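(* Let $Y$ be a compact hyperbolic Riemann surface and let $\ell\subset Y$ be a closed geodesic. There exists a constant $C''_\ell>0$ such that for every eigenfunction $\phi_i$ of the Laplace-Beltrami operator on $Y$ with $\|\phi_i\|_{L^2(Y)}=1$, $$\left|p_0^\ell(\phi_i)\right|=\left|\int_\ell\phi_i(t_\ell(\theta))\,d\ell\right|\leq C''_\ell .$$
   Context: $Y$ is a compact connected Riemann surface with a Riemannian metric of constant curvature $-1$ and volume element $dv$; eigenfunctions are normalized to have norm one in $L^2(Y,dv)$. $t_\ell:\mathbb R/\mathbb Z\to\ell$ is the constant speed parametrization of the closed geodesic $\ell$ and $d\ell=\mathrm{length}(\ell)\,d\theta$ is the line element. *)

theory Defs
  imports "HOL-Complex_Analysis.Complex_Analysis"
begin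

section \<open>Calculus on open subsets of the complex plane\<close>

definition partial_x :: "(complex \<Rightarrow> 'b::real_normed_vector) \<Rightarrow> complex \<Rightarrow> 'b" where
  "partial_x f z = vector_derivative (\<lambda>t::real. f (z + of_real t)) (at 0)"

definition partial_y :: "(complex \<Rightarrow> 'b::real_normed_vector) \<Rightarrow> complex \<Rightarrow> 'b" where
  "partial_y f z = vector_derivative (\<lambda>t::real. f (z + \<i> * of_real t)) (at 0)"

definition flat_laplacian :: "(complex \<Rightarrow> 'b::real_normed_vector) \<Rightarrow> complex \<Rightarrow> 'b" where
  "flat_laplacian f z = partial_x (partial_x f) z + partial_y (partial_y f) z"

text \<open>The Wirtinger derivative of a real-valued function.\<close>

definition wirtinger_dz :: "(complex \<Rightarrow> real) \<Rightarrow> complex \<Rightarrow> complex" where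
  "wirtinger_dz f z = (of_real (partial_x f z) - \<i> * of_real (partial_y f z)) / 2"

primrec Ck_on :: "nat \<Rightarrow> complex set \<Rightarrow> (complex \<Rightarrow> 'b::real_normed_vector) \<Rightarrow> bool" where
  "Ck_on 0 S f \<longleftrightarrow> continuous_on S f"
| "Ck_on (Suc k) S f \<longleftrightarrow>
     f differentiable_on S \<and> Ck_on k S (partial_x f) \<and> Ck_on k S (partial_y f)"

definition smooth_on :: "complex set \<Rightarrow> (complex \<Rightarrow> 'b::real_normed_vector) \<Rightarrow> bool" where
  "smooth_on S f \<longleftrightarrow> (\<forall>k. Ck_on k S f)"

section \<open>Riemann surfaces with a conformal metric\<close>

text \<open>The underlying space of the surface is the whole type \<^typ>\<open>'a\<close>. The values of
  \<open>coord c\<close> outside \<open>patch c\<close> are irrelevant, and so are those of \<open>param c\<close> outside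
  \<open>coord_dom c\<close>.\<close>

datatype 'a chart = Chart (patch: "'a set") (coord: "'a \<Rightarrow> complex")

definition coord_dom :: "'a chart \<Rightarrow> complex set" where
  "coord_dom c = coord c ` patch c"

definition param :: "'a chart \<Rightarrow> complex \<Rightarrow> 'a" where
  "param c = inv_into (patch c) (coord c)"

definition riemann_surface :: "'a::t2_space chart set \<Rightarrow> bool" where
  "riemann_surface A \<longleftrightarrow>
     (\<Union>c\<in>A. patch c) = UNIV \<and>
     (\<forall>c\<in>A. open (patch c) \<and> open (coord_dom c) \<and>
        homeomorphism (patch c) (coord_dom c) (coord c) (param c)) \<and>
     (\<forall>c\<in>A. \<forall>d\<in>A. (coord d \<circ> param c) holomorphic_on coord c ` (patch c \<inter> patch d))"

text \<open>\<open>\<rho> c\<close> is the density of the metric in the chart \<open>c\<close>: the Riemannian metric is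
  \<open>\<rho> c z |dz|\<^sup>2\<close>, with \<open>z\<close> the coordinate of \<open>c\<close>. The last clause says that these local
  expressions glue to a metric on the surface.\<close>

definition conformal_metric ::
  "'a::t2_space chart set \<Rightarrow> ('a chart \<Rightarrow> complex \<Rightarrow> real) \<Rightarrow> bool" where
  "conformal_metric A \<rho> \<longleftrightarrow>
     (\<forall>c\<in>A. smooth_on (coord_dom c) (\<rho> c) \<and> (\<forall>z\<in>coord_dom c. \<rho> c z > 0)) \<and>
     (\<forall>c\<in>A. \<forall>d\<in>A. \<forall>z\<in>coord c ` (patch c \<inter> patch d).
        \<rho> c z = \<rho> d (coord d (param c z)) * (cmod (deriv (coord d \<circ> param c) z))\<^sup>2)"

text \<open>Gaussian curvature of \<open>r z |dz|\<^sup>2\<close>.\<close>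

definition gauss_curvature :: "(complex \<Rightarrow> real) \<Rightarrow> complex \<Rightarrow> real" where
  "gauss_curvature r z = - flat_laplacian (\<lambda>w. ln (r w)) z / (2 * r z)"

definition compact_hyperbolic_surface ::
  "'a::t2_space chart set \<Rightarrow> ('a chart \<Rightarrow> complex \<Rightarrow> real) \<Rightarrow> bool" where
  "compact_hyperbolic_surface A \<rho> \<longleftrightarrow>
     riemann_surface A \<and> compact (UNIV :: 'a set) \<and> connected (UNIV :: 'a set) \<and>
     conformal_metric A \<rho> \<and>
     (\<forall>c\<in>A. \<forall>z\<in>coord_dom c. gauss_curvature (\<rho> c) z = -1)"

text \<open>The quantities defined below with \<open>chart_at\<close> are invariant under change of chart, so the
  choice does not matter.\<close>

definition chart_at :: "'a chart set \<Rightarrow> 'a \<Rightarrow> 'a chart" where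
  "chart_at A y = (SOME c. c \<in> A \<and> y \<in> patch c)"

text \<open>The Riemannian volume element \<open>dv\<close>. The condition determines the measure, as the surface
  is a finite union of chart domains.\<close>

definition is_volume_measure ::
  "'a::t2_space chart set \<Rightarrow> ('a chart \<Rightarrow> complex \<Rightarrow> real) \<Rightarrow> 'a measure \<Rightarrow> bool" where
  "is_volume_measure A \<rho> v \<longleftrightarrow>
     sets v = sets borel \<and>
     (\<forall>c\<in>A. \<forall>B\<in>sets borel. B \<subseteq> patch c \<longrightarrow>
        emeasure v B = (\<integral>\<^sup>+z\<in>coord c ` B. ennreal (\<rho> c z) \<partial>lborel))"

section \<open>Laplace-Beltrami operator\<close>

definition smooth_function :: "'a::t2_space chart set \<Rightarrow> ('a \<Rightarrow> complex) \<Rightarrow> bool" where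
  "smooth_function A \<phi> \<longleftrightarrow> (\<forall>c\<in>A. smooth_on (coord_dom c) (\<phi> \<circ> param c))"

definition laplace_beltrami ::
  "'a::t2_space chart set \<Rightarrow> ('a chart \<Rightarrow> complex \<Rightarrow> real) \<Rightarrow> ('a \<Rightarrow> complex) \<Rightarrow> 'a \<Rightarrow> complex" where
  "laplace_beltrami A \<rho> \<phi> y =
     (let c = chart_at A y; z = coord c y
      in flat_laplacian (\<phi> \<circ> param c) z / of_real (\<rho> c z))"

text \<open>The eigenvalue is an arbitrary complex number; that it is real (and of which sign) is a
  property of the operator and not part of the definition.\<close>

definition eigenfunction ::
  "'a::t2_space chart set \<Rightarrow> ('a chart \<Rightarrow> complex \<Rightarrow> real) \<Rightarrow> ('a \<Rightarrow> complex) \<Rightarrow> bool" where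
  "eigenfunction A \<rho> \<phi> \<longleftrightarrow>
     smooth_function A \<phi> \<and> (\<exists>y. \<phi> y \<noteq> 0) \<and>
     (\<exists>\<mu>. \<forall>y. laplace_beltrami A \<rho> \<phi> y = \<mu> * \<phi> y)"

definition L2_norm :: "'a measure \<Rightarrow> ('a \<Rightarrow> complex) \<Rightarrow> real" where
  "L2_norm v \<phi> = sqrt (\<integral>y. (cmod (\<phi> y))\<^sup>2 \<partial>v)"

section \<open>Closed geodesics and periods\<close>

definition speed ::
  "'a::t2_space chart set \<Rightarrow> ('a chart \<Rightarrow> complex \<Rightarrow> real) \<Rightarrow> (real \<Rightarrow> 'a) \<Rightarrow> real \<Rightarrow> real" where
  "speed A \<rho> t \<theta> =
     (let c = chart_at A (t \<theta>)
      in sqrt (\<rho> c (coord c (t \<theta>))) * cmod (vector_derivative (coord c \<circ> t) (at \<theta>)))"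

text \<open>For the metric \<open>\<rho> |dz|\<^sup>2\<close> the geodesic equation reads
  \<open>z'' + (\<partial> ln \<rho> / \<partial>z) (z')\<^sup>2 = 0\<close>.\<close>

definition geodesic ::
  "'a::t2_space chart set \<Rightarrow> ('a chart \<Rightarrow> complex \<Rightarrow> real) \<Rightarrow> (real \<Rightarrow> 'a) \<Rightarrow> bool" where
  "geodesic A \<rho> t \<longleftrightarrow>
     continuous_on UNIV t \<and>
     (\<forall>c\<in>A. \<forall>\<theta>. t \<theta> \<in> patch c \<longrightarrow>
        (let z = coord c \<circ> t; z' = (\<lambda>s. vector_derivative z (at s))
         in z differentiable at \<theta> \<and> z' differentiable at \<theta> \<and>
            vector_derivative z' (at \<theta>) +
              wirtinger_dz (\<lambda>w. ln (\<rho> c w)) (z \<theta>) * (z' \<theta>)\<^sup>2 = 0))"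

text \<open>A closed geodesic is given by a parametrization of constant nonzero speed by
  \<open>\<real>/\<int>\<close>, that is, by a 1-periodic map on the line.\<close>

definition closed_geodesic ::
  "'a::t2_space chart set \<Rightarrow> ('a chart \<Rightarrow> complex \<Rightarrow> real) \<Rightarrow> (real \<Rightarrow> 'a) \<Rightarrow> bool" where
  "closed_geodesic A \<rho> t \<longleftrightarrow>
     geodesic A \<rho> t \<and> (\<forall>\<theta>. t (\<theta> + 1) = t \<theta>) \<and>
     (\<exists>s>0. \<forall>\<theta>. speed A \<rho> t \<theta> = s)"

definition curve_length ::
  "'a::t2_space chart set \<Rightarrow> ('a chart \<Rightarrow> complex \<Rightarrow> real) \<Rightarrow> (real \<Rightarrow> 'a) \<Rightarrow> real" where
  "curve_length A \<rho> t = integral {0..1} (speed A \<rho> t)"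

text \<open>Integration against the line element \<open>length d\<theta>\<close>.\<close>

definition geodesic_period ::
  "'a::t2_space chart set \<Rightarrow> ('a chart \<Rightarrow> complex \<Rightarrow> real) \<Rightarrow> (real \<Rightarrow> 'a) \<Rightarrow>
     ('a \<Rightarrow> complex) \<Rightarrow> complex" where
  "geodesic_period A \<rho> t \<phi> =
     integral {0..1} (\<lambda>\<theta>. \<phi> (t \<theta>) * of_real (curve_length A \<rho> t))"

end

theory Submission
  imports Defs
begin

text \<open>
  Near each of its points the closed geodesic lies on the real axis of a \<^emph>\<open>strip coordinate\<close>
  \<open>u = x + iy\<close>, a holomorphic coordinate in which the metric is \<open>|du|\<^sup>2 / (cos y)\<^sup>2\<close>. The
  curves \<open>y = const\<close> are the curves at constant distance from the geodesic. An eigenfunction becomes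
  a function \<open>f\<close> with \<open>\<Delta>f = \<mu> f / (cos y)\<^sup>2\<close> for the flat Laplacian, and since the
  factor on the right depends on \<open>y\<close> alone, its weighted averages
  \<open>F y = \<integral> B(x) f(x + iy) dx\<close> over a segment satisfy an ordinary differential equation: two
  integrations by parts in \<open>x\<close> give \<open>F'' = \<mu> F / (cos y)\<^sup>2 + R\<close>, where \<open>R\<close> averages
  \<open>f\<close> with the weight \<open>- B''\<close>. Both \<open>F\<close> and \<open>R\<close> are bounded in \<open>L\<^sup>2\<close> by the
  norm of the eigenfunction, with a constant independent of \<open>\<mu>\<close>.

  The even part of \<open>F\<close> has the same value at \<open>0\<close>, and its derivative vanishes there. Such a
  solution looks like a multiple of a cosine or a hyperbolic cosine, whose mean square over a fixed
  interval is bounded below however large \<open>|\<mu>|\<close> is. Hence \<open>|F 0|\<close> is controlled by the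
  \<open>L\<^sup>2\<close> norms of \<open>F\<close> and \<open>R\<close>, uniformly in \<open>\<mu>\<close>; this is
  \<open>sec_squared_ode_bound\<close>, and \<open>strip_average_bound\<close> is its consequence for averages. Finitely
  many windows with weights adding up to one cover the geodesic
  (\<open>periodic_integral_partition\<close>), and the period is the sum of the corresponding values \<open>F 0\<close>.

  The strip coordinate comes from Liouville's description of metrics \<open>r |dz|\<^sup>2\<close> of curvature
  \<open>-1\<close>. For \<open>\<psi> = 1 / sqrt r\<close> the quotient \<open>P = \<psi>\<^sub>z\<^sub>z / \<psi>\<close> is holomorphic
  (\<open>schwarzian_holomorphic\<close>), so that \<open>\<psi>\<close> is a Hermitian form in two holomorphic
  solutions \<open>y1, y2\<close> of \<open>y'' = P y\<close>; with suitable initial values it is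
  \<open>Re (y1 * cnj y2)\<close> (\<open>liouville_product_form\<close>), and \<open>Ln (y1 / y2)\<close> is the coordinate
  (\<open>strip_coordinate\<close>). The initial values make the geodesic start on the real axis tangentially
  to it, and uniqueness for the geodesic equation keeps it there
  (\<open>geodesic_straight_in_strip\<close>).
\<close>

section \<open>Calculus on plane domains\<close>

lemma partials_of_has_derivative:
  assumes "(f has_derivative D) (at z)"
  shows "partial_x f z = D 1" "partial_y f z = D \<i>"
proof -
  have lin: "linear D" using assms has_derivative_linear by blast
  have "((\<lambda>t::real. f (z + of_real t)) has_derivative (\<lambda>t. D (of_real t))) (at 0)"
    by (rule has_derivative_compose[of "\<lambda>t::real. z + of_real t" of_real _ _ f D, unfolded o_def])
      (use assms in \<open>auto intro!: derivative_eq_intros\<close>)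
  moreover have "D (of_real t) = t *\<^sub>R D 1" for t
    by (metis lin linear_cmul of_real_def)
  ultimately have "((\<lambda>t::real. f (z + of_real t)) has_vector_derivative D 1) (at 0)"
    by (simp add: has_vector_derivative_def)
  then show "partial_x f z = D 1"
    unfolding partial_x_def by (rule vector_derivative_at)
  have "((\<lambda>t::real. f (z + \<i> * of_real t)) has_derivative (\<lambda>t. D (\<i> * of_real t))) (at 0)"
    by (rule has_derivative_compose[of "\<lambda>t::real. z + \<i> * of_real t" "\<lambda>t. \<i> * of_real t" _ _ f D, unfolded o_def])
      (use assms in \<open>auto intro!: derivative_eq_intros\<close>)
  moreover have "D (\<i> * of_real t) = t *\<^sub>R D \<i>" for t
    by (metis lin linear_cmul scaleR_conv_of_real mult.commute)
  ultimately have "((\<lambda>t::real. f (z + \<i> * of_real t)) has_vector_derivative D \<i>) (at 0)"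
    by (simp add: has_vector_derivative_def)
  then show "partial_y f z = D \<i>"
    unfolding partial_y_def by (rule vector_derivative_at)
qed

lemma has_derivative_partials:
  assumes "f differentiable (at z)"
  shows "(f has_derivative (\<lambda>h. Re h *\<^sub>R partial_x f z + Im h *\<^sub>R partial_y f z)) (at z)"
proof -
  obtain D where D: "(f has_derivative D) (at z)" using assms by (auto simp: differentiable_def)
  have lin: "linear D" using D has_derivative_linear by blast
  have "D h = Re h *\<^sub>R D 1 + Im h *\<^sub>R D \<i>" for h
  proof -
    have "h = Re h *\<^sub>R 1 + Im h *\<^sub>R \<i>" by (simp add: complex_eq_iff)
    then show ?thesis by (metis lin linear_add linear_cmul)
  qed
  then have "D = (\<lambda>h. Re h *\<^sub>R partial_x f z + Im h *\<^sub>R partial_y f z)"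
    unfolding partials_of_has_derivative[OF D] by (intro ext)
  then show ?thesis using D by simp
qed

lemma partials_cong:
  assumes "open S" "z \<in> S" "\<And>w. w \<in> S \<Longrightarrow> f w = g w"
  shows "partial_x f z = partial_x g z" "partial_y f z = partial_y g z"
proof -
  have *: "eventually (\<lambda>t::real. z + c * of_real t \<in> S) (nhds 0)" for c
  proof -
    have "((\<lambda>t::real. z + c * of_real t) \<longlongrightarrow> z + c * of_real 0) (nhds 0)"
      by (intro tendsto_intros) (auto simp: filterlim_ident)
    then show ?thesis
      using assms(1,2) by (simp add: tendsto_def)
  qed
  show "partial_x f z = partial_x g z"
    unfolding partial_x_def
    by (rule vector_derivative_cong_eq) (use *[of 1] assms(3) in \<open>auto elim!: eventually_mono\<close>)
  show "partial_y f z = partial_y g z"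
    unfolding partial_y_def
    by (rule vector_derivative_cong_eq) (use *[of \<i>] assms(3) in \<open>auto elim!: eventually_mono\<close>)
qed

lemma differentiable_on_cong:
  assumes "f differentiable_on S" "\<And>w. w \<in> S \<Longrightarrow> f w = g w"
  shows "g differentiable_on S"
  unfolding differentiable_on_def
proof
  fix x assume x: "x \<in> S"
  obtain D where "(f has_derivative D) (at x within S)"
    using assms(1) x by (auto simp: differentiable_on_def differentiable_def)
  then have "(g has_derivative D) (at x within S)"
    by (rule has_derivative_transform[OF x, rotated]) (use assms(2) in auto)
  then show "g differentiable (at x within S)" by (auto simp: differentiable_def)
qed

lemma Ck_on_cong:
  assumes "open S" "\<And>w. w \<in> S \<Longrightarrow> f w = g w" "Ck_on k S f"
  shows "Ck_on k S g"
  using assms(2,3)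
proof (induction k arbitrary: f g)
  case 0
  then show ?case using continuous_on_cong[of S S f g] by simp
next
  case (Suc k)
  have "g differentiable_on S"
    using Suc.prems differentiable_on_cong[of f S g] by auto
  then show ?case
    using Suc.prems Suc.IH[of "partial_x f" "partial_x g"] Suc.IH[of "partial_y f" "partial_y g"]
      partials_cong[OF assms(1), of _ f g] by auto
qed

lemma Ck_on_Suc_imp: "Ck_on (Suc k) S f \<Longrightarrow> Ck_on k S f"
proof (induction k arbitrary: f)
  case 0
  then show ?case by (simp add: differentiable_imp_continuous_on)
next
  case (Suc k)
  have "f differentiable_on S" "Ck_on (Suc k) S (partial_x f)" "Ck_on (Suc k) S (partial_y f)"
    using Suc.prems by simp_all
  then show ?case using Suc.IH[of "partial_x f"] Suc.IH[of "partial_y f"] unfolding Ck_on.simps(2)[of k S f] by blast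
qed

lemma Ck_on_diffD:
  assumes "Ck_on (Suc k) S f" "open S" "z \<in> S"
  shows "f differentiable (at z)"
  using assms by (simp add: differentiable_on_eq_differentiable_at)

lemma Ck_on_SucI:
  assumes "open S" "\<And>z. z \<in> S \<Longrightarrow> f differentiable (at z)"
    and "\<And>z. z \<in> S \<Longrightarrow> partial_x f z = fx z" "\<And>z. z \<in> S \<Longrightarrow> partial_y f z = fy z"
    and "Ck_on k S fx" "Ck_on k S fy"
  shows "Ck_on (Suc k) S f"
proof -
  have "Ck_on k S (partial_x f)"
    by (rule Ck_on_cong[OF assms(1) _ assms(5)]) (simp add: assms(3))
  moreover have "Ck_on k S (partial_y f)"
    by (rule Ck_on_cong[OF assms(1) _ assms(6)]) (simp add: assms(4))
  ultimately show ?thesis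
    using assms(1,2) by (simp add: differentiable_on_eq_differentiable_at)
qed

lemma Ck_on_add:
  assumes "open S" "Ck_on k S f" "Ck_on k S g"
  shows "Ck_on k S (\<lambda>z. f z + g z)"
  using assms(2,3)
proof (induction k arbitrary: f g)
  case 0
  then show ?case by (auto intro: continuous_intros)
next
  case (Suc k)
  have d: "f differentiable (at z)" "g differentiable (at z)" if "z \<in> S" for z
    using Ck_on_diffD[OF Suc.prems(1) assms(1) that] Ck_on_diffD[OF Suc.prems(2) assms(1) that] .
  note p = partials_of_has_derivative[OF has_derivative_add[OF has_derivative_partials[OF d(1)] has_derivative_partials[OF d(2)]]]
  show ?case
  proof (rule Ck_on_SucI[OF assms(1), where fx = "\<lambda>z. partial_x f z + partial_x g z"
        and fy = "\<lambda>z. partial_y f z + partial_y g z"])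
    show "(\<lambda>z. f z + g z) differentiable (at z)" if "z \<in> S" for z
      using d[OF that] by (rule differentiable_add)
    show "partial_x (\<lambda>z. f z + g z) z = partial_x f z + partial_x g z"
      "partial_y (\<lambda>z. f z + g z) z = partial_y f z + partial_y g z" if "z \<in> S" for z
      using p[OF that that] by simp_all
  qed (use Suc in auto)
qed

lemma Ck_on_mult:
  fixes f g :: "complex \<Rightarrow> 'b::real_normed_algebra"
  assumes "open S" "Ck_on k S f" "Ck_on k S g"
  shows "Ck_on k S (\<lambda>z. f z * g z)"
  using assms(2,3)
proof (induction k arbitrary: f g)
  case 0
  then show ?case by (auto intro: continuous_intros)
next
  case (Suc k)
  have d: "f differentiable (at z)" "g differentiable (at z)" if "z \<in> S" for z
    using Ck_on_diffD[OF Suc.prems(1) assms(1) that] Ck_on_diffD[OF Suc.prems(2) assms(1) that] .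
  note p = partials_of_has_derivative[OF has_derivative_mult[OF has_derivative_partials[OF d(1)] has_derivative_partials[OF d(2)]]]
  have C: "Ck_on k S f" "Ck_on k S g"
    "Ck_on k S (partial_x f)" "Ck_on k S (partial_y f)" "Ck_on k S (partial_x g)" "Ck_on k S (partial_y g)"
    using Ck_on_Suc_imp[OF Suc.prems(1)] Ck_on_Suc_imp[OF Suc.prems(2)] Suc.prems by simp_all
  show ?case
  proof (rule Ck_on_SucI[OF assms(1), where fx = "\<lambda>z. f z * partial_x g z + partial_x f z * g z"
        and fy = "\<lambda>z. f z * partial_y g z + partial_y f z * g z"])
    show "(\<lambda>z. f z * g z) differentiable (at z)" if "z \<in> S" for z
      using d[OF that] by (rule differentiable_mult)
    show "partial_x (\<lambda>z. f z * g z) z = f z * partial_x g z + partial_x f z * g z"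
      "partial_y (\<lambda>z. f z * g z) z = f z * partial_y g z + partial_y f z * g z" if "z \<in> S" for z
      using p[OF that that] by simp_all
    show "Ck_on k S (\<lambda>z. f z * partial_x g z + partial_x f z * g z)"
      by (rule Ck_on_add[OF assms(1) Suc.IH[OF C(1,5)] Suc.IH[OF C(3,2)]])
    show "Ck_on k S (\<lambda>z. f z * partial_y g z + partial_y f z * g z)"
      by (rule Ck_on_add[OF assms(1) Suc.IH[OF C(1,6)] Suc.IH[OF C(4,2)]])
  qed
qed

lemma partials_const: "partial_x (\<lambda>z. c) = (\<lambda>z. 0)" "partial_y (\<lambda>z. c) = (\<lambda>z. 0)"
  unfolding partial_x_def partial_y_def by simp_all

lemma Ck_on_const: "Ck_on k S (\<lambda>z. c)"
proof (induction k arbitrary: c)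
  case 0
  show ?case unfolding Ck_on.simps(1) by (rule continuous_on_const)
next
  case (Suc k)
  show ?case
    unfolding Ck_on.simps(2) partials_const using Suc[of 0] differentiable_on_const by blast
qed

text \<open>The derivative of \<open>p = 1 / sqrt r\<close> is \<open>- p\<^sup>3 / 2\<close> times that of \<open>r\<close>, so the induction on the
  order of differentiability runs on products alone.\<close>

lemma Ck_on_inverse_sqrt:
  assumes "open S" "Ck_on k S r" "\<And>z. z \<in> S \<Longrightarrow> r z > 0"
  shows "Ck_on k S (\<lambda>z. 1 / sqrt (r z))"
  using assms(2)
proof (induction k)
  case 0
  have "sqrt (r z) \<noteq> 0" if "z \<in> S" for z using assms(3)[OF that] by simp
  then show ?case using 0 by (auto intro!: continuous_intros)
next
  case (Suc k)
  let ?p = "\<lambda>z. 1 / sqrt (r z)"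
  have IH: "Ck_on k S ?p" using Suc Ck_on_Suc_imp by blast
  have hd: "(?p has_derivative (\<lambda>h. (-1/2 * (?p z * (?p z * ?p z))) * (Re h *\<^sub>R partial_x r z + Im h *\<^sub>R partial_y r z))) (at z)"
    if "z \<in> S" for z
  proof -
    have d: "(r has_derivative (\<lambda>h. Re h *\<^sub>R partial_x r z + Im h *\<^sub>R partial_y r z)) (at z)"
      using Ck_on_diffD[OF Suc.prems assms(1) that] by (rule has_derivative_partials)
    have "((\<lambda>x. 1 / sqrt x) has_real_derivative - 1/2 * (1/sqrt x * (1/sqrt x * (1/sqrt x)))) (at x)" if "x > 0" for x
      using that by (auto intro!: derivative_eq_intros simp: field_simps)
    from this[OF assms(3)[OF that]] have "((\<lambda>x. 1 / sqrt x) has_derivative (\<lambda>h. (- 1/2 * (?p z * (?p z * ?p z))) * h)) (at (r z))"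
      unfolding has_field_derivative_def .
    from has_derivative_compose[OF d this] show ?thesis .
  qed
  have p: "partial_x ?p z = -1/2 * (?p z * (?p z * ?p z)) * partial_x r z"
     "partial_y ?p z = -1/2 * (?p z * (?p z * ?p z)) * partial_y r z" if "z \<in> S" for z
    using partials_of_has_derivative[OF hd[OF that]] by auto
  have *: "Ck_on k S (\<lambda>z. -1/2 * (?p z * (?p z * ?p z)))"
    by (intro Ck_on_mult[OF assms(1)] Ck_on_const IH)
  show ?case
  proof (rule Ck_on_SucI[OF assms(1) _ p])
    show "?p differentiable (at z)" if "z \<in> S" for z
      using hd[OF that] differentiable_def by blast
    show "Ck_on k S (\<lambda>z. -1/2 * (?p z * (?p z * ?p z)) * partial_x r z)"
      using Suc.prems by (intro Ck_on_mult[OF assms(1) *]) simp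
    show "Ck_on k S (\<lambda>z. -1/2 * (?p z * (?p z * ?p z)) * partial_y r z)"
      using Suc.prems by (intro Ck_on_mult[OF assms(1) *]) simp
  qed
qed

lemma partials_holomorphic_comp:
  assumes "h differentiable (at (g z))" "(g has_field_derivative d) (at z)"
  shows "(h \<circ> g) differentiable (at z)"
    "partial_x (h \<circ> g) z = Re d *\<^sub>R partial_x h (g z) + Im d *\<^sub>R partial_y h (g z)"
    "partial_y (h \<circ> g) z = Re d *\<^sub>R partial_y h (g z) - Im d *\<^sub>R partial_x h (g z)"
proof -
  have "(g has_derivative (\<lambda>v. d * v)) (at z)" using assms(2) by (simp add: has_field_derivative_def)
  from has_derivative_compose[OF this has_derivative_partials[OF assms(1)]]
  have *: "(h \<circ> g has_derivative (\<lambda>v. Re (d * v) *\<^sub>R partial_x h (g z) + Im (d * v) *\<^sub>R partial_y h (g z))) (at z)"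
    by (simp add: o_def)
  show "(h \<circ> g) differentiable (at z)" using * differentiable_def by blast
  show "partial_x (h \<circ> g) z = Re d *\<^sub>R partial_x h (g z) + Im d *\<^sub>R partial_y h (g z)"
    "partial_y (h \<circ> g) z = Re d *\<^sub>R partial_y h (g z) - Im d *\<^sub>R partial_x h (g z)"
    using partials_of_has_derivative[OF *] by auto
qed

lemma holomorphic_partials:
  assumes "(d has_field_derivative e) (at z)"
  shows "((\<lambda>z. Re (d z)) has_derivative (\<lambda>v. Re (e * v))) (at z)"
    "((\<lambda>z. Im (d z)) has_derivative (\<lambda>v. Im (e * v))) (at z)"
  using assms bounded_linear.has_derivative[OF bounded_linear_Re] bounded_linear.has_derivative[OF bounded_linear_Im]
  unfolding has_field_derivative_def by blast+

text \<open>Conformal invariance of the Laplacian: in the second derivatives of \<open>h \<circ> g\<close> the mixed derivatives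
  of \<open>h\<close> cancel in pairs, and the terms with first derivatives of \<open>h\<close> cancel by the
  Cauchy-Riemann equations for \<open>g'\<close>.\<close>

lemma Ck2_holomorphic_comp:
  fixes h :: "complex \<Rightarrow> 'b::real_normed_vector"
  assumes "open S" "open T" "g holomorphic_on T" "g ` T \<subseteq> S" "Ck_on 2 S h"
  shows "Ck_on 2 T (h \<circ> g)"
    and "\<And>z. z \<in> T \<Longrightarrow> flat_laplacian (h \<circ> g) z = (cmod (deriv g z))\<^sup>2 *\<^sub>R flat_laplacian h (g z)"
proof -
  let ?d = "deriv g" and ?e = "deriv (deriv g)"
  have dg: "(g has_field_derivative ?d z) (at z)" if "z \<in> T" for z
    using assms(2,3) that holomorphic_derivI by blast
  have dd: "(?d has_field_derivative ?e z) (at z)" if "z \<in> T" for z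
    using assms(2,3) that holomorphic_deriv holomorphic_derivI by blast
  note [simp] = numeral_2_eq_2
  have h: "h differentiable at z" "partial_x h differentiable at z" "partial_y h differentiable at z" if "z \<in> S" for z
    using assms(1,5) that by (auto simp: differentiable_on_eq_differentiable_at)
  have hc: "continuous_on S (partial_x (partial_x h))" "continuous_on S (partial_x (partial_y h))"
     "continuous_on S (partial_y (partial_x h))" "continuous_on S (partial_y (partial_y h))"
     "continuous_on S (partial_x h)" "continuous_on S (partial_y h)"
    using assms(5) by (auto intro: differentiable_imp_continuous_on)
  have gc: "continuous_on T g" "continuous_on T ?d" "continuous_on T ?e"
    using assms(2,3) by (auto intro!: holomorphic_on_imp_continuous_on holomorphic_deriv)
  have gS: "g z \<in> S" if "z \<in> T" for z using assms(4) that by auto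
  note [continuous_intros] = continuous_on_compose2[OF hc(1) gc(1)] continuous_on_compose2[OF hc(2) gc(1)]
    continuous_on_compose2[OF hc(3) gc(1)] continuous_on_compose2[OF hc(4) gc(1)]
    continuous_on_compose2[OF hc(5) gc(1)] continuous_on_compose2[OF hc(6) gc(1)]
  let ?X = "\<lambda>z. Re (?d z) *\<^sub>R (partial_x h \<circ> g) z + Im (?d z) *\<^sub>R (partial_y h \<circ> g) z"
  let ?Y = "\<lambda>z. Re (?d z) *\<^sub>R (partial_y h \<circ> g) z - Im (?d z) *\<^sub>R (partial_x h \<circ> g) z"
  have X: "partial_x (h \<circ> g) z = ?X z" and Y: "partial_y (h \<circ> g) z = ?Y z" if "z \<in> T" for z
    using partials_holomorphic_comp[OF h(1)[OF gS[OF that]] dg[OF that]] by auto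
  let ?D1 = "\<lambda>z v. Re v *\<^sub>R partial_x (partial_x h \<circ> g) z + Im v *\<^sub>R partial_y (partial_x h \<circ> g) z"
  let ?D2 = "\<lambda>z v. Re v *\<^sub>R partial_x (partial_y h \<circ> g) z + Im v *\<^sub>R partial_y (partial_y h \<circ> g) z"
  have hX: "(?X has_derivative (\<lambda>v. (Re (?d z) *\<^sub>R ?D1 z v + Re (?e z * v) *\<^sub>R (partial_x h \<circ> g) z)
      + (Im (?d z) *\<^sub>R ?D2 z v + Im (?e z * v) *\<^sub>R (partial_y h \<circ> g) z))) (at z)"
   and hY: "(?Y has_derivative (\<lambda>v. (Re (?d z) *\<^sub>R ?D2 z v + Re (?e z * v) *\<^sub>R (partial_y h \<circ> g) z)
      - (Im (?d z) *\<^sub>R ?D1 z v + Im (?e z * v) *\<^sub>R (partial_x h \<circ> g) z))) (at z)" if z: "z \<in> T" for z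
    by (intro has_derivative_add has_derivative_diff has_derivative_scaleR holomorphic_partials[OF dd[OF z]]
      has_derivative_partials partials_holomorphic_comp(1)[OF h(2)[OF gS[OF z]] dg[OF z]]
      partials_holomorphic_comp(1)[OF h(3)[OF gS[OF z]] dg[OF z]])+
  note E = partials_holomorphic_comp(2,3)[OF h(2)[OF gS] dg] partials_holomorphic_comp(2,3)[OF h(3)[OF gS] dg]
  note pX = partials_of_has_derivative[OF hX] and pY = partials_of_has_derivative[OF hY]
  have pc: "partial_x (partial_x (h \<circ> g)) z = partial_x ?X z" "partial_y (partial_x (h \<circ> g)) z = partial_y ?X z"
     "partial_x (partial_y (h \<circ> g)) z = partial_x ?Y z" "partial_y (partial_y (h \<circ> g)) z = partial_y ?Y z" if "z \<in> T" for z
    using partials_cong[OF assms(2) that, of "partial_x (h \<circ> g)" ?X]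
     partials_cong[OF assms(2) that, of "partial_y (h \<circ> g)" ?Y] X Y by auto
  have dfX: "?X differentiable_on T" and dfY: "?Y differentiable_on T"
    using hX hY assms(2) unfolding differentiable_on_eq_differentiable_at[OF assms(2)] differentiable_def by blast+
  have "h \<circ> g differentiable_on T"
    using partials_holomorphic_comp(1)[OF h(1)[OF gS] dg] assms(2)
    by (auto simp: differentiable_on_eq_differentiable_at)
  moreover have "partial_x (h \<circ> g) differentiable_on T"
    using dfX differentiable_on_cong[OF dfX, of "partial_x (h \<circ> g)"] X by force
  moreover have "partial_y (h \<circ> g) differentiable_on T"
    using dfY differentiable_on_cong[OF dfY, of "partial_y (h \<circ> g)"] Y by force
  moreover have "continuous_on T (partial_x (partial_x (h \<circ> g)))"
    by (subst continuous_on_cong[OF refl pc(1)], assumption, simp only: pX E cong: continuous_on_cong)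
     (auto intro!: continuous_intros gc gS)
  moreover have "continuous_on T (partial_y (partial_x (h \<circ> g)))"
    by (subst continuous_on_cong[OF refl pc(2)], assumption, simp only: pX E cong: continuous_on_cong)
     (auto intro!: continuous_intros gc gS)
  moreover have "continuous_on T (partial_x (partial_y (h \<circ> g)))"
    by (subst continuous_on_cong[OF refl pc(3)], assumption, simp only: pY E cong: continuous_on_cong)
     (auto intro!: continuous_intros gc gS)
  moreover have "continuous_on T (partial_y (partial_y (h \<circ> g)))"
    by (subst continuous_on_cong[OF refl pc(4)], assumption, simp only: pY E cong: continuous_on_cong)
     (auto intro!: continuous_intros gc gS)
  ultimately show "Ck_on 2 T (h \<circ> g)"
    by simp
  show "flat_laplacian (h \<circ> g) z = (cmod (deriv g z))\<^sup>2 *\<^sub>R flat_laplacian h (g z)" if z: "z \<in> T" for z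
    unfolding flat_laplacian_def pc[OF z] cmod_power2 pX[OF z] pY[OF z] E[OF z z]
    by (simp add: algebra_simps power2_eq_square)
qed

section \<open>Two estimates for ordinary differential equations\<close>

text \<open>Uniqueness in both directions of time: \<open>exp (- C t) * E t\<close> cannot increase to the right of the
  zero and \<open>exp (C t) * E t\<close> cannot decrease to the left of it.\<close>

lemma gronwall_zero:
  fixes E E' :: "real \<Rightarrow> real"
  assumes der: "\<And>t. t \<in> {a..b} \<Longrightarrow> (E has_real_derivative E' t) (at t)"
    and bnd: "\<And>t. t \<in> {a..b} \<Longrightarrow> \<bar>E' t\<bar> \<le> C * E t"
    and nonneg: "\<And>t. t \<in> {a..b} \<Longrightarrow> E t \<ge> 0"
    and t0: "t0 \<in> {a..b}" "E t0 = 0" and t: "t \<in> {a..b}"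
  shows "E t = 0"
proof (cases "t \<ge> t0")
  case True
  have "exp (- C * t) * E t \<le> exp (- C * t0) * E t0"
  proof (rule DERIV_nonpos_imp_nonincreasing[OF True])
    fix x assume x: "t0 \<le> x" "x \<le> t"
    then have "x \<in> {a..b}" using t0 t by auto
    then show "\<exists>y. ((\<lambda>t. exp (- C * t) * E t) has_real_derivative y) (at x) \<and> y \<le> 0"
      by (intro exI[of _ "exp (- C * x) * (E' x - C * E x)"] conjI)
        (use bnd[of x] in \<open>auto intro!: derivative_eq_intros der mult_nonneg_nonpos simp: algebra_simps abs_le_iff\<close>)
  qed
  then show ?thesis using t0 nonneg[OF t] by (simp add: mult_le_0_iff)
next
  case False
  then have le: "t \<le> t0" by simp
  have "exp (C * t) * E t \<le> exp (C * t0) * E t0"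
  proof (rule DERIV_nonneg_imp_nondecreasing[OF le])
    fix x assume x: "t \<le> x" "x \<le> t0"
    then have "x \<in> {a..b}" using t0 t by auto
    then have "E' x + C * E x \<ge> 0" and der': "(E has_real_derivative E' x) (at x)"
      using bnd[of x] der by (auto simp: abs_le_iff)
    then have "exp (C * x) * (E' x + C * E x) \<ge> 0" by simp
    moreover have "((\<lambda>t. exp (C * t) * E t) has_real_derivative exp (C * x) * (E' x + C * E x)) (at x)"
      by (auto intro!: derivative_eq_intros der' simp: algebra_simps)
    ultimately show "\<exists>y. ((\<lambda>t. exp (C * t) * E t) has_real_derivative y) (at x) \<and> y \<ge> 0"
      by blast
  qed
  then show ?thesis using t0 nonneg[OF t] by (simp add: mult_le_0_iff)
qed

lemma le_of_deriv_nonneg: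
  fixes f :: "real \<Rightarrow> real"
  assumes "a \<le> b" "continuous_on {a..b} f"
    and "\<And>x. a < x \<Longrightarrow> x < b \<Longrightarrow> (f has_real_derivative f' x) (at x)"
    and "\<And>x. a < x \<Longrightarrow> x < b \<Longrightarrow> f' x \<ge> 0"
  shows "f a \<le> f b"
  using DERIV_nonneg_imp_increasing_open[OF assms(1) _ assms(2)] assms(3,4) by blast

lemma cos_ge_half: "0 \<le> y \<Longrightarrow> y \<le> 1 \<Longrightarrow> cos y \<ge> 1/2" for y :: real
proof -
  assume "0 \<le> y" "y \<le> 1"
  moreover have "1 \<le> pi/3" using pi_gt3 by simp
  ultimately have "cos (pi/3) \<le> cos y" by (intro cos_monotone_0_pi_le) auto
  then show ?thesis by (simp add: cos_60)
qed

lemma exp_le_3: "x \<le> 1 \<Longrightarrow> exp x \<le> (3::real)"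
  using exp_le exp_le_cancel_iff[of x 1] by linarith

lemma antiderivative:
  fixes g :: "real \<Rightarrow> real"
  assumes "continuous_on {0..d} g" "\<And>y. y \<in> {0..d} \<Longrightarrow> g y \<ge> 0"
  defines "G \<equiv> \<lambda>y. integral {0..y} g"
  shows "continuous_on {0..d} G" "\<And>y. 0 < y \<Longrightarrow> y < d \<Longrightarrow> (G has_real_derivative g y) (at y)"
    "\<And>y. 0 \<le> y \<Longrightarrow> y \<le> d \<Longrightarrow> 0 \<le> G y" "\<And>y. 0 \<le> y \<Longrightarrow> y \<le> d \<Longrightarrow> G y \<le> G d" "G 0 = 0"
proof -
  have int: "g integrable_on {0..y}" if "y \<le> d" for y
    using assms(1) that by (intro integrable_continuous_real) (auto elim: continuous_on_subset)
  show "continuous_on {0..d} G" unfolding G_def by (rule indefinite_integral_continuous_1[OF int]) simp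
  show "(G has_real_derivative g y) (at y)" if "0 < y" "y < d" for y
  proof -
    have "(G has_real_derivative g y) (at y within {0..d})"
      unfolding G_def by (rule integral_has_real_derivative[OF assms(1)]) (use that in auto)
    then show ?thesis using that by (simp add: at_within_interior[of y "{0..d}"])
  qed
  show "0 \<le> G y" if "0 \<le> y" "y \<le> d" for y
    unfolding G_def using that assms(2) by (intro integral_nonneg int) auto
  show "G y \<le> G d" if "0 \<le> y" "y \<le> d" for y
    unfolding G_def using that assms(2) by (intro integral_subset_le int) auto
  show "G 0 = 0" by (simp add: G_def)
qed

text \<open>The constant does not depend on \<open>\<mu>\<close>. Write \<open>m = - Re \<mu>\<close>, \<open>b = Im \<mu>\<close> and
  \<open>u = |F|\<^sup>2\<close>. If \<open>m\<close> is at most 1, then \<open>u'' \<ge> - 9 u - |R|\<^sup>2\<close> with \<open>u' 0 = 0\<close>, so \<open>u\<close>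
  can fall below \<open>u 0\<close> only at the cost of the integrals on the right. If \<open>m\<close> is large, \<open>F\<close>
  oscillates; up to the contribution of \<open>R\<close>, the energy
  \<open>|F'|\<^sup>2 + m q u\<close> starts at \<open>m u 0\<close> and does not decay much, and testing \<open>u''\<close> against a
  bump function bounds the mean of the energy by \<open>m\<close> times the mean of \<open>u\<close>. An imaginary part of
  \<open>\<mu>\<close> feeds \<open>2 q b W\<close> with \<open>W = Im (F' * cnj F)\<close> into the energy; as \<open>b W\<close> is
  increasing up to the contribution of \<open>R\<close>, this term does not lower the energy by much.\<close>

lemma sec_squared_ode_bound:
  fixes F F' R :: "real \<Rightarrow> complex" and \<mu> :: complex
  assumes d: "0 < d" "d \<le> 1"
    and F: "\<And>y. y \<in> {0..d} \<Longrightarrow> (F has_vector_derivative F' y) (at y)"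
    and F': "\<And>y. y \<in> {0..d} \<Longrightarrow> (F' has_vector_derivative \<mu> * of_real (1 / (cos y)\<^sup>2) * F y + R y) (at y)"
    and F'0: "F' 0 = 0"
    and R: "continuous_on {0..d} R"
  shows "(cmod (F 0))\<^sup>2 \<le> 855 / d ^ 5 *
    (integral {0..d} (\<lambda>y. (cmod (F y))\<^sup>2) + integral {0..d} (\<lambda>y. (cmod (R y))\<^sup>2))"
proof -
  define m b where "m = - Re \<mu>" and "b = Im \<mu>"
  define q where "q = (\<lambda>y::real. 1 / (cos y)\<^sup>2)"
  define q' where "q' = (\<lambda>y::real. 2 * sin y / (cos y)^3)"
  define a c a' c' r s where "a = (\<lambda>y. Re (F y))" and "c = (\<lambda>y. Im (F y))"
    and "a' = (\<lambda>y. Re (F' y))" and "c' = (\<lambda>y. Im (F' y))"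
    and "r = (\<lambda>y. Re (R y))" and "s = (\<lambda>y. Im (R y))"
  have cp: "cos y \<ge> 1/2" if "y \<in> {0..d}" for y using that d by (intro cos_ge_half) auto
  have q1: "q y \<ge> 1" and q4: "q y \<le> 4" and q'0: "q' y \<ge> 0"
    and dq: "(q has_real_derivative q' y) (at y)" if y: "y \<in> {0..d}" for y
  proof -
    have c: "cos y \<ge> 1/2" "cos y \<le> 1" using cp[OF y] by auto
    have "(cos y)\<^sup>2 \<le> 1" using c by (simp add: power_le_one)
    moreover have "(cos y)\<^sup>2 \<ge> 1/4" using power_mono[OF c(1), of 2] by (simp add: power2_eq_square)
    ultimately show "q y \<ge> 1" "q y \<le> 4" unfolding q_def using c by (auto simp: field_simps)
    have "0 \<le> sin y" using y d pi_gt3 by (intro sin_ge_zero) auto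
    then show "q' y \<ge> 0" unfolding q'_def using c by auto
    show "(q has_real_derivative q' y) (at y)"
      unfolding q_def q'_def using c
      by (auto intro!: derivative_eq_intros simp: field_simps power2_eq_square power3_eq_cube)
  qed
  have da: "(a has_real_derivative a' y) (at y)" and dc: "(c has_real_derivative c' y) (at y)"
    and da': "(a' has_real_derivative (- m * q y * a y - b * q y * c y + r y)) (at y)"
    and dc': "(c' has_real_derivative (- m * q y * c y + b * q y * a y + s y)) (at y)"
    if y: "y \<in> {0..d}" for y
    using bounded_linear.has_vector_derivative[OF bounded_linear_Re F[OF y]]
      bounded_linear.has_vector_derivative[OF bounded_linear_Im F[OF y]]
      bounded_linear.has_vector_derivative[OF bounded_linear_Re F'[OF y]]
      bounded_linear.has_vector_derivative[OF bounded_linear_Im F'[OF y]]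
    by (simp_all add: a_def c_def a'_def c'_def r_def s_def q_def m_def b_def
        has_real_derivative_iff_has_vector_derivative algebra_simps diff_divide_distrib add_divide_distrib)
  note D = da dc da' dc' dq
  have ca: "continuous_on {0..d} a" "continuous_on {0..d} c" "continuous_on {0..d} a'" "continuous_on {0..d} c'"
    "continuous_on {0..d} q" "continuous_on {0..d} r" "continuous_on {0..d} s"
    apply -
    subgoal by (rule DERIV_continuous_on[OF has_field_derivative_at_within[OF da]])
    subgoal by (rule DERIV_continuous_on[OF has_field_derivative_at_within[OF dc]])
    subgoal by (rule DERIV_continuous_on[OF has_field_derivative_at_within[OF da']])
    subgoal by (rule DERIV_continuous_on[OF has_field_derivative_at_within[OF dc']])
    subgoal by (rule DERIV_continuous_on[OF has_field_derivative_at_within[OF dq]])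
    using R by (auto simp: r_def s_def intro!: continuous_intros)
  have z: "a' 0 = 0" "c' 0 = 0" using F'0 by (auto simp: a'_def c'_def)
  define u where "u = (\<lambda>y. (a y)\<^sup>2 + (c y)\<^sup>2)"
  define u' where "u' = (\<lambda>y. 2 * (a y * a' y + c y * c' y))"
  define v where "v = (\<lambda>y. (a' y)\<^sup>2 + (c' y)\<^sup>2)"
  define \<rho> where "\<rho> = (\<lambda>y. (r y)\<^sup>2 + (s y)\<^sup>2)"
  define U J where "U = (\<lambda>y. integral {0..y} u)" and "J = (\<lambda>y. integral {0..y} \<rho>)"
  have UJ: "integral {0..y} u = U y" "integral {0..y} \<rho> = J y" for y
    by (simp_all add: U_def J_def)
  have un: "u y \<ge> 0" "\<rho> y \<ge> 0" "v y \<ge> 0" for y by (auto simp: u_def \<rho>_def v_def)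
  have cu: "continuous_on {0..d} u" "continuous_on {0..d} u'" "continuous_on {0..d} \<rho>" "continuous_on {0..d} v"
    unfolding u_def u'_def \<rho>_def v_def by (intro continuous_intros ca)+
  note U = antiderivative[OF cu(1) un(1), unfolded UJ]
  note J = antiderivative[OF cu(3) un(2), unfolded UJ]
  define I N where "I = U d" and "N = J d"
  have IN: "0 \<le> I" "0 \<le> N" unfolding I_def N_def using U(3)[of d] J(3)[of d] d by simp_all
  have du: "(u has_real_derivative u' y) (at y)" if y: "y \<in> {0..d}" for y
    unfolding u_def u'_def by (auto intro!: derivative_eq_intros D y)
  define rf where "rf = (\<lambda>y. r y * a y + s y * c y)"
  have rf: "2 * rf y \<ge> - \<rho> y - u y" for y
  proof -
    have "0 \<le> (r y + a y)\<^sup>2 + (s y + c y)\<^sup>2" by simp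
    then show ?thesis by (simp add: rf_def \<rho>_def u_def power2_eq_square algebra_simps)
  qed
  have du': "(u' has_real_derivative (2 * v y - 2 * m * q y * u y + 2 * rf y)) (at y)" if y: "y \<in> {0..d}" for y
    unfolding u_def u'_def v_def rf_def
    by (auto intro!: derivative_eq_intros D y simp: power2_eq_square algebra_simps)
  have *: "u 0 \<le> 855 / d ^ 5 * (I + N)"
  proof (cases "m \<le> 1")
    case True
    define M where "M = 9 * I + N"
    have 1: "u' y \<ge> - M" if y: "y \<in> {0..d}" for y
    proof -
      have "u' 0 + 9 * U 0 + J 0 \<le> u' y + 9 * U y + J y"
      proof (rule le_of_deriv_nonneg[where f = "\<lambda>y. u' y + 9 * U y + J y"
          and f' = "\<lambda>x. 2 * v x - 2 * m * q x * u x + 2 * rf x + 9 * u x + \<rho> x"])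
        show "0 \<le> y" using y by simp
        show "continuous_on {0..y} (\<lambda>y. u' y + 9 * U y + J y)"
          by (rule continuous_on_subset[of "{0..d}"]) (use y in \<open>auto intro!: continuous_intros cu U J\<close>)
        fix x assume x: "0 < x" "x < y"
        then have x': "x \<in> {0..d}" "x < d" using y by auto
        show "((\<lambda>y. u' y + 9 * U y + J y) has_real_derivative (2 * v x - 2 * m * q x * u x + 2 * rf x + 9 * u x + \<rho> x)) (at x)"
          by (auto intro!: derivative_eq_intros du' x' U J x)
        have "m * q x \<le> 4"
        proof (cases "m \<le> 0")
          case True then show ?thesis using q1[OF x'(1)] mult_nonpos_nonneg[of m "q x"] by auto
        next
          case False then show ?thesis using mult_mono[OF \<open>m \<le> 1\<close> q4[OF x'(1)]] q1[OF x'(1)] by auto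
        qed
        then have "m * q x * u x \<le> 4 * u x" using un by (intro mult_right_mono) auto
        then show "0 \<le> 2 * v x - 2 * m * q x * u x + 2 * rf x + 9 * u x + \<rho> x"
          using rf[of x] un[of x] by linarith
      qed
      moreover have "u' 0 = 0" by (simp add: u'_def z)
      moreover have "U y \<le> I" "J y \<le> N" unfolding I_def N_def using y U(4) J(4) by auto
      ultimately show ?thesis using U(5) J(5) by (simp add: M_def)
    qed
    have 2: "u y \<ge> u 0 - M * y" if y: "y \<in> {0..d}" for y
    proof -
      have "u 0 + M * 0 \<le> u y + M * y"
      proof (rule le_of_deriv_nonneg[where f = "\<lambda>y. u y + M * y"
          and f' = "\<lambda>x. u' x + M"])
        show "0 \<le> y" using y by simp
        show "continuous_on {0..y} (\<lambda>y. u y + M * y)"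
          by (rule continuous_on_subset[of "{0..d}"]) (use y in \<open>auto intro!: continuous_intros cu U J\<close>)
        fix x assume x: "0 < x" "x < y"
        then have x': "x \<in> {0..d}" "x < d" using y by auto
        show "((\<lambda>y. u y + M * y) has_real_derivative (u' x + M)) (at x)"
          by (auto intro!: derivative_eq_intros du x')
        show "0 \<le> u' x + M" using 1[OF x'(1)] by simp
      qed
      then show ?thesis by simp
    qed
    have "U 0 - u 0 * 0 + M * 0\<^sup>2 / 2 \<le> U d - u 0 * d + M * d\<^sup>2 / 2"
    proof (rule le_of_deriv_nonneg[where f = "\<lambda>y. U y - u 0 * y + M * y\<^sup>2 / 2"
          and f' = "\<lambda>x. u x - u 0 + M * x"])
      show "0 \<le> d" using d by simp
      show "continuous_on {0..d} (\<lambda>y. U y - u 0 * y + M * y\<^sup>2 / 2)"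
        by (intro continuous_intros U) auto
      fix x assume x: "0 < x" "x < d"
      then show "((\<lambda>y. U y - u 0 * y + M * y\<^sup>2 / 2) has_real_derivative (u x - u 0 + M * x)) (at x)"
        by (auto intro!: derivative_eq_intros U)
      show "0 \<le> u x - u 0 + M * x" using 2[of x] x by simp
    qed
    then have "u 0 * d \<le> I + M * d\<^sup>2 / 2" using U(5) by (simp add: I_def)
    also have "\<dots> \<le> I + M / 2"
      using d IN by (auto simp: M_def power_le_one intro!: mult_left_le)
    also have "\<dots> \<le> 855 * (I + N)" using IN by (simp add: M_def)
    finally have "u 0 * d \<le> 855 * (I + N)" .
    moreover have "u 0 * d ^ 5 \<le> u 0 * d" using d un[of 0] power_decreasing[of 1 5 d] by (auto intro: mult_left_mono)
    ultimately show ?thesis using d by (simp add: field_simps)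
  next
    case False
    then have m: "m \<ge> 1" by simp
    \<comment> \<open>\<open>W\<close> is \<open>Im (F' * cnj F)\<close>.\<close>
    define W where "W = (\<lambda>y. c' y * a y - a' y * c y)"
    have W: "b * W y \<ge> - N / 4" if y: "y \<in> {0..d}" for y
    proof -
      have "b * W 0 + J 0 / 4 \<le> b * W y + J y / 4"
      proof (rule le_of_deriv_nonneg[where f = "\<lambda>y. b * W y + J y / 4"
          and f' = "\<lambda>x. b * (b * q x * u x + s x * a x - r x * c x) + \<rho> x / 4"])
        show "0 \<le> y" using y by simp
        show "continuous_on {0..y} (\<lambda>y. b * W y + J y / 4)" unfolding W_def
          by (rule continuous_on_subset[of "{0..d}"]) (use y in \<open>auto intro!: continuous_intros cu ca U J\<close>)
        fix x assume x: "0 < x" "x < y"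
        then have x': "x \<in> {0..d}" "x < d" using y by auto
        show "((\<lambda>y. b * W y + J y / 4) has_real_derivative (b * (b * q x * u x + s x * a x - r x * c x) + \<rho> x / 4)) (at x)"
          unfolding W_def u_def
          by (auto intro!: derivative_eq_intros D x' J x simp: power2_eq_square algebra_simps)
        have "b\<^sup>2 * u x * 1 \<le> b\<^sup>2 * u x * q x" using q1[OF x'(1)] un by (intro mult_left_mono) auto
        moreover have "0 \<le> (b * a x + s x / 2)\<^sup>2 + (b * c x - r x / 2)\<^sup>2" by simp
        ultimately show "0 \<le> b * (b * q x * u x + s x * a x - r x * c x) + \<rho> x / 4"
          by (simp add: u_def \<rho>_def power2_eq_square add_divide_distrib algebra_simps)
      qed
      moreover have "W 0 = 0" by (simp add: W_def z)
      moreover have "J y \<le> N" unfolding N_def using y J(4) by auto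
      ultimately show ?thesis using J(5) by simp
    qed
    define E where "E = (\<lambda>y. v y + m * q y * u y)"
    define G where "G = (\<lambda>x. 2 * q x * (b * W x) + 2 * (r x * a' x + s x * c' x) + m * q' x * u x)"
    have E: "E y \<ge> m * u 0 / 3 - 3 * N" if y: "y \<in> {0..d}" for y
    proof -
      have "exp 0 * E 0 + 3 * (2 * N * 0 + J 0) \<le> exp y * E y + 3 * (2 * N * y + J y)"
      proof (rule le_of_deriv_nonneg[where f = "\<lambda>y. exp y * E y + 3 * (2 * N * y + J y)"
          and f' = "\<lambda>x. exp x * (G x + E x) + 3 * (2 * N + \<rho> x)"])
        show "0 \<le> y" using y by simp
        show "continuous_on {0..y} (\<lambda>y. exp y * E y + 3 * (2 * N * y + J y))" unfolding E_def
          by (rule continuous_on_subset[of "{0..d}"]) (use y in \<open>auto intro!: continuous_intros cu ca U J\<close>)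
        fix x assume x: "0 < x" "x < y"
        then have x': "x \<in> {0..d}" "x < d" using y by auto
        show "((\<lambda>y. exp y * E y + 3 * (2 * N * y + J y)) has_real_derivative (exp x * (G x + E x) + 3 * (2 * N + \<rho> x))) (at x)"
          unfolding E_def u_def v_def G_def W_def
          by (auto intro!: derivative_eq_intros D x' J x simp: power2_eq_square algebra_simps)
        have "2 * q x * (b * W x) \<ge> - (2 * N)"
        proof -
          have "q x * (- N / 4) \<le> q x * (b * W x)" using W[OF x'(1)] q1[OF x'(1)] by (intro mult_left_mono) auto
          moreover have "q x * N \<le> 4 * N" using q4[OF x'(1)] IN by (intro mult_right_mono) auto
          ultimately show ?thesis by (simp add: algebra_simps)
        qed
        moreover have "2 * (r x * a' x + s x * c' x) \<ge> - \<rho> x - v x"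
        proof -
          have "0 \<le> (r x + a' x)\<^sup>2 + (s x + c' x)\<^sup>2" by simp
          then show ?thesis by (simp add: v_def \<rho>_def power2_eq_square algebra_simps)
        qed
        moreover have "m * q' x * u x \<ge> 0" using m q'0[OF x'(1)] un by auto
        moreover have "m * q x * u x \<ge> 0" using m q1[OF x'(1)] un[of x] by auto
        ultimately have GE: "G x + E x \<ge> - (2 * N + \<rho> x)" unfolding G_def E_def by linarith
        have "exp x \<le> 3" using exp_le_3[of x] x' d by simp
        then have "exp x * (2 * N + \<rho> x) \<le> 3 * (2 * N + \<rho> x)" using IN un by (intro mult_right_mono) auto
        moreover have "exp x * (G x + E x) \<ge> exp x * (- (2 * N + \<rho> x))" using GE by (intro mult_left_mono) auto
        ultimately show "0 \<le> exp x * (G x + E x) + 3 * (2 * N + \<rho> x)" by linarith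
      qed
      moreover have "E 0 = m * u 0" by (simp add: E_def v_def z q_def)
      moreover have "J y \<le> N" unfolding N_def using y J(4) by auto
      moreover have "N * y \<le> N * 1" using y d IN by (intro mult_left_mono) auto
      moreover have "exp y * E y \<le> 3 * E y"
      proof -
        have "exp y \<le> 3" using exp_le_3[of y] y d by simp
        moreover have "E y \<ge> 0" using m q1[OF y] un[of y] by (auto simp: E_def)
        ultimately show ?thesis by (rule mult_right_mono)
      qed
      ultimately show ?thesis using J(5) by simp
    qed
    \<comment> \<open>A bump function vanishing with its derivative at both ends; \<open>X\<close> is its antiderivative.\<close>
    define cut where "cut = (\<lambda>y. y\<^sup>2 * (d - y)\<^sup>2)"
    define cut' where "cut' = (\<lambda>y. 2 * y * (d - y)\<^sup>2 - 2 * y\<^sup>2 * (d - y))"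
    define X where "X = (\<lambda>y. d\<^sup>2 * y^3 / 3 - d * y^4 / 2 + y^5 / 5)"
    define u2 where "u2 = (\<lambda>x. 2 * v x - 2 * m * q x * u x + 2 * rf x)"
    define c2 where "c2 = (\<lambda>x. 2 * d\<^sup>2 - 12 * d * x + 12 * x\<^sup>2)"
    let ?f = "\<lambda>y. cut y * u' y - cut' y * u y - 2/3 * m * u 0 * X y + 6 * N * y + 19 * m * U y + J y"
    have "?f 0 \<le> ?f d"
    proof (rule le_of_deriv_nonneg[where f = "?f"
          and f' = "\<lambda>x. cut x * u2 x - c2 x * u x - 2/3 * m * u 0 * cut x + 6 * N + 19 * m * u x + \<rho> x"])
      show "0 \<le> d" using d by simp
      show "continuous_on {0..d} ?f" unfolding cut_def cut'_def X_def
        by (intro continuous_intros cu U J) auto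
      fix x assume x: "0 < x" "x < d"
      then have x': "x \<in> {0..d}" by simp
      show "(?f has_real_derivative (cut x * u2 x - c2 x * u x - 2/3 * m * u 0 * cut x + 6 * N + 19 * m * u x + \<rho> x)) (at x)"
        unfolding cut_def cut'_def X_def u2_def c2_def
        by (auto intro!: derivative_eq_intros du du' x' U J x simp: power2_eq_square power3_eq_cube power4_eq_xxxx algebra_simps)
      have cut: "0 \<le> cut x" "cut x \<le> 1"
        unfolding cut_def using x d by (auto intro!: mult_le_one power_le_one)
      have "x * x \<le> d * x" using x by (intro mult_right_mono) auto
      moreover have "d\<^sup>2 \<le> 1" using d by (simp add: power_le_one)
      ultimately have "c2 x \<le> 2" by (simp add: c2_def power2_eq_square)
      then have c: "c2 x * u x \<le> 2 * u x" using un by (intro mult_right_mono) auto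
      have mu: "u x \<le> m * u x" using m un[of x] mult_right_mono[of 1 m "u x"] by simp
      have "m * u x * q x \<le> m * u x * 4" using q4[OF x'] m un[of x] by (intro mult_left_mono) auto
      then have "u2 x \<ge> 2 * (m * u 0 / 3 - 3 * N) - 16 * (m * u x) - \<rho> x - u x"
        using E[OF x'] rf[of x] unfolding E_def u2_def by (simp add: algebra_simps)
      then have "u2 x \<ge> 2/3 * m * u 0 - (6 * N + 17 * (m * u x) + \<rho> x)" using mu by simp
      then have "cut x * u2 x \<ge> cut x * (2/3 * m * u 0 - (6 * N + 17 * (m * u x) + \<rho> x))"
        using cut by (intro mult_left_mono) auto
      moreover have "cut x * (6 * N + 17 * (m * u x) + \<rho> x) \<le> 1 * (6 * N + 17 * (m * u x) + \<rho> x)"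
        using cut IN un m by (intro mult_right_mono) auto
      ultimately show "0 \<le> cut x * u2 x - c2 x * u x - 2/3 * m * u 0 * cut x + 6 * N + 19 * m * u x + \<rho> x"
        using c mu by (simp add: algebra_simps)
    qed
    moreover have "X d = d^5 / 30"
      by (simp add: X_def eval_nat_numeral field_simps)
    moreover have "X 0 = 0" "cut 0 = 0" "cut' 0 = 0" "cut d = 0" "cut' d = 0"
      by (simp_all add: X_def cut_def cut'_def)
    ultimately have "0 \<le> - (2/3 * m * u 0 * (d^5 / 30)) + 6 * N * d + 19 * m * I + N"
      using U(5) J(5) by (simp only: I_def N_def mult_zero_left mult_zero_right diff_0 add_0 add_0_right minus_zero diff_self)
    then have "m * (u 0 * d ^ 5 / 45) \<le> 6 * N * d + 19 * m * I + N"
      by (simp add: mult_ac)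
    also have "\<dots> \<le> m * (7 * N) + 19 * m * I"
    proof -
      have "N * d \<le> N * 1" "1 * N \<le> m * N" using d IN m by (intro mult_left_mono mult_right_mono; simp)+
      then show ?thesis by simp
    qed
    also have "\<dots> = m * (7 * N + 19 * I)" by (simp add: algebra_simps)
    finally have "u 0 * d ^ 5 / 45 \<le> 7 * N + 19 * I" using m by simp
    then have "u 0 * d ^ 5 \<le> 855 * (I + N)" using IN by simp
    then show ?thesis using d by (simp add: field_simps)
  qed
  have "u = (\<lambda>y. (cmod (F y))\<^sup>2)" "\<rho> = (\<lambda>y. (cmod (R y))\<^sup>2)"
    by (auto simp: u_def \<rho>_def a_def c_def r_def s_def cmod_power2)
  then show ?thesis using * by (simp add: I_def N_def U_def J_def)
qed

section \<open>Linear holomorphic equations of second order\<close>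

fun ode_coeff :: "(nat \<Rightarrow> complex) \<Rightarrow> complex \<Rightarrow> complex \<Rightarrow> nat \<Rightarrow> complex" where
  "ode_coeff p a b 0 = a"
| "ode_coeff p a b (Suc 0) = b"
| "ode_coeff p a b (Suc (Suc n)) =
     (\<Sum>i\<le>n. p i * ode_coeff p a b (n - i)) / (of_nat (n + 1) * of_nat (n + 2))"

text \<open>The \<open>n + 1\<close> terms of the convolution are outweighed by the denominator \<open>(n + 1) (n + 2)\<close>, and the
  constant \<open>K\<close> is absorbed by the two extra powers of \<open>B\<close>.\<close>

lemma ode_coeff_bound:
  assumes p: "\<And>k. norm (p k) \<le> K * B ^ k" and B: "B \<ge> 1" "K \<ge> 0" "B\<^sup>2 \<ge> K"
    and M: "norm a \<le> M" "norm b \<le> M"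
  shows "norm (ode_coeff p a b n) \<le> M * B ^ n"
proof (induction n rule: less_induct)
  case (less n)
  have M0: "M \<ge> 0" using M norm_ge_zero order_trans by blast
  consider "n = 0" | "n = 1" | k where "n = Suc (Suc k)"
    by (metis One_nat_def not0_implies_Suc)
  then show ?case
  proof cases
    case 1 then show ?thesis using M by simp
  next
    case 2
    have "M * 1 \<le> M * B" using M0 B by (intro mult_left_mono) auto
    then show ?thesis using 2 M by simp
  next
    case (3 k)
    have "norm (\<Sum>i\<le>k. p i * ode_coeff p a b (k - i)) \<le> (\<Sum>i\<le>k. K * M * B ^ k)"
    proof (rule sum_norm_le)
      fix i assume i: "i \<in> {..k}"
      have "norm (p i * ode_coeff p a b (k - i)) \<le> (K * B ^ i) * (M * B ^ (k - i))"
        unfolding norm_mult using less[of "k - i"] i 3 B by (intro mult_mono p) auto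
      also have "\<dots> = K * M * (B ^ i * B ^ (k - i))" by simp
      also have "B ^ i * B ^ (k - i) = B ^ k" using i by (simp flip: power_add)
      finally show "norm (p i * ode_coeff p a b (k - i)) \<le> K * M * B ^ k" .
    qed
    also have "\<dots> = (real k + 1) * (K * M * B ^ k)" by simp
    finally have 1: "norm (\<Sum>i\<le>k. p i * ode_coeff p a b (k - i)) \<le> (real k + 1) * (K * M * B ^ k)" .
    have nrm: "norm (of_nat (k + 1) * of_nat (k + 2) :: complex) = (real k + 1) * (real k + 2)"
      unfolding norm_mult norm_of_nat by (simp add: algebra_simps)
    have "norm (ode_coeff p a b n) \<le> (real k + 1) * (K * M * B ^ k) / ((real k + 1) * (real k + 2))"
      unfolding 3 ode_coeff.simps norm_divide nrm using 1 by (intro divide_right_mono) auto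
    also have "\<dots> = K * M * B ^ k / (real k + 2)" by simp
    also have "\<dots> \<le> K * M * B ^ k / 1" using B M0 by (intro divide_left_mono mult_nonneg_nonneg) auto
    also have "\<dots> = K * M * B ^ k" by simp
    also have "\<dots> \<le> B\<^sup>2 * (M * B ^ k)" using mult_right_mono[OF B(3), of "M * B ^ k"] B M0 by (simp add: algebra_simps)
    also have "\<dots> = M * B ^ n" using 3 by (simp add: power2_eq_square)
    finally show ?thesis .
  qed
qed

lemma fps_coeff_geometric_bound:
  fixes F :: "complex fps"
  assumes "fps_conv_radius F > 0"
  shows "\<exists>K B. B \<ge> 1 \<and> K \<ge> 0 \<and> (\<forall>k. norm (fps_nth F k) \<le> K * B ^ k)"
proof -
  obtain r where r: "0 < ereal r" "ereal r < fps_conv_radius F"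
    using ereal_dense2[OF assms] by auto
  define s where "s = min r 1"
  have s: "0 < s" "s \<le> 1" "ereal s < fps_conv_radius F"
    using r le_less_trans[of "ereal s" "ereal r"] by (auto simp: s_def)
  have "summable (\<lambda>n. fps_nth F n * of_real s ^ n)"
    by (rule summable_fps) (use s in auto)
  then have "Bseq (\<lambda>n. fps_nth F n * of_real s ^ n)"
    using summable_LIMSEQ_zero convergentI convergent_imp_Bseq by blast
  then obtain K where K: "K > 0" "\<And>n. norm (fps_nth F n * of_real s ^ n) \<le> K"
    by (auto simp: Bseq_def)
  show ?thesis
  proof (intro exI conjI allI)
    show "1 / s \<ge> 1" "K \<ge> 0" using s K by auto
    show "norm (fps_nth F k) \<le> K * (1 / s) ^ k" for k
      using K(2)[of k] s by (simp add: norm_mult norm_power field_simps)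
  qed
qed

text \<open>Solution by power series. Both sides of the differential equation have the same expansion, hence agree
  near \<open>z0\<close>; the radius of that neighbourhood is left unspecified because the solution is used
  locally.\<close>

lemma holomorphic_linear_ode:
  fixes P :: "complex \<Rightarrow> complex"
  assumes P: "P holomorphic_on ball z0 R" and R: "R > 0"
  obtains y r where "0 < r" "r \<le> R" "y holomorphic_on ball z0 r" "y z0 = a" "deriv y z0 = b"
    "\<And>z. z \<in> ball z0 r \<Longrightarrow> deriv (deriv y) z = P z * y z"
proof -
  define p where "p = (\<lambda>z. P (z0 + z))"
  have "p holomorphic_on ball 0 R"
    unfolding p_def
    by (rule holomorphic_on_compose_gen[of "\<lambda>z. z0 + z" _ P, unfolded o_def, OF _ P])
      (auto intro!: holomorphic_intros simp: dist_norm)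
  then have pF: "p has_fps_expansion fps_expansion p 0"
    using R by (intro has_fps_expansion_fps_expansion[of "ball 0 R"]) auto
  define F where "F = fps_expansion p 0"
  have Fr: "fps_conv_radius F > 0" using pF by (simp add: has_fps_expansion_def F_def)
  obtain B K where KB: "B \<ge> 1" "K \<ge> 0" "\<And>k. norm (fps_nth F k) \<le> K * B ^ k"
    using fps_coeff_geometric_bound[OF Fr] by auto
  \<comment> \<open>Large enough for \<open>B \<le> B'\<close> and \<open>K \<le> B'\<^sup>2\<close> at once.\<close>
  define B' where "B' = B + K + 1"
  have B': "B' \<ge> 1" "B'\<^sup>2 \<ge> K" "B \<le> B'"
  proof -
    show 1: "B' \<ge> 1" using KB by (simp add: B'_def)
    have "B' \<le> B'\<^sup>2" using 1 by (simp add: power2_eq_square)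
    then show "B'\<^sup>2 \<ge> K" using KB by (simp add: B'_def)
    show "B \<le> B'" using KB by (simp add: B'_def)
  qed
  define c where "c = ode_coeff (fps_nth F) a b"
  define C where "C = Abs_fps c"
  define M where "M = norm a + norm b"
  have cb: "norm (c n) \<le> M * B' ^ n" for n
    unfolding c_def
  proof (rule ode_coeff_bound[OF _ B'(1) KB(2) B'(2)])
    show "norm (fps_nth F k) \<le> K * B' ^ k" for k
      using KB(3)[of k] mult_left_mono[OF power_mono[OF B'(3), of k] KB(2)] KB(1) by auto
  qed (auto simp: M_def)
  have "summable (\<lambda>n. c n * (of_real (1 / (2 * B'))) ^ n)"
  proof (rule summable_comparison_test')
    show "summable (\<lambda>n. M * (1/2::real) ^ n)" by (intro summable_mult summable_geometric) auto
    fix n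
    have "norm (c n * (of_real (1 / (2 * B'))) ^ n) = norm (c n) * (1 / (2 * B')) ^ n"
      using B' unfolding norm_mult norm_power norm_of_real by simp
    also have "\<dots> \<le> (M * B' ^ n) * (1 / (2 * B')) ^ n"
      using B' by (intro mult_right_mono cb) auto
    also have "\<dots> = M * (B' * (1 / (2 * B'))) ^ n" by (simp only: power_mult_distrib mult.assoc)
    also have "B' * (1 / (2 * B')) = 1 / 2" using B' by simp
    finally show "norm (c n * (of_real (1 / (2 * B'))) ^ n) \<le> M * (1/2) ^ n" .
  qed
  then have "fps_conv_radius C \<ge> norm (of_real (1 / (2 * B')) :: complex)"
    unfolding fps_conv_radius_def C_def fps_nth_Abs_fps by (rule conv_radius_geI)
  moreover have "norm (of_real (1 / (2 * B')) :: complex) > 0" using B' by simp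
  ultimately have Cr: "fps_conv_radius C > 0"
    using ereal_less(2) less_le_trans by blast
  define y0 where "y0 = eval_fps C"
  have y0C: "y0 has_fps_expansion C" using Cr by (simp add: y0_def eval_fps_has_fps_expansion)
  have eq: "fps_deriv (fps_deriv C) = F * C"
  proof (rule fps_ext)
    fix n
    have "fps_nth (fps_deriv (fps_deriv C)) n = of_nat (n + 1) * of_nat (n + 2) * c (Suc (Suc n))"
      by (simp add: C_def algebra_simps)
    also have "\<dots> = (\<Sum>i\<le>n. fps_nth F i * c (n - i))"
    proof -
      have "(of_nat (n + 1) * of_nat (n + 2) :: complex) \<noteq> 0"
        using of_nat_neq_0[of n] of_nat_neq_0[of "Suc n"] by (simp del: of_nat_Suc of_nat_add)
      then show ?thesis unfolding c_def ode_coeff.simps by simp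
    qed
    finally show "fps_nth (fps_deriv (fps_deriv C)) n = fps_nth (F * C) n"
      by (simp add: fps_mult_nth C_def atLeast0AtMost)
  qed
  have "deriv (deriv y0) has_fps_expansion F * C"
    using has_fps_expansion_deriv[OF has_fps_expansion_deriv[OF y0C]] by (simp add: eq)
  moreover have "(\<lambda>z. p z * y0 z) has_fps_expansion F * C"
    using pF y0C unfolding F_def by (rule has_fps_expansion_mult)
  ultimately have "eventually (\<lambda>z. eval_fps (F * C) z = deriv (deriv y0) z) (nhds 0)"
    "eventually (\<lambda>z. eval_fps (F * C) z = p z * y0 z) (nhds 0)"
    unfolding has_fps_expansion_def by auto
  then have "eventually (\<lambda>z. deriv (deriv y0) z = p z * y0 z) (nhds 0)"
    by eventually_elim simp
  note ev = this
  obtain A where A: "open A" "0 \<in> A" "y0 holomorphic_on A"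
    using has_fps_expansion_imp_holomorphic[OF y0C] by blast
  have "eventually (\<lambda>z. deriv (deriv y0) z = p z * y0 z \<and> z \<in> A) (nhds 0)"
    using ev eventually_nhds_in_open[OF A(1,2)] by (rule eventually_conj)
  then obtain e where e: "e > 0" "\<And>z. dist z 0 < e \<Longrightarrow> deriv (deriv y0) z = p z * y0 z \<and> z \<in> A"
    unfolding eventually_nhds_metric by blast
  define r where "r = min e R"
  define y where "y = (\<lambda>z. y0 (z - z0))"
  have y0h: "y0 holomorphic_on ball 0 r"
    using A(3) by (rule holomorphic_on_subset) (use e in \<open>auto simp: r_def dist_commute\<close>)
  have in0: "z - z0 \<in> ball 0 r" if "z \<in> ball z0 r" for z
    using that by (simp add: dist_norm norm_minus_commute)
  have dy: "(y has_field_derivative deriv y0 (z - z0)) (at z)" if "z \<in> ball z0 r" for z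
  proof -
    have "(y0 has_field_derivative deriv y0 (z - z0)) (at (z - z0))"
      using holomorphic_derivI[OF y0h _ in0[OF that]] by simp
    then show ?thesis unfolding y_def using DERIV_shift[of y0 _ z "- z0"] by simp
  qed
  have dy': "(deriv y has_field_derivative deriv (deriv y0) (z - z0)) (at z)" if z: "z \<in> ball z0 r" for z
  proof -
    have "(deriv y0 has_field_derivative deriv (deriv y0) (z - z0)) (at (z - z0))"
      using holomorphic_derivI[OF holomorphic_deriv[OF y0h] _ in0[OF z]] by simp
    then have "((\<lambda>z. deriv y0 (z - z0)) has_field_derivative deriv (deriv y0) (z - z0)) (at z)"
      using DERIV_shift[of "deriv y0" _ z "- z0"] by simp
    then show ?thesis
      by (rule has_field_derivative_transform_within_open[of _ _ _ "ball z0 r"])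
        (use z DERIV_imp_deriv[OF dy] in auto)
  qed
  have cn: "fps_nth C 0 = a" "fps_nth C 1 = b" by (simp_all add: C_def c_def)
  show thesis
  proof (rule that[of r y])
    show "0 < r" "r \<le> R" using e R by (auto simp: r_def)
    then have z0: "z0 \<in> ball z0 r" by simp
    show "y holomorphic_on ball z0 r"
      unfolding holomorphic_on_open[OF open_ball] using dy by blast
    show "y z0 = a" unfolding y_def y0_def using cn by (simp add: eval_fps_at_0)
    have "deriv y z0 = deriv y0 0" using DERIV_imp_deriv[OF dy[OF z0]] by simp
    also have "\<dots> = fps_nth (fps_deriv C) 0"
      using has_fps_expansion_imp_0_eq_fps_nth_0[OF has_fps_expansion_deriv[OF y0C]] by simp
    finally show "deriv y z0 = b" using cn by simp
    show "deriv (deriv y) z = P z * y z" if z: "z \<in> ball z0 r" for z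
      using DERIV_imp_deriv[OF dy'[OF z]] e(2)[of "z - z0"] in0[OF z]
      by (simp add: y_def p_def r_def dist_norm norm_minus_commute[of z0 z])
  qed
qed

section \<open>Metrics of curvature -1 in a conformal coordinate\<close>

lemma has_vector_derivative_along_line:
  assumes "f differentiable (at (z + of_real t * v))"
  shows "((\<lambda>t. f (z + of_real t * v)) has_vector_derivative
     Re v *\<^sub>R partial_x f (z + of_real t * v) + Im v *\<^sub>R partial_y f (z + of_real t * v)) (at t)"
proof -
  have "((\<lambda>t. z + of_real t * v) has_derivative (\<lambda>h. of_real h * v)) (at t)"
    by (auto intro!: derivative_eq_intros)
  from has_derivative_compose[OF this has_derivative_partials[OF assms]]
  show ?thesis unfolding has_vector_derivative_def
    by (rule has_derivative_eq_rhs) (auto simp: algebra_simps)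
qed

text \<open>Differentiating \<open>f(x, y) = f(x, -e) + \<integral> f\<^sub>y(x, \<tau>) d\<tau>\<close> in \<open>x\<close> under the integral
  sign expresses \<open>f\<^sub>x\<close> as an integral up to \<open>y\<close> of a continuous function, whose derivative in
  \<open>y\<close> is the integrand.\<close>

lemma partial_y_partial_x_eq:
  fixes f :: "complex \<Rightarrow> 'b::banach"
  assumes U: "open U" and C: "Ck_on 2 U f" and z: "z \<in> U"
  shows "partial_y (partial_x f) z = partial_x (partial_y f) z"
proof -
  note [simp] = numeral_2_eq_2
  obtain e0 where e0: "e0 > 0" "ball z e0 \<subseteq> U" using U z open_contains_ball by blast
  \<comment> \<open>A third, so that the square of half side \<open>e\<close> lies in the ball.\<close>
  define e where "e = e0 / 3"
  have e: "e > 0" using e0 by (simp add: e_def)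
  define p where "p = (\<lambda>s t::real. z + of_real s + \<i> * of_real t)"
  have pU: "p s t \<in> U" if "\<bar>s\<bar> \<le> e" "\<bar>t\<bar> \<le> e" for s t
  proof -
    have "cmod (of_real s + \<i> * of_real t) \<le> \<bar>s\<bar> + \<bar>t\<bar>"
      using norm_triangle_ineq[of "of_real s :: complex" "\<i> * of_real t"] by (simp add: norm_mult)
    also have "\<dots> < e0" using that e0 by (simp add: e_def)
    finally have "dist (p s t) z < e0" by (simp add: p_def dist_norm add.assoc)
    then have "p s t \<in> ball z e0" by (simp add: dist_commute)
    then show ?thesis using e0 by blast
  qed
  have df: "f differentiable (at w)" "partial_x f differentiable (at w)" "partial_y f differentiable (at w)" if "w \<in> U" for w
    using C U that by (auto simp: differentiable_on_eq_differentiable_at)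
  have cont: "continuous_on U (partial_x (partial_y f))" "continuous_on U (partial_y f)" "continuous_on U (partial_y (partial_x f))"
    using C by (auto intro: differentiable_imp_continuous_on)
  have ps: "((\<lambda>s. g (p s t)) has_vector_derivative partial_x g (p s t)) (at s)"
    if "g differentiable (at (p s t))" for g :: "complex \<Rightarrow> 'b" and s t
    using has_vector_derivative_along_line[of g "z + \<i> * of_real t" s 1] that by (simp add: p_def algebra_simps)
  have pt: "((\<lambda>t. g (p s t)) has_vector_derivative partial_y g (p s t)) (at t)"
    if "g differentiable (at (p s t))" for g :: "complex \<Rightarrow> 'b" and s t
    using has_vector_derivative_along_line[of g "z + of_real s" t \<i>] that by (simp add: p_def algebra_simps)
  have cp: "continuous_on S (\<lambda>x. p (a x) (b x))" if "continuous_on S a" "continuous_on S b" for S :: "'c::topological_space set" and a b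
    unfolding p_def by (intro continuous_intros that)
  have mixed: "partial_x f (p 0 t) = partial_x f (p 0 (-e)) + integral {-e..t} (\<lambda>\<tau>. partial_x (partial_y f) (p 0 \<tau>))"
    if t: "t \<in> {-e..e}" for t
  proof -
    have 1: "f (p s t) - f (p s (-e)) = integral {-e..t} (\<lambda>\<tau>. partial_y f (p s \<tau>))" if s: "\<bar>s\<bar> \<le> e" for s
    proof -
      have "((\<lambda>\<tau>. partial_y f (p s \<tau>)) has_integral (f (p s t) - f (p s (-e)))) {-e..t}"
        using t s by (intro fundamental_theorem_of_calculus has_vector_derivative_at_within[OF pt] df pU) auto
      then show ?thesis by (simp add: integral_unique)
    qed
    have "((\<lambda>s. integral (cbox (-e) t) (\<lambda>\<tau>. partial_y f (p s \<tau>))) has_vector_derivative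
        integral (cbox (-e) t) (\<lambda>\<tau>. partial_x (partial_y f) (p 0 \<tau>))) (at 0 within {-e..e})"
    proof (rule leibniz_rule_vector_derivative)
      fix s \<tau> assume "s \<in> {-e..e}" "\<tau> \<in> cbox (-e) t"
      then show "((\<lambda>s. partial_y f (p s \<tau>)) has_vector_derivative partial_x (partial_y f) (p s \<tau>)) (at s within {-e..e})"
        using t by (intro has_vector_derivative_at_within[OF ps] df pU) auto
    next
      fix s assume s: "s \<in> {-e..e}"
      show "(\<lambda>\<tau>. partial_y f (p s \<tau>)) integrable_on cbox (-e) t"
        by (intro integrable_continuous continuous_on_compose2[OF cont(2)] cp continuous_intros)
          (use s t in \<open>auto intro!: pU\<close>)
    next
      show "continuous_on ({-e..e} \<times> cbox (-e) t) (\<lambda>(s, \<tau>). partial_x (partial_y f) (p s \<tau>))"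
        unfolding split_beta
        by (intro continuous_on_compose2[OF cont(1)] cp continuous_intros)
          (use t in \<open>auto intro!: pU\<close>)
    qed (use e in auto)
    from this[unfolded cbox_interval] have "((\<lambda>s. f (p s t) - f (p s (-e))) has_vector_derivative
        integral {-e..t} (\<lambda>\<tau>. partial_x (partial_y f) (p 0 \<tau>))) (at 0 within {-e..e})"
      by (rule has_vector_derivative_transform[rotated 2]) (use 1 e in auto)
    moreover have "at 0 within {-e..e} = at 0" using e by (intro at_within_interior) auto
    moreover have "((\<lambda>s. f (p s t) - f (p s (-e))) has_vector_derivative (partial_x f (p 0 t) - partial_x f (p 0 (-e)))) (at 0)"
      using t e by (intro has_vector_derivative_diff ps df pU) auto
    ultimately have "partial_x f (p 0 t) - partial_x f (p 0 (-e)) = integral {-e..t} (\<lambda>\<tau>. partial_x (partial_y f) (p 0 \<tau>))"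
      using vector_derivative_unique_at by metis
    then show ?thesis by (simp add: algebra_simps)
  qed
  have "((\<lambda>t. integral {-e..t} (\<lambda>\<tau>. partial_x (partial_y f) (p 0 \<tau>))) has_vector_derivative partial_x (partial_y f) (p 0 0)) (at 0 within {-e..e})"
    by (rule integral_has_vector_derivative, intro continuous_on_compose2[OF cont(1)] cp continuous_intros)
     (use e in \<open>auto intro!: pU\<close>)
  then have "((\<lambda>t. partial_x f (p 0 (-e)) + integral {-e..t} (\<lambda>\<tau>. partial_x (partial_y f) (p 0 \<tau>))) has_vector_derivative 0 + partial_x (partial_y f) (p 0 0)) (at 0 within {-e..e})"
    by (intro has_vector_derivative_add has_vector_derivative_const)
  then have "((\<lambda>t. partial_x f (p 0 t)) has_vector_derivative 0 + partial_x (partial_y f) (p 0 0)) (at 0 within {-e..e})"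
    by (rule has_vector_derivative_transform[rotated 2]) (use e in simp, rule mixed)
  moreover have "at 0 within {-e..e} = at 0" using e by (intro at_within_interior) auto
  moreover have "((\<lambda>t. partial_x f (p 0 t)) has_vector_derivative partial_y (partial_x f) (p 0 0)) (at 0)"
    using e by (intro pt df pU) auto
  ultimately have "partial_y (partial_x f) (p 0 0) = partial_x (partial_y f) (p 0 0)"
    using vector_derivative_unique_at by fastforce
  then show ?thesis by (simp add: p_def)
qed

lemma cauchy_riemann_imp_field_derivative:
  fixes f :: "complex \<Rightarrow> complex"
  assumes "f differentiable (at z)" "partial_y f z = \<i> * partial_x f z"
  shows "(f has_field_derivative partial_x f z) (at z)"
proof -
  have "(\<lambda>h. Re h *\<^sub>R partial_x f z + Im h *\<^sub>R partial_y f z) = (*) (partial_x f z)"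
    unfolding assms(2) by (rule ext) (simp add: complex_eq_iff algebra_simps)
  then show ?thesis using has_derivative_partials[OF assms(1)] by (simp add: has_field_derivative_def)
qed

text \<open>The equation \<open>\<Delta> ln r = 2 r\<close> rewritten through \<open>ln r = - 2 ln \<psi>\<close>.\<close>

lemma curvature_equation:
  assumes U: "open U" and C: "Ck_on 3 U r" and pos: "\<And>z. z \<in> U \<Longrightarrow> r z > 0"
    and K: "\<And>z. z \<in> U \<Longrightarrow> gauss_curvature r z = -1" and z: "z \<in> U"
  defines "\<psi> \<equiv> \<lambda>z. 1 / sqrt (r z)"
  shows "\<psi> z * (partial_x (partial_x \<psi>) z + partial_y (partial_y \<psi>) z)
     = (partial_x \<psi> z)\<^sup>2 + (partial_y \<psi> z)\<^sup>2 - 1"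
proof -
  have C\<psi>: "Ck_on (Suc (Suc (Suc 0))) U \<psi>"
    using Ck_on_inverse_sqrt[OF U C pos] unfolding \<psi>_def by (simp only: numeral_3_eq_3)
  then have d: "\<psi> differentiable (at w)" "partial_x \<psi> differentiable (at w)" "partial_y \<psi> differentiable (at w)" if "w \<in> U" for w
    using U that by (auto simp: differentiable_on_eq_differentiable_at)
  have \<psi>pos: "\<psi> w > 0" if "w \<in> U" for w using pos[OF that] by (simp add: \<psi>_def)
  have Lx: "partial_x (\<lambda>w. ln (r w)) w = -2 * partial_x \<psi> w / \<psi> w"
    and Ly: "partial_y (\<lambda>w. ln (r w)) w = -2 * partial_y \<psi> w / \<psi> w" if w: "w \<in> U" for w
  proof -
    have eq: "ln (r w) = -2 * ln (\<psi> w)" if "w \<in> U" for w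
      using pos[OF that] by (simp add: \<psi>_def ln_div ln_sqrt)
    have "((\<lambda>w. -2 * ln (\<psi> w)) has_derivative
       (\<lambda>h. -2 * (1 / \<psi> w * (Re h *\<^sub>R partial_x \<psi> w + Im h *\<^sub>R partial_y \<psi> w)))) (at w)"
      using \<psi>pos[OF w] by (auto intro!: derivative_eq_intros has_derivative_partials[OF d(1)[OF w]] simp: field_simps)
    from partials_of_has_derivative[OF this]
    show "partial_x (\<lambda>w. ln (r w)) w = -2 * partial_x \<psi> w / \<psi> w"
      "partial_y (\<lambda>w. ln (r w)) w = -2 * partial_y \<psi> w / \<psi> w"
      using partials_cong[OF U w, of "\<lambda>w. ln (r w)" "\<lambda>w. -2 * ln (\<psi> w)"] eq by auto
  qed
  note p0 = \<psi>pos[OF z]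
  have dq: "((\<lambda>w. -2 * g w / \<psi> w) has_derivative (\<lambda>h. (-2 * (Re h *\<^sub>R partial_x g z + Im h *\<^sub>R partial_y g z) * \<psi> z
      + 2 * g z * (Re h *\<^sub>R partial_x \<psi> z + Im h *\<^sub>R partial_y \<psi> z)) / (\<psi> z)\<^sup>2)) (at z)"
    if "g differentiable (at z)" for g :: "complex \<Rightarrow> real"
    using p0 by (auto intro!: derivative_eq_intros has_derivative_partials[OF d(1)[OF z]] has_derivative_partials[OF that]
        simp: field_simps power2_eq_square)
  have "partial_x (partial_x (\<lambda>w. ln (r w))) z = partial_x (\<lambda>w. -2 * partial_x \<psi> w / \<psi> w) z"
    by (rule partials_cong(1)[OF U z Lx])
  then have 1: "partial_x (partial_x (\<lambda>w. ln (r w))) z = (-2 * partial_x (partial_x \<psi>) z * \<psi> z + 2 * partial_x \<psi> z * partial_x \<psi> z) / (\<psi> z)\<^sup>2"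
    using partials_of_has_derivative(1)[OF dq[OF d(2)[OF z]]] by simp
  have "partial_y (partial_y (\<lambda>w. ln (r w))) z = partial_y (\<lambda>w. -2 * partial_y \<psi> w / \<psi> w) z"
    by (rule partials_cong(2)[OF U z Ly])
  then have 2: "partial_y (partial_y (\<lambda>w. ln (r w))) z = (-2 * partial_y (partial_y \<psi>) z * \<psi> z + 2 * partial_y \<psi> z * partial_y \<psi> z) / (\<psi> z)\<^sup>2"
    using partials_of_has_derivative(2)[OF dq[OF d(3)[OF z]]] by simp
  have "flat_laplacian (\<lambda>w. ln (r w)) z = 2 * r z"
    using K[OF z] pos[OF z] by (simp add: gauss_curvature_def field_simps)
  moreover have "r z = 1 / (\<psi> z)\<^sup>2"
    using pos[OF z] by (simp add: \<psi>_def power_divide)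
  ultimately have "(-2 * partial_x (partial_x \<psi>) z * \<psi> z + 2 * partial_x \<psi> z * partial_x \<psi> z) / (\<psi> z)\<^sup>2
     + (-2 * partial_y (partial_y \<psi>) z * \<psi> z + 2 * partial_y \<psi> z * partial_y \<psi> z) / (\<psi> z)\<^sup>2 = 2 * (1 / (\<psi> z)\<^sup>2)"
    unfolding flat_laplacian_def 1 2 by simp
  moreover have "a / s + b / s = 2 * (1 / s) \<Longrightarrow> s \<noteq> 0 \<Longrightarrow> a + b = 2" for a b s :: real
    by (simp add: field_simps)
  ultimately have "(-2 * partial_x (partial_x \<psi>) z * \<psi> z + 2 * partial_x \<psi> z * partial_x \<psi> z)
     + (-2 * partial_y (partial_y \<psi>) z * \<psi> z + 2 * partial_y \<psi> z * partial_y \<psi> z) = 2"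
    using p0 by auto
  then show ?thesis by (simp add: algebra_simps power2_eq_square)
qed

definition wirtinger_dzz :: "(complex \<Rightarrow> real) \<Rightarrow> complex \<Rightarrow> complex" where
  "wirtinger_dzz f z = Complex ((partial_x (partial_x f) z - partial_y (partial_y f) z) / 4) (- partial_x (partial_y f) z / 2)"

text \<open>Up to the factor \<open>-2\<close> the quotient is the projective connection
  \<open>(ln r)\<^sub>z\<^sub>z - (ln r)\<^sub>z\<^sup>2 / 2\<close> of the metric \<open>r |dz|\<^sup>2\<close> with
  \<open>r = 1 / \<psi>\<^sup>2\<close>. Its two Cauchy-Riemann equations are the \<open>x\<close>- and \<open>y\<close>-derivatives of
  the curvature equation.\<close>

lemma schwarzian_holomorphic:
  assumes U: "open U" and C: "Ck_on 3 U \<psi>" and pos: "\<And>z. z \<in> U \<Longrightarrow> \<psi> z > 0"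
    and K: "\<And>z. z \<in> U \<Longrightarrow> \<psi> z * (partial_x (partial_x \<psi>) z + partial_y (partial_y \<psi>) z)
       = (partial_x \<psi> z)\<^sup>2 + (partial_y \<psi> z)\<^sup>2 - 1"
  shows "(\<lambda>z. wirtinger_dzz \<psi> z / of_real (\<psi> z)) holomorphic_on U"
proof -
  note [simp] = numeral_2_eq_2 numeral_3_eq_3
  let ?x = "partial_x \<psi>" and ?y = "partial_y \<psi>"
  let ?xx = "partial_x ?x" and ?yy = "partial_y ?y" and ?yx = "partial_x ?y"
  let ?P = "\<lambda>z. wirtinger_dzz \<psi> z / of_real (\<psi> z)"
  have d: "\<psi> differentiable (at w)" "?x differentiable (at w)" "?y differentiable (at w)"
    "?xx differentiable (at w)" "?yx differentiable (at w)" "?yy differentiable (at w)" if "w \<in> U" for w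
    using C U that by (auto simp: differentiable_on_eq_differentiable_at)
  have C2: "Ck_on 2 U \<psi>" "Ck_on 2 U ?x" "Ck_on 2 U ?y"
    using Ck_on_Suc_imp[of "Suc (Suc 0)" U \<psi>] C by auto
  have "(?P has_field_derivative partial_x ?P z) (at z)" if z: "z \<in> U" for z
  proof -
    note hd = has_derivative_partials[OF d(1)[OF z]] has_derivative_partials[OF d(2)[OF z]]
      has_derivative_partials[OF d(3)[OF z]] has_derivative_partials[OF d(4)[OF z]]
      has_derivative_partials[OF d(5)[OF z]] has_derivative_partials[OF d(6)[OF z]]
    have sym: "partial_y ?x w = ?yx w" "partial_y ?xx w = partial_x (partial_y ?x) w"
       "partial_y ?yx w = partial_x ?yy w" if "w \<in> U" for w
      using partial_y_partial_x_eq[OF U _ that] C2 by blast+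
    have s1: "partial_y ?xx z = partial_x ?yx z"
      using sym(2)[OF z] partials_cong(1)[OF U z, of "partial_y ?x" ?yx] sym(1) by simp
    have s2: "partial_y ?yx z = partial_x ?yy z" by (rule sym(3)[OF z])
    \<comment> \<open>\<open>?K\<close> is constant by the curvature equation, so both its partial derivatives vanish.\<close>
    let ?K = "\<lambda>w. \<psi> w * (?xx w + ?yy w) - (?x w)\<^sup>2 - (?y w)\<^sup>2"
    have hK: "(?K has_derivative (\<lambda>h. \<psi> z * ((Re h *\<^sub>R partial_x ?xx z + Im h *\<^sub>R partial_y ?xx z) + (Re h *\<^sub>R partial_x ?yy z + Im h *\<^sub>R partial_y ?yy z))
       + (Re h *\<^sub>R ?x z + Im h *\<^sub>R ?y z) * (?xx z + ?yy z)
       - 2 * ?x z * (Re h *\<^sub>R ?xx z + Im h *\<^sub>R partial_y ?x z) - 2 * ?y z * (Re h *\<^sub>R ?yx z + Im h *\<^sub>R ?yy z))) (at z)"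
      by (auto intro!: derivative_eq_intros hd simp: algebra_simps)
    have "partial_x ?K z = 0" "partial_y ?K z = 0"
      using partials_cong[OF U z, of ?K "\<lambda>_. -1"] K by (auto simp: partials_const)
    then have K1: "\<psi> z * (partial_x ?xx z + partial_x ?yy z) + ?x z * (?xx z + ?yy z) - 2 * ?x z * ?xx z - 2 * ?y z * ?yx z = 0"
      and K2: "\<psi> z * (partial_x ?yx z + partial_y ?yy z) + ?y z * (?xx z + ?yy z) - 2 * ?x z * ?yx z - 2 * ?y z * ?yy z = 0"
      using partials_of_has_derivative[OF hK] sym(1)[OF z] s1 by simp_all
    have p0: "\<psi> z \<noteq> 0" using pos[OF z] by simp
    have eqP: "?P = (\<lambda>w. of_real ((?xx w - ?yy w) / (4 * \<psi> w)) + \<i> * of_real (- ?yx w / (2 * \<psi> w)))"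
      by (rule ext) (simp add: wirtinger_dzz_def complex_eq_iff Re_divide_of_real Im_divide_of_real)
    have h1: "((\<lambda>w. (?xx w - ?yy w) / (4 * \<psi> w)) has_derivative (\<lambda>h. (((Re h *\<^sub>R partial_x ?xx z + Im h *\<^sub>R partial_y ?xx z) - (Re h *\<^sub>R partial_x ?yy z + Im h *\<^sub>R partial_y ?yy z)) * \<psi> z
        - (?xx z - ?yy z) * (Re h *\<^sub>R ?x z + Im h *\<^sub>R ?y z)) / (4 * (\<psi> z)\<^sup>2))) (at z)"
      using p0 by (auto intro!: derivative_eq_intros hd simp: field_simps power2_eq_square)
    have h2: "((\<lambda>w. - ?yx w / (2 * \<psi> w)) has_derivative (\<lambda>h. (- (Re h *\<^sub>R partial_x ?yx z + Im h *\<^sub>R partial_y ?yx z) * \<psi> z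
        + ?yx z * (Re h *\<^sub>R ?x z + Im h *\<^sub>R ?y z)) / (2 * (\<psi> z)\<^sup>2))) (at z)"
      using p0 by (auto intro!: derivative_eq_intros hd simp: field_simps power2_eq_square)
    have hP: "(?P has_derivative (\<lambda>h. of_real ((((Re h *\<^sub>R partial_x ?xx z + Im h *\<^sub>R partial_y ?xx z) - (Re h *\<^sub>R partial_x ?yy z + Im h *\<^sub>R partial_y ?yy z)) * \<psi> z
        - (?xx z - ?yy z) * (Re h *\<^sub>R ?x z + Im h *\<^sub>R ?y z)) / (4 * (\<psi> z)\<^sup>2))
        + \<i> * of_real ((- (Re h *\<^sub>R partial_x ?yx z + Im h *\<^sub>R partial_y ?yx z) * \<psi> z
        + ?yx z * (Re h *\<^sub>R ?x z + Im h *\<^sub>R ?y z)) / (2 * (\<psi> z)\<^sup>2)))) (at z)"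
      unfolding eqP by (intro has_derivative_add has_derivative_mult_right has_derivative_of_real h1 h2)
    show ?thesis
    proof (rule cauchy_riemann_imp_field_derivative)
      show "?P differentiable (at z)" using hP differentiable_def by blast
      have a: "(partial_y ?xx z - partial_y ?yy z) * \<psi> z - (?xx z - ?yy z) * ?y z = 2 * (partial_x ?yx z * \<psi> z - ?yx z * ?x z)"
        using K2 s1 by (simp add: algebra_simps)
      have b: "(partial_x ?xx z - partial_x ?yy z) * \<psi> z - (?xx z - ?yy z) * ?x z = - 2 * (partial_y ?yx z * \<psi> z - ?yx z * ?y z)"
        using K1 s2 by (simp add: algebra_simps)
      show "partial_y ?P z = \<i> * partial_x ?P z"
        unfolding partials_of_has_derivative[OF hP] using a b p0
        by (simp add: complex_eq_iff divide_simps)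
    qed
  qed
  then show ?thesis unfolding holomorphic_on_open[OF U] by blast
qed

text \<open>Along a ray with direction \<open>v\<close> the triple of \<open>\<psi>\<close>, \<open>\<psi>\<^sub>z\<close> and \<open>\<Delta>\<psi> / 4\<close> of a real solution of
  \<open>\<psi>\<^sub>z\<^sub>z = P \<psi>\<close> satisfies this closed linear system, because \<open>P\<close> is holomorphic. Here
  \<open>(d, c, e)\<close> stands for the difference of two such triples.\<close>

lemma wirtinger_system_unique:
  fixes d e :: "real \<Rightarrow> real" and c P :: "real \<Rightarrow> complex"
  assumes d: "\<And>t. t \<in> {0..1} \<Longrightarrow> (d has_real_derivative 2 * Re (v * c t)) (at t)"
    and c: "\<And>t. t \<in> {0..1} \<Longrightarrow> (c has_vector_derivative v * P t * of_real (d t) + cnj v * of_real (e t)) (at t)"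
    and e: "\<And>t. t \<in> {0..1} \<Longrightarrow> (e has_real_derivative 2 * Re (v * P t * cnj (c t))) (at t)"
    and P: "\<And>t. t \<in> {0..1} \<Longrightarrow> cmod (P t) \<le> K"
    and init: "d 0 = 0" "c 0 = 0" "e 0 = 0"
  shows "d 1 = 0"
proof -
  define cr ci where "cr = (\<lambda>t. Re (c t))" and "ci = (\<lambda>t. Im (c t))"
  define E where "E = (\<lambda>t. (d t)\<^sup>2 + (cr t)\<^sup>2 + (ci t)\<^sup>2 + (e t)\<^sup>2)"
  define E' where "E' = (\<lambda>t. 2 * (d t * (2 * Re (v * c t)))
     + 2 * Re ((v * P t * of_real (d t) + cnj v * of_real (e t)) * cnj (c t)) + 2 * (e t * (2 * Re (v * P t * cnj (c t)))))"
  have "E 1 = 0"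
  proof (rule gronwall_zero[where a = 0 and b = 1 and ?t0.0 = 0 and t = 1 and E = E and E' = E' and C = "cmod v * (3 + 3 * K)"])
    fix t :: real assume t: "t \<in> {0..1}"
    have "(cr has_real_derivative Re (v * P t * of_real (d t) + cnj v * of_real (e t))) (at t)"
      "(ci has_real_derivative Im (v * P t * of_real (d t) + cnj v * of_real (e t))) (at t)"
      using bounded_linear.has_vector_derivative[OF bounded_linear_Re c[OF t]]
        bounded_linear.has_vector_derivative[OF bounded_linear_Im c[OF t]]
      unfolding cr_def ci_def by (simp_all only: has_real_derivative_iff_has_vector_derivative)
    then show "(E has_real_derivative E' t) (at t)"
      unfolding E_def E'_def
      by (auto intro!: derivative_eq_intros d e t simp: cr_def[symmetric] ci_def[symmetric] algebra_simps)
        (simp add: cr_def ci_def algebra_simps)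
    have EE: "E t = (d t)\<^sup>2 + (cmod (c t))\<^sup>2 + (e t)\<^sup>2" by (simp add: E_def cr_def ci_def cmod_power2)
    show "E t \<ge> 0" by (simp add: E_def)
    have amgm: "2 * (x * y) \<le> x\<^sup>2 + y\<^sup>2" for x y :: real
      using sum_squares_bound[of x y] by simp
    define D G H where "D = \<bar>d t\<bar>" and "G = cmod (c t)" and "H = \<bar>e t\<bar>"
    have K0: "0 \<le> K" using P[OF t] norm_ge_zero order_trans by blast
    have 1: "\<bar>Re (v * c t)\<bar> \<le> cmod v * G" unfolding G_def by (metis abs_Re_le_cmod norm_mult)
    have 2: "\<bar>Re ((v * P t * of_real (d t) + cnj v * of_real (e t)) * cnj (c t))\<bar> \<le> cmod v * (K * D + H) * G"
    proof -
      have "cmod (v * P t * of_real (d t) + cnj v * of_real (e t)) \<le> cmod v * cmod (P t) * D + cmod v * H"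
        unfolding D_def H_def by (rule order_trans[OF norm_triangle_ineq]) (simp add: norm_mult)
      also have "\<dots> \<le> cmod v * K * D + cmod v * H"
        using P[OF t] by (intro add_mono mult_right_mono mult_left_mono) (auto simp: D_def)
      finally have "cmod (v * P t * of_real (d t) + cnj v * of_real (e t)) * G \<le> cmod v * (K * D + H) * G"
        by (intro mult_right_mono) (auto simp: G_def algebra_simps)
      then show ?thesis unfolding G_def
        by (intro order_trans[OF abs_Re_le_cmod]) (simp add: norm_mult)
    qed
    have 3: "\<bar>Re (v * P t * cnj (c t))\<bar> \<le> cmod v * K * G"
    proof -
      have "\<bar>Re (v * P t * cnj (c t))\<bar> \<le> cmod v * cmod (P t) * G"
        unfolding G_def by (rule order_trans[OF abs_Re_le_cmod]) (simp add: norm_mult)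
      also have "\<dots> \<le> cmod v * K * G" using P[OF t] by (intro mult_right_mono mult_left_mono) (auto simp: G_def)
      finally show ?thesis .
    qed
    have "\<bar>E' t\<bar> \<le> 2 * (D * (2 * (cmod v * G))) + 2 * (cmod v * (K * D + H) * G) + 2 * (H * (2 * (cmod v * K * G)))"
    proof -
      have "\<bar>d t * (2 * Re (v * c t))\<bar> \<le> D * (2 * (cmod v * G))"
        unfolding abs_mult using 1 by (intro mult_mono) (auto simp: D_def)
      moreover have "\<bar>e t * (2 * Re (v * P t * cnj (c t)))\<bar> \<le> H * (2 * (cmod v * K * G))"
        unfolding abs_mult[of "e t"] using 3 by (intro mult_mono) (auto simp: H_def abs_mult)
      ultimately show ?thesis unfolding E'_def using 2 by linarith
    qed
    also have "\<dots> = cmod v * (2 * (2 * (D * G)) + K * (2 * (D * G)) + 2 * (H * G) + K * (2 * (2 * (H * G))))"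
      by (simp add: algebra_simps)
    also have "\<dots> \<le> cmod v * (2 * (D\<^sup>2 + G\<^sup>2) + K * (D\<^sup>2 + G\<^sup>2) + (H\<^sup>2 + G\<^sup>2) + K * (2 * (H\<^sup>2 + G\<^sup>2)))"
      using K0 by (intro mult_left_mono add_mono amgm) auto
    also have "\<dots> \<le> cmod v * ((3 + 3 * K) * (D\<^sup>2 + G\<^sup>2 + H\<^sup>2))"
      using K0 by (intro mult_left_mono) (auto simp: algebra_simps)
    also have "\<dots> = cmod v * (3 + 3 * K) * E t" unfolding EE D_def G_def H_def by simp
    finally show "\<bar>E' t\<bar> \<le> cmod v * (3 + 3 * K) * E t" .
  qed (auto simp: E_def cr_def ci_def init)
  then show ?thesis by (auto simp: E_def add_nonneg_eq_0_iff)
qed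

section \<open>Strip coordinates\<close>

lemma has_vector_derivative_field_along_line:
  fixes f :: "complex \<Rightarrow> complex"
  assumes "(f has_field_derivative f') (at (z + of_real t * v))"
  shows "((\<lambda>t. f (z + of_real t * v)) has_vector_derivative v * f') (at t)"
proof -
  have "((\<lambda>t. z + of_real t * v) has_vector_derivative v) (at t)"
    by (auto intro!: derivative_eq_intros simp: has_vector_derivative_def scaleR_conv_of_real)
  from field_vector_diff_chain_at[OF this assms] show ?thesis by (simp add: o_def)
qed

text \<open>Both \<open>\<psi> = 1 / sqrt r\<close> and \<open>Re (y1 * cnj y2)\<close> solve the linear system of
  \<open>wirtinger_system_unique\<close> along rays from \<open>z0\<close>, so it is enough that they agree at \<open>z0\<close>
  together with their derivatives \<open>\<partial>\<^sub>z\<close> and \<open>\<Delta> / 4\<close>. Taking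
  \<open>y1 = y2 = q\<close> at \<open>z0\<close>, the first derivative fixes \<open>y1' + y2'\<close> and the Wronskian 1 fixes
  \<open>y1' - y2'\<close>; the condition on \<open>\<Delta>\<close> is then the curvature equation at \<open>z0\<close>. The
  argument of \<open>q\<close> remains free and is used to prescribe the direction \<open>e\<close>.\<close>

lemma liouville_product_form:
  assumes U: "open U" and C: "Ck_on 3 U r" and pos: "\<And>z. z \<in> U \<Longrightarrow> r z > 0"
    and K: "\<And>z. z \<in> U \<Longrightarrow> gauss_curvature r z = -1" and z0: "z0 \<in> U"
    and e: "r z0 * (cmod e)\<^sup>2 = 1"
  obtains \<rho> y1 y2 where "\<rho> > 0" "ball z0 \<rho> \<subseteq> U" "y1 holomorphic_on ball z0 \<rho>" "y2 holomorphic_on ball z0 \<rho>"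
    "\<And>z. z \<in> ball z0 \<rho> \<Longrightarrow> deriv y1 z * y2 z - y1 z * deriv y2 z = 1"
    "\<And>z. z \<in> ball z0 \<rho> \<Longrightarrow> 1 / sqrt (r z) = Re (y1 z * cnj (y2 z))"
    "y1 z0 = y2 z0" "(y1 z0)\<^sup>2 = e"
proof -
  define \<psi> where "\<psi> = (\<lambda>z. 1 / sqrt (r z))"
  let ?x = "partial_x \<psi>" and ?y = "partial_y \<psi>"
  let ?xx = "partial_x ?x" and ?yx = "partial_x ?y" and ?yy = "partial_y ?y"
  have C3: "Ck_on 3 U \<psi>" unfolding \<psi>_def by (rule Ck_on_inverse_sqrt[OF U C pos])
  have \<psi>pos: "\<psi> z > 0" if "z \<in> U" for z using pos[OF that] by (simp add: \<psi>_def)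
  have ceq: "\<psi> z * (partial_x (partial_x \<psi>) z + partial_y (partial_y \<psi>) z)
     = (partial_x \<psi> z)\<^sup>2 + (partial_y \<psi> z)\<^sup>2 - 1" if "z \<in> U" for z
    unfolding \<psi>_def by (rule curvature_equation[OF U C pos K that])
  define P where "P = (\<lambda>z. wirtinger_dzz \<psi> z / of_real (\<psi> z))"
  have Ph: "P holomorphic_on U" unfolding P_def by (rule schwarzian_holomorphic[OF U C3 \<psi>pos ceq])
  define \<psi>z where "\<psi>z = (\<lambda>z. Complex (?x z / 2) (- ?y z / 2))"
  \<comment> \<open>By the curvature equation \<open>n\<close> is a quarter of the Laplacian of \<open>\<psi>\<close>; in this form it can be differentiated once more.\<close>
  define n where "n = (\<lambda>z. ((?x z)\<^sup>2 + (?y z)\<^sup>2 - 1) / (4 * \<psi> z))"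
  obtain R where R: "R > 0" "cball z0 R \<subseteq> U" using U z0 open_contains_cball by blast
  have "compact (P ` cball z0 R)"
    using Ph R by (intro compact_continuous_image compact_cball)
      (meson continuous_on_subset holomorphic_on_imp_continuous_on)
  then obtain B where B: "\<And>z. z \<in> cball z0 R \<Longrightarrow> cmod (P z) \<le> B"
    using compact_imp_bounded[of "P ` cball z0 R"] unfolding bounded_iff by blast
  define q where "q = csqrt e"
  have q2: "q\<^sup>2 = e" by (simp add: q_def)
  have e0: "cmod e = \<psi> z0"
  proof -
    have "r z0 > 0" using pos z0 by blast
    then have "(cmod e)\<^sup>2 = 1 / r z0" using e by (simp add: field_simps)
    then have "sqrt ((cmod e)\<^sup>2) = sqrt (1 / r z0)" by simp
    then show ?thesis by (simp add: \<psi>_def real_sqrt_divide)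
  qed
  have qq: "(cmod q)\<^sup>2 = \<psi> z0" using e0 q2 by (metis norm_power)
  have q0: "q \<noteq> 0" using qq \<psi>pos[OF z0] by auto
  \<comment> \<open>The half sum and the half difference of the initial derivatives.\<close>
  define s h where "s = \<psi>z z0 / cnj q" and "h = 1 / (2 * q)"
  have PR: "P holomorphic_on ball z0 R" using Ph R ball_subset_cball by (meson holomorphic_on_subset order_trans)
  obtain y1 r1 where y1: "0 < r1" "r1 \<le> R" "y1 holomorphic_on ball z0 r1" "y1 z0 = q" "deriv y1 z0 = s + h"
    "\<And>z. z \<in> ball z0 r1 \<Longrightarrow> deriv (deriv y1) z = P z * y1 z"
    by (rule holomorphic_linear_ode[OF PR R(1), of q "s + h"]) blast
  obtain y2 r2 where y2: "0 < r2" "r2 \<le> R" "y2 holomorphic_on ball z0 r2" "y2 z0 = q" "deriv y2 z0 = s - h"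
    "\<And>z. z \<in> ball z0 r2 \<Longrightarrow> deriv (deriv y2) z = P z * y2 z"
    by (rule holomorphic_linear_ode[OF PR R(1), of q "s - h"]) blast
  define \<rho> where "\<rho> = min r1 r2"
  have \<rho>: "\<rho> > 0" "ball z0 \<rho> \<subseteq> U" "ball z0 \<rho> \<subseteq> cball z0 R"
    using y1(1,2) y2(1,2) R(2) by (auto simp: \<rho>_def)
  have hol: "y1 holomorphic_on ball z0 \<rho>" "y2 holomorphic_on ball z0 \<rho>"
    using y1(3) y2(3) by (auto simp: \<rho>_def elim: holomorphic_on_subset)
  have d1: "(y1 has_field_derivative deriv y1 z) (at z)" "(y2 has_field_derivative deriv y2 z) (at z)"
     "(deriv y1 has_field_derivative P z * y1 z) (at z)" "(deriv y2 has_field_derivative P z * y2 z) (at z)"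
     if z: "z \<in> ball z0 \<rho>" for z
  proof -
    show "(y1 has_field_derivative deriv y1 z) (at z)" "(y2 has_field_derivative deriv y2 z) (at z)"
      using holomorphic_derivI[OF hol(1) open_ball z] holomorphic_derivI[OF hol(2) open_ball z] by auto
    have "z \<in> ball z0 r1" "z \<in> ball z0 r2" using z by (auto simp: \<rho>_def)
    then show "(deriv y1 has_field_derivative P z * y1 z) (at z)" "(deriv y2 has_field_derivative P z * y2 z) (at z)"
      using holomorphic_derivI[OF holomorphic_deriv[OF hol(1) open_ball] open_ball z]
       holomorphic_derivI[OF holomorphic_deriv[OF hol(2) open_ball] open_ball z] y1(6) y2(6) by metis+
  qed
  have z0b: "z0 \<in> ball z0 \<rho>" using \<rho> by simp
  have W: "deriv y1 z * y2 z - y1 z * deriv y2 z = 1" if z: "z \<in> ball z0 \<rho>" for z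
  proof -
    let ?W = "\<lambda>z. deriv y1 z * y2 z - y1 z * deriv y2 z"
    have "(?W has_field_derivative 0) (at z within ball z0 \<rho>)" if z: "z \<in> ball z0 \<rho>" for z
      by (rule has_field_derivative_at_within) (auto intro!: derivative_eq_intros d1 z simp del: mem_ball)
    then obtain c where c: "\<And>z. z \<in> ball z0 \<rho> \<Longrightarrow> ?W z = c"
      using has_field_derivative_zero_constant[of "ball z0 \<rho>" ?W] by blast
    have "?W z0 = 1" using q0 by (simp add: y1 y2 h_def algebra_simps)
    then show ?thesis using c[OF z] c[OF z0b] by simp
  qed
  have main: "\<psi> z = Re (y1 z * cnj (y2 z))" if z: "z \<in> ball z0 \<rho>" for z
  proof -
    define v where "v = z - z0"
    define \<gamma> where "\<gamma> = (\<lambda>t::real. z0 + of_real t * v)"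
    have \<gamma>b: "\<gamma> t \<in> ball z0 \<rho>" if "t \<in> {0..1}" for t
    proof -
      have "cmod (of_real t * v) \<le> 1 * cmod v" using that unfolding norm_mult by (intro mult_right_mono) auto
      also have "\<dots> < \<rho>" using z by (simp add: v_def dist_norm norm_minus_commute)
      finally show ?thesis by (simp add: \<gamma>_def dist_norm)
    qed
    define d where "d = (\<lambda>t. \<psi> (\<gamma> t) - Re (y1 (\<gamma> t) * cnj (y2 (\<gamma> t))))"
    define c where "c = (\<lambda>t. \<psi>z (\<gamma> t) - (deriv y1 (\<gamma> t) * cnj (y2 (\<gamma> t)) + deriv y2 (\<gamma> t) * cnj (y1 (\<gamma> t))) / 2)"
    define k where "k = (\<lambda>t. n (\<gamma> t) - Re (deriv y1 (\<gamma> t) * cnj (deriv y2 (\<gamma> t))))"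
    have "d 1 = 0"
    proof (rule wirtinger_system_unique[where d = d and c = c and e = k and v = v and P = "\<lambda>t. P (\<gamma> t)" and K = B])
      fix t :: real assume t: "t \<in> {0..1}"
      define w where "w = \<gamma> t"
      have \<gamma>_w: "w = z0 + of_real t * v" by (simp add: w_def \<gamma>_def)
      have wb: "w \<in> ball z0 \<rho>" unfolding w_def by (rule \<gamma>b[OF t])
      then have wU: "w \<in> U" using \<rho> by blast
      have p0: "\<psi> w \<noteq> 0" using \<psi>pos[OF wU] by simp
      note C' = C3[unfolded numeral_3_eq_3]
      have df: "\<psi> differentiable (at w)" "?x differentiable (at w)" "?y differentiable (at w)"
        using C' U wU by (auto simp: differentiable_on_eq_differentiable_at)
      have sym: "partial_y ?x w = ?yx w"
        using partial_y_partial_x_eq[OF U _ wU] Ck_on_Suc_imp[OF C'] by (simp add: numeral_2_eq_2)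
      have a: "((\<lambda>t. \<psi> (\<gamma> t)) has_real_derivative Re v * ?x w + Im v * ?y w) (at t)"
        and b: "((\<lambda>t. ?x (\<gamma> t)) has_real_derivative Re v * ?xx w + Im v * ?yx w) (at t)"
        and b': "((\<lambda>t. ?y (\<gamma> t)) has_real_derivative Re v * ?yx w + Im v * ?yy w) (at t)"
        using has_vector_derivative_along_line[of \<psi> z0 t v, unfolded \<gamma>_w[symmetric], OF df(1)]
          has_vector_derivative_along_line[of "?x" z0 t v, unfolded \<gamma>_w[symmetric], OF df(2)]
          has_vector_derivative_along_line[of "?y" z0 t v, unfolded \<gamma>_w[symmetric], OF df(3)]
        unfolding has_real_derivative_iff_has_vector_derivative sym \<gamma>_def by simp_all
      have Y: "((\<lambda>t. y1 (\<gamma> t)) has_vector_derivative v * deriv y1 w) (at t)"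
         "((\<lambda>t. y2 (\<gamma> t)) has_vector_derivative v * deriv y2 w) (at t)"
         "((\<lambda>t. deriv y1 (\<gamma> t)) has_vector_derivative v * (P w * y1 w)) (at t)"
         "((\<lambda>t. deriv y2 (\<gamma> t)) has_vector_derivative v * (P w * y2 w)) (at t)"
        using d1[OF wb] unfolding w_def \<gamma>_def by (auto intro: has_vector_derivative_field_along_line)
      have S1: "((\<lambda>t. Re (y1 (\<gamma> t) * cnj (y2 (\<gamma> t)))) has_real_derivative
          Re (y1 w * cnj (v * deriv y2 w) + (v * deriv y1 w) * cnj (y2 w))) (at t)"
        unfolding has_real_derivative_iff_has_vector_derivative
        using bounded_linear.has_vector_derivative[OF bounded_linear_Re has_vector_derivative_mult[OF Y(1) has_vector_derivative_cnj[OF Y(2)]]]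
        by (simp only: w_def)
      have S3: "((\<lambda>t. Re (deriv y1 (\<gamma> t) * cnj (deriv y2 (\<gamma> t)))) has_real_derivative
          Re (deriv y1 w * cnj (v * (P w * y2 w)) + (v * (P w * y1 w)) * cnj (deriv y2 w))) (at t)"
        unfolding has_real_derivative_iff_has_vector_derivative
        using bounded_linear.has_vector_derivative[OF bounded_linear_Re has_vector_derivative_mult[OF Y(3) has_vector_derivative_cnj[OF Y(4)]]]
        by (simp only: w_def)
      have S2: "((\<lambda>t. (deriv y1 (\<gamma> t) * cnj (y2 (\<gamma> t)) + deriv y2 (\<gamma> t) * cnj (y1 (\<gamma> t))) / 2) has_vector_derivative
          ((deriv y1 w * cnj (v * deriv y2 w) + (v * (P w * y1 w)) * cnj (y2 w)) +
           (deriv y2 w * cnj (v * deriv y1 w) + (v * (P w * y2 w)) * cnj (y1 w))) / 2) (at t)"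
        using has_vector_derivative_divide[OF has_vector_derivative_add[OF has_vector_derivative_mult[OF Y(3) has_vector_derivative_cnj[OF Y(2)]]
           has_vector_derivative_mult[OF Y(4) has_vector_derivative_cnj[OF Y(1)]]]]
        by (simp only: w_def)
      have "(d has_real_derivative (Re v * ?x w + Im v * ?y w) -
          Re (y1 w * cnj (v * deriv y2 w) + (v * deriv y1 w) * cnj (y2 w))) (at t)"
        unfolding d_def by (intro DERIV_diff a S1)
      moreover have "(Re v * ?x w + Im v * ?y w) -
          Re (y1 w * cnj (v * deriv y2 w) + (v * deriv y1 w) * cnj (y2 w)) = 2 * Re (v * c t)"
        unfolding c_def \<psi>z_def w_def[symmetric] by (simp add: field_simps)
      ultimately show "(d has_real_derivative 2 * Re (v * c t)) (at t)" by simp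
      have zz: "P w * of_real (\<psi> w) = wirtinger_dzz \<psi> w" using p0 by (simp add: P_def)
      have n4: "n w = (?xx w + ?yy w) / 4"
        using ceq[OF wU] p0 by (simp add: n_def field_simps)
      have "((\<lambda>t. \<psi>z (\<gamma> t)) has_vector_derivative
         Complex ((Re v * ?xx w + Im v * ?yx w) / 2)
          (- (Re v * ?yx w + Im v * ?yy w) / 2)) (at t)"
        unfolding \<psi>z_def has_vector_derivative_complex_iff
        using b b' by (auto intro!: derivative_eq_intros simp: field_simps)
      moreover have "Complex ((Re v * ?xx w + Im v * ?yx w) / 2)
          (- (Re v * ?yx w + Im v * ?yy w) / 2)
          = v * (P w * of_real (\<psi> w)) + cnj v * of_real (n w)"
        unfolding zz n4 wirtinger_dzz_def complex_eq_iff by (simp add: field_simps)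
      ultimately have "(c has_vector_derivative (v * (P w * of_real (\<psi> w)) + cnj v * of_real (n w)) -
          ((deriv y1 w * cnj (v * deriv y2 w) + (v * (P w * y1 w)) * cnj (y2 w)) +
           (deriv y2 w * cnj (v * deriv y1 w) + (v * (P w * y2 w)) * cnj (y1 w))) / 2) (at t)"
        unfolding c_def by (intro has_vector_derivative_diff S2) simp
      moreover have "(v * (P w * of_real (\<psi> w)) + cnj v * of_real (n w)) -
          ((deriv y1 w * cnj (v * deriv y2 w) + (v * (P w * y1 w)) * cnj (y2 w)) +
           (deriv y2 w * cnj (v * deriv y1 w) + (v * (P w * y2 w)) * cnj (y1 w))) / 2
          = v * P (\<gamma> t) * of_real (d t) + cnj v * of_real (k t)"
      proof -
        have re: "of_real (Re (x * cnj y)) = (x * cnj y + cnj x * y) / 2" for x y :: complex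
          by (simp add: complex_eq_iff)
        show ?thesis unfolding d_def k_def w_def[symmetric] of_real_diff re
          by (simp add: field_simps)
      qed
      ultimately show "(c has_vector_derivative v * P (\<gamma> t) * of_real (d t) + cnj v * of_real (k t)) (at t)" by simp
      have "((\<lambda>t. n (\<gamma> t)) has_real_derivative
         ((2 * ?x w * (Re v * ?xx w + Im v * ?yx w)
         + 2 * ?y w * (Re v * ?yx w + Im v * ?yy w)) / (4 * \<psi> w)
         - n w * (Re v * ?x w + Im v * ?y w) / \<psi> w)) (at t)"
        unfolding n_def using p0 unfolding w_def
        by (auto intro!: derivative_eq_intros a[unfolded w_def] b[unfolded w_def] b'[unfolded w_def] simp: field_simps power2_eq_square)
      moreover have "(2 * ?x w * (Re v * ?xx w + Im v * ?yx w)
         + 2 * ?y w * (Re v * ?yx w + Im v * ?yy w)) / (4 * \<psi> w)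
         - n w * (Re v * ?x w + Im v * ?y w) / \<psi> w = 2 * Re (v * P w * cnj (\<psi>z w))"
        using p0 unfolding n4 P_def wirtinger_dzz_def \<psi>z_def
        by (simp add: Re_divide_of_real Im_divide_of_real field_simps)
      ultimately have "(k has_real_derivative 2 * Re (v * P w * cnj (\<psi>z w)) -
         Re (deriv y1 w * cnj (v * (P w * y2 w)) + (v * (P w * y1 w)) * cnj (deriv y2 w))) (at t)"
        unfolding k_def by (intro DERIV_diff S3) simp
      moreover have "2 * Re (v * P w * cnj (\<psi>z w)) -
         Re (deriv y1 w * cnj (v * (P w * y2 w)) + (v * (P w * y1 w)) * cnj (deriv y2 w))
         = 2 * Re (v * P (\<gamma> t) * cnj (c t))"
      proof -
        have "Re (deriv y1 w * cnj (v * (P w * y2 w))) = Re (v * P w * (cnj (deriv y1 w) * y2 w))"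
          by (simp add: algebra_simps)
        then show ?thesis unfolding c_def w_def[symmetric]
          by (simp add: field_simps)
      qed
      ultimately show "(k has_real_derivative 2 * Re (v * P (\<gamma> t) * cnj (c t))) (at t)" by simp
      show "cmod (P (\<gamma> t)) \<le> B" using B wb \<rho> unfolding w_def by blast
    next
      have \<gamma>0: "\<gamma> 0 = z0" by (simp add: \<gamma>_def)
      have "\<psi> z0 = Re q * Re q + Im q * Im q" using qq unfolding cmod_power2 by (simp add: power2_eq_square)
      then show "d 0 = 0" by (simp add: d_def \<gamma>0 y1 y2)
      have "s * cnj q = \<psi>z z0" using q0 by (simp add: s_def)
      then show "c 0 = 0" by (simp add: c_def \<gamma>0 y1 y2 algebra_simps)
      have "Re ((s + h) * cnj (s - h)) = (cmod s)\<^sup>2 - (cmod h)\<^sup>2"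
        unfolding cmod_power2 by (simp add: algebra_simps power2_eq_square)
      also have "\<dots> = (cmod (\<psi>z z0))\<^sup>2 / \<psi> z0 - 1 / (4 * \<psi> z0)"
        by (simp add: s_def h_def norm_divide norm_mult power_divide power_mult_distrib qq)
      also have "\<dots> = n z0" using \<psi>pos[OF z0] unfolding n_def cmod_power2 \<psi>z_def by (simp add: field_simps)
      finally show "k 0 = 0" unfolding k_def \<gamma>0 y1 y2 by simp
    qed
    then show ?thesis by (simp add: d_def \<gamma>_def v_def)
  qed
  show thesis
    by (rule that[OF \<rho>(1,2) hol W main[unfolded \<psi>_def]]) (use y1 y2 q2 in auto)
qed

text \<open>With \<open>w = Ln (y1 / y2)\<close> the Wronskian gives \<open>w' = 1 / (y1 y2)\<close>, and
  \<open>Re (y1 * cnj y2) = |y1 y2| cos (Im w)\<close>. Positivity of \<open>\<psi>\<close> keeps \<open>y1 / y2\<close> in the right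
  half plane, where the principal logarithm is holomorphic.\<close>

lemma strip_coordinate:
  assumes U: "open U" and C: "Ck_on 3 U r" and pos: "\<And>z. z \<in> U \<Longrightarrow> r z > 0"
    and K: "\<And>z. z \<in> U \<Longrightarrow> gauss_curvature r z = -1" and z0: "z0 \<in> U"
    and e: "r z0 * (cmod e)\<^sup>2 = 1"
  obtains \<rho> w where "\<rho> > 0" "ball z0 \<rho> \<subseteq> U" "w holomorphic_on ball z0 \<rho>" "w z0 = 0" "deriv w z0 = 1 / e"
    "\<And>z. z \<in> ball z0 \<rho> \<Longrightarrow> deriv w z \<noteq> 0"
    "\<And>z. z \<in> ball z0 \<rho> \<Longrightarrow> \<bar>Im (w z)\<bar> < pi / 2"
    "\<And>z. z \<in> ball z0 \<rho> \<Longrightarrow> r z = (cmod (deriv w z))\<^sup>2 / (cos (Im (w z)))\<^sup>2"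
proof -
  obtain \<rho> y1 y2 where \<rho>: "\<rho> > 0" "ball z0 \<rho> \<subseteq> U"
    and hol: "y1 holomorphic_on ball z0 \<rho>" "y2 holomorphic_on ball z0 \<rho>"
    and W: "\<And>z. z \<in> ball z0 \<rho> \<Longrightarrow> deriv y1 z * y2 z - y1 z * deriv y2 z = 1"
    and \<psi>: "\<And>z. z \<in> ball z0 \<rho> \<Longrightarrow> 1 / sqrt (r z) = Re (y1 z * cnj (y2 z))"
    and y: "y1 z0 = y2 z0" "(y1 z0)\<^sup>2 = e"
    by (rule liouville_product_form[OF U C pos K z0 e]) blast+
  have Repos: "Re (y1 z * cnj (y2 z)) > 0" if z: "z \<in> ball z0 \<rho>" for z
    using pos[of z] z \<rho>(2) by (subst \<psi>[OF z, symmetric]) auto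
  have nz: "y1 z \<noteq> 0" "y2 z \<noteq> 0" if z: "z \<in> ball z0 \<rho>" for z
    using Repos[OF z] by auto
  have quot: "Re (y1 z / y2 z) = Re (y1 z * cnj (y2 z)) / (cmod (y2 z))\<^sup>2" for z
    by (simp add: Re_divide cmod_power2)
  have Req: "Re (y1 z / y2 z) > 0" if z: "z \<in> ball z0 \<rho>" for z
    unfolding quot using Repos[OF z] nz[OF z] by auto
  define w where "w = (\<lambda>z. Ln (y1 z / y2 z))"
  have dw: "(w has_field_derivative 1 / (y1 z * y2 z)) (at z)" if z: "z \<in> ball z0 \<rho>" for z
  proof -
    have "y1 z / y2 z \<notin> \<real>\<^sub>\<le>\<^sub>0" using Req[OF z] complex_nonpos_Reals_iff by auto
    then have "(w has_field_derivative inverse (y1 z / y2 z) * ((deriv y1 z * y2 z - y1 z * deriv y2 z) / (y2 z * y2 z))) (at z)"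
      unfolding w_def using nz[OF z] holomorphic_derivI[OF hol(1) open_ball z] holomorphic_derivI[OF hol(2) open_ball z]
      by (intro DERIV_chain2[OF has_field_derivative_Ln] DERIV_divide) auto
    then show ?thesis unfolding W[OF z] using nz[OF z] by (simp add: field_simps)
  qed
  have dw': "deriv w z = 1 / (y1 z * y2 z)" if "z \<in> ball z0 \<rho>" for z
    using DERIV_imp_deriv[OF dw[OF that]] .
  have z0b: "z0 \<in> ball z0 \<rho>" using \<rho> by simp
  show thesis
  proof (rule that[OF \<rho>])
    show "w holomorphic_on ball z0 \<rho>" unfolding holomorphic_on_open[OF open_ball] using dw by blast
    show "w z0 = 0" using nz[OF z0b] y by (simp add: w_def)
    show "deriv w z0 = 1 / e" using dw'[OF z0b] y by (simp add: power2_eq_square)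
    fix z assume z: "z \<in> ball z0 \<rho>"
    show "deriv w z \<noteq> 0" using dw'[OF z] nz[OF z] by simp
    show "\<bar>Im (w z)\<bar> < pi / 2" unfolding w_def by (rule Re_Ln_pos_lt_imp[OF Req[OF z]])
    have rp: "r z > 0" using pos z \<rho> by blast
    have ex: "exp (w z) = y1 z / y2 z" unfolding w_def using nz[OF z] by simp
    have "cmod (y1 z / y2 z) * cos (Im (w z)) = Re (y1 z / y2 z)"
      unfolding ex[symmetric] by (simp add: Re_exp)
    then have cs: "cos (Im (w z)) = Re (y1 z * cnj (y2 z)) / (cmod (y1 z) * cmod (y2 z))"
      unfolding quot using nz[OF z] by (simp add: norm_divide field_simps power2_eq_square)
    have "(cmod (deriv w z))\<^sup>2 / (cos (Im (w z)))\<^sup>2 = 1 / (Re (y1 z * cnj (y2 z)))\<^sup>2"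
      unfolding dw'[OF z] cs using nz[OF z] by (simp add: norm_divide norm_mult power_divide field_simps)
    also have "\<dots> = r z" unfolding \<psi>[OF z, symmetric] using rp by (simp add: power_divide)
    finally show "r z = (cmod (deriv w z))\<^sup>2 / (cos (Im (w z)))\<^sup>2" by simp
  qed
qed

section \<open>Geodesics in strip coordinates\<close>

text \<open>The coefficient of the geodesic equation in the original coordinate. The first term comes from
  \<open>ln |w'|\<^sup>2\<close>, the second from \<open>- 2 ln (cos (Im w))\<close>.\<close>

lemma wirtinger_ln_strip_density:
  assumes D: "open D" and w: "w holomorphic_on D" and w0: "\<And>z. z \<in> D \<Longrightarrow> deriv w z \<noteq> 0"
    and Im: "\<And>z. z \<in> D \<Longrightarrow> \<bar>Im (w z)\<bar> < pi / 2"
    and r: "\<And>z. z \<in> D \<Longrightarrow> r z = (cmod (deriv w z))\<^sup>2 / (cos (Im (w z)))\<^sup>2"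
    and z: "z \<in> D"
  shows "wirtinger_dz (\<lambda>u. ln (r u)) z =
    deriv (deriv w) z / deriv w z - \<i> * of_real (tan (Im (w z))) * deriv w z"
proof -
  define a b where "a = (\<lambda>u. Re (deriv w u))" and "b = (\<lambda>u. Im (deriv w u))"
  define y where "y = (\<lambda>u. Im (w u))"
  let ?d = "deriv w z" and ?e = "deriv (deriv w) z"
  have cosp: "cos (y u) > 0" if "u \<in> D" for u
    using Im[OF that] unfolding y_def by (intro cos_gt_zero_pi) auto
  have ab: "(a u)\<^sup>2 + (b u)\<^sup>2 > 0" if "u \<in> D" for u
    using w0[OF that] unfolding a_def b_def cmod_power2[symmetric] by simp
  have eq: "ln (r u) = ln ((a u)\<^sup>2 + (b u)\<^sup>2) - 2 * ln (cos (y u))" if "u \<in> D" for u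
  proof -
    have "r u = ((a u)\<^sup>2 + (b u)\<^sup>2) / (cos (y u))\<^sup>2"
      using r[OF that] by (simp add: a_def b_def y_def cmod_power2)
    moreover have "ln (X / c\<^sup>2) = ln X - 2 * ln c" if "X > 0" "c > 0" for X c :: real
      using that by (simp add: ln_div ln_realpow)
    ultimately show ?thesis using ab[OF that] cosp[OF that] by simp
  qed
  have dw: "(w has_field_derivative ?d) (at z)" using holomorphic_derivI[OF w D z] .
  have ddw: "(deriv w has_field_derivative ?e) (at z)"
    using holomorphic_derivI[OF holomorphic_deriv[OF w D] D z] .
  have da: "(a has_derivative (\<lambda>v. Re (?e * v))) (at z)" "(b has_derivative (\<lambda>v. Im (?e * v))) (at z)"
    using holomorphic_partials[OF ddw] unfolding a_def b_def .
  have dy: "(y has_derivative (\<lambda>v. Im (?d * v))) (at z)"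
    using holomorphic_partials(2)[OF dw] unfolding y_def .
  have der: "((\<lambda>u. ln ((a u)\<^sup>2 + (b u)\<^sup>2) - 2 * ln (cos (y u))) has_derivative
     (\<lambda>v. (2 * a z * Re (?e * v) + 2 * b z * Im (?e * v)) / ((a z)\<^sup>2 + (b z)\<^sup>2) + 2 * (sin (y z) * Im (?d * v) / cos (y z)))) (at z)"
    using ab[OF z] cosp[OF z] by (auto intro!: derivative_eq_intros da dy simp: field_simps)
  have px: "partial_x (\<lambda>u. ln (r u)) z = (2 * a z * Re ?e + 2 * b z * Im ?e) / ((a z)\<^sup>2 + (b z)\<^sup>2) + 2 * tan (y z) * b z"
    and py: "partial_y (\<lambda>u. ln (r u)) z = (2 * b z * Re ?e - 2 * a z * Im ?e) / ((a z)\<^sup>2 + (b z)\<^sup>2) + 2 * tan (y z) * a z"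
    using partials_cong[OF D z eq] partials_of_has_derivative[OF der]
    by (simp_all add: tan_def a_def b_def)
  have q: "?e / ?d = Complex ((a z * Re ?e + b z * Im ?e) / ((a z)\<^sup>2 + (b z)\<^sup>2)) ((a z * Im ?e - b z * Re ?e) / ((a z)\<^sup>2 + (b z)\<^sup>2))"
    by (simp add: complex_eq_iff Re_divide Im_divide a_def b_def algebra_simps)
  have d: "?d = Complex (a z) (b z)" by (simp add: a_def b_def)
  have yz: "Im (w z) = y z" by (simp add: y_def)
  define N where "N = (a z)\<^sup>2 + (b z)\<^sup>2"
  have N: "N \<noteq> 0" using ab[OF z] unfolding N_def by linarith
  show ?thesis
    unfolding wirtinger_dz_def px py q yz N_def[symmetric] unfolding d
    using N by (simp add: complex_eq_iff field_simps)
qed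

text \<open>In the strip coordinate \<open>om = w \<circ> z\<close> the geodesic equation reads
  \<open>om'' = \<i> tan (Im om) om'\<^sup>2\<close>. Constancy of the speed gives \<open>|om'| = s cos (Im om)\<close>, hence
  \<open>|om''| \<le> s\<^sup>2 |Im om|\<close>, and the Gronwall argument applies to
  \<open>(Im om)\<^sup>2 + (Im om')\<^sup>2\<close>. Once \<open>Im om = 0\<close>, the equation becomes \<open>om'' = 0\<close>.\<close>

lemma geodesic_straight_in_strip:
  fixes z z' z'' :: "real \<Rightarrow> complex"
  assumes D: "open D" and w: "w holomorphic_on D" and w0: "\<And>z. z \<in> D \<Longrightarrow> deriv w z \<noteq> 0"
    and Im: "\<And>z. z \<in> D \<Longrightarrow> \<bar>Im (w z)\<bar> < pi / 2"
    and r: "\<And>z. z \<in> D \<Longrightarrow> r z = (cmod (deriv w z))\<^sup>2 / (cos (Im (w z)))\<^sup>2"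
    and zD: "\<And>t. \<bar>t - t0\<bar> \<le> e \<Longrightarrow> z t \<in> D"
    and dz: "\<And>t. \<bar>t - t0\<bar> \<le> e \<Longrightarrow> (z has_vector_derivative z' t) (at t)"
    and dz': "\<And>t. \<bar>t - t0\<bar> \<le> e \<Longrightarrow> (z' has_vector_derivative z'' t) (at t)"
    and geo: "\<And>t. \<bar>t - t0\<bar> \<le> e \<Longrightarrow> z'' t + wirtinger_dz (\<lambda>u. ln (r u)) (z t) * (z' t)\<^sup>2 = 0"
    and speed: "\<And>t. \<bar>t - t0\<bar> \<le> e \<Longrightarrow> r (z t) * (cmod (z' t))\<^sup>2 = s\<^sup>2"
    and init: "w (z t0) = 0" "deriv w (z t0) * z' t0 = of_real s"
    and t: "\<bar>t - t0\<bar> \<le> e"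
  shows "w (z t) = of_real (s * (t - t0))"
proof -
  define om om' where "om = (\<lambda>t. w (z t))" and "om' = (\<lambda>t. deriv w (z t) * z' t)"
  define x y x' y' where "x = (\<lambda>t. Re (om t))" and "y = (\<lambda>t. Im (om t))" and "x' = (\<lambda>t. Re (om' t))" and "y' = (\<lambda>t. Im (om' t))"
  have dom: "(om has_vector_derivative om' t) (at t)"
    and dom': "(om' has_vector_derivative \<i> * of_real (tan (y t)) * (om' t)\<^sup>2) (at t)"
    and nrm: "(cmod (om' t))\<^sup>2 = s\<^sup>2 * (cos (y t))\<^sup>2" and cosp: "cos (y t) > 0" if t: "\<bar>t - t0\<bar> \<le> e" for t
  proof -
    note zt = zD[OF t]
    have dw: "(w has_field_derivative deriv w (z t)) (at (z t))" using holomorphic_derivI[OF w D zt] .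
    have ddw: "(deriv w has_field_derivative deriv (deriv w) (z t)) (at (z t))"
      using holomorphic_derivI[OF holomorphic_deriv[OF w D] D zt] .
    show "(om has_vector_derivative om' t) (at t)"
      using field_vector_diff_chain_at[OF dz[OF t] dw] by (simp add: om_def om'_def o_def mult.commute)
    have "(om' has_vector_derivative deriv w (z t) * z'' t + (z' t * deriv (deriv w) (z t)) * z' t) (at t)"
      unfolding om'_def
      using has_vector_derivative_mult[OF field_vector_diff_chain_at[OF dz[OF t] ddw] dz'[OF t]]
      by (simp add: o_def)
    moreover have "deriv w (z t) * z'' t + (z' t * deriv (deriv w) (z t)) * z' t = \<i> * of_real (tan (y t)) * (om' t)\<^sup>2"
    proof -
      have "z'' t = - wirtinger_dz (\<lambda>u. ln (r u)) (z t) * (z' t)\<^sup>2"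
        using geo[OF t] by (simp add: eq_neg_iff_add_eq_0)
      moreover have "wirtinger_dz (\<lambda>u. ln (r u)) (z t) = deriv (deriv w) (z t) / deriv w (z t)
          - \<i> * of_real (tan (Im (w (z t)))) * deriv w (z t)"
        by (rule wirtinger_ln_strip_density[OF D w w0 Im r zt])
      ultimately have "z'' t = - (deriv (deriv w) (z t) / deriv w (z t)
          - \<i> * of_real (tan (Im (w (z t)))) * deriv w (z t)) * (z' t)\<^sup>2" by simp
      then show ?thesis
        unfolding om'_def y_def om_def
        using w0[OF zt] by (simp add: field_simps power2_eq_square)
    qed
    ultimately show "(om' has_vector_derivative \<i> * of_real (tan (y t)) * (om' t)\<^sup>2) (at t)" by simp
    show c: "cos (y t) > 0" using Im[OF zt] unfolding y_def om_def by (intro cos_gt_zero_pi) auto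
    show "(cmod (om' t))\<^sup>2 = s\<^sup>2 * (cos (y t))\<^sup>2"
      using speed[OF t] c unfolding r[OF zt] om'_def y_def om_def by (simp add: norm_mult power_mult_distrib field_simps)
  qed
  have dy: "(y has_real_derivative y' t) (at t)"
    and dy': "(y' has_real_derivative tan (y t) * ((x' t)\<^sup>2 - (y' t)\<^sup>2)) (at t)" if t: "\<bar>t - t0\<bar> \<le> e" for t
  proof -
    show "(y has_real_derivative y' t) (at t)"
      using bounded_linear.has_vector_derivative[OF bounded_linear_Im dom[OF t]]
      unfolding has_real_derivative_iff_has_vector_derivative y_def y'_def .
    have "Im (\<i> * of_real (tan (y t)) * (om' t)\<^sup>2) = tan (y t) * ((x' t)\<^sup>2 - (y' t)\<^sup>2)"
      by (simp add: x'_def y'_def power2_eq_square)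
    moreover have "(y' has_real_derivative Im (\<i> * of_real (tan (y t)) * (om' t)\<^sup>2)) (at t)"
      using bounded_linear.has_vector_derivative[OF bounded_linear_Im dom'[OF t]]
      unfolding has_real_derivative_iff_has_vector_derivative y'_def .
    ultimately show "(y' has_real_derivative tan (y t) * ((x' t)\<^sup>2 - (y' t)\<^sup>2)) (at t)"
      by (simp only:)
  qed
  have zero: "(y t)\<^sup>2 + (y' t)\<^sup>2 = 0" if t: "\<bar>t - t0\<bar> \<le> e" for t
  proof (rule gronwall_zero[where a = "t0 - e" and b = "t0 + e" and ?t0.0 = t0 and t = t
        and E = "\<lambda>t. (y t)\<^sup>2 + (y' t)\<^sup>2" and C = "1 + s\<^sup>2"
        and E' = "\<lambda>t. 2 * (y t * y' t) + 2 * (y' t * (tan (y t) * ((x' t)\<^sup>2 - (y' t)\<^sup>2)))"])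
    fix t assume "t \<in> {t0 - e..t0 + e}"
    then have t: "\<bar>t - t0\<bar> \<le> e" by auto
    show "((\<lambda>t. (y t)\<^sup>2 + (y' t)\<^sup>2) has_real_derivative 2 * (y t * y' t) + 2 * (y' t * (tan (y t) * ((x' t)\<^sup>2 - (y' t)\<^sup>2)))) (at t)"
      by (auto intro!: derivative_eq_intros dy dy' t simp: algebra_simps)
    have "\<bar>(x' t)\<^sup>2 - (y' t)\<^sup>2\<bar> \<le> (x' t)\<^sup>2 + (y' t)\<^sup>2" by (simp add: abs_le_iff)
    also have "\<dots> = s\<^sup>2 * (cos (y t))\<^sup>2" using nrm[OF t] by (simp add: cmod_power2 x'_def y'_def)
    finally have "\<bar>tan (y t)\<bar> * \<bar>(x' t)\<^sup>2 - (y' t)\<^sup>2\<bar> \<le> \<bar>tan (y t)\<bar> * (s\<^sup>2 * (cos (y t))\<^sup>2)"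
      by (rule mult_left_mono) simp
    also have "\<dots> = s\<^sup>2 * (\<bar>sin (y t)\<bar> * \<bar>cos (y t)\<bar>)"
      using cosp[OF t] by (simp add: tan_def abs_divide power2_eq_square field_simps)
    also have "\<dots> \<le> s\<^sup>2 * (\<bar>y t\<bar> * 1)"
      by (intro mult_left_mono mult_mono abs_sin_x_le_abs_x) auto
    finally have tb: "\<bar>tan (y t) * ((x' t)\<^sup>2 - (y' t)\<^sup>2)\<bar> \<le> s\<^sup>2 * \<bar>y t\<bar>" by (simp add: abs_mult)
    have "\<bar>2 * (y t * y' t) + 2 * (y' t * (tan (y t) * ((x' t)\<^sup>2 - (y' t)\<^sup>2)))\<bar>
       \<le> 2 * (\<bar>y t\<bar> * \<bar>y' t\<bar>) + 2 * (\<bar>y' t\<bar> * \<bar>tan (y t) * ((x' t)\<^sup>2 - (y' t)\<^sup>2)\<bar>)"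
      by (rule order_trans[OF abs_triangle_ineq]) (simp add: abs_mult)
    also have "\<dots> \<le> 2 * (\<bar>y t\<bar> * \<bar>y' t\<bar>) + 2 * (\<bar>y' t\<bar> * (s\<^sup>2 * \<bar>y t\<bar>))"
      using tb by (intro add_mono mult_left_mono) auto
    also have "\<dots> = (1 + s\<^sup>2) * (2 * \<bar>y t\<bar> * \<bar>y' t\<bar>)" by (simp add: algebra_simps)
    also have "\<dots> \<le> (1 + s\<^sup>2) * ((y t)\<^sup>2 + (y' t)\<^sup>2)"
      using sum_squares_bound[of "\<bar>y t\<bar>" "\<bar>y' t\<bar>"] by (intro mult_left_mono) auto
    finally show "\<bar>2 * (y t * y' t) + 2 * (y' t * (tan (y t) * ((x' t)\<^sup>2 - (y' t)\<^sup>2)))\<bar>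
       \<le> (1 + s\<^sup>2) * ((y t)\<^sup>2 + (y' t)\<^sup>2)" .
  next
    show "t0 \<in> {t0 - e..t0 + e}" "t \<in> {t0 - e..t0 + e}" using t by auto
    have "om t0 = 0" "om' t0 = of_real s" unfolding om_def om'_def by (rule init)+
    then show "(y t0)\<^sup>2 + (y' t0)\<^sup>2 = 0" by (simp add: y_def y'_def)
  qed auto
  define I where "I = {t0 - e..t0 + e}"
  have I: "convex I" "t0 \<in> I" "t \<in> I" "\<And>u. u \<in> I \<Longrightarrow> \<bar>u - t0\<bar> \<le> e" using t by (auto simp: I_def)
  have y0: "y u = 0" if "u \<in> I" for u using zero[OF I(4)[OF that]] by simp
  have "(om' has_vector_derivative 0) (at u within I)" if "u \<in> I" for u
    using has_vector_derivative_at_within[OF dom'[OF I(4)[OF that]]] y0[OF that] by simp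
  then obtain c where "\<And>u. u \<in> I \<Longrightarrow> om' u = c"
    using has_vector_derivative_zero_constant[OF I(1)] by blast
  then have om's: "om' u = of_real s" if "u \<in> I" for u
    using that I(2) init by (metis om'_def)
  have "((\<lambda>u. om u - of_real (s * (u - t0))) has_vector_derivative 0) (at u within I)" if "u \<in> I" for u
  proof -
    have "((\<lambda>u. of_real (s * (u - t0))) has_vector_derivative (of_real s :: complex)) (at u)"
      by (auto intro!: derivative_eq_intros simp: has_vector_derivative_def scaleR_conv_of_real)
    from has_vector_derivative_diff[OF dom[OF I(4)[OF that]] this]
    show ?thesis by (simp add: om's[OF that] has_vector_derivative_at_within)
  qed
  then obtain c where c: "\<And>u. u \<in> I \<Longrightarrow> om u - of_real (s * (u - t0)) = c"
    using has_vector_derivative_zero_constant[OF I(1)] by blast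
  have "c = 0" using c[OF I(2)] init by (simp add: om_def)
  then show ?thesis using c[OF I(3)] by (simp add: om_def)
qed

section \<open>Weighted averages in a strip\<close>

text \<open>The integral of \<open>(g - m)\<^sup>2\<close> is nonnegative for the mean value \<open>m\<close> of \<open>g\<close>.\<close>

lemma cauchy_schwarz_integral:
  fixes g :: "real \<Rightarrow> real"
  assumes "a < b" "continuous_on {a..b} g"
  shows "(integral {a..b} g)\<^sup>2 \<le> (b - a) * integral {a..b} (\<lambda>x. (g x)\<^sup>2)"
proof -
  define I where "I = integral {a..b} g"
  define m where "m = I / (b - a)"
  have int: "g integrable_on {a..b}" "(\<lambda>x. (g x)\<^sup>2) integrable_on {a..b}"
    using assms(2) by (auto intro!: integrable_continuous_real continuous_intros)
  have "0 \<le> integral {a..b} (\<lambda>x. (g x - m)\<^sup>2)"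
    by (rule integral_nonneg) (use assms(2) in \<open>auto intro!: integrable_continuous_real continuous_intros\<close>)
  also have "(\<lambda>x. (g x - m)\<^sup>2) = (\<lambda>x. (g x)\<^sup>2 - 2 * m * g x + m\<^sup>2)"
    by (auto simp: power2_diff algebra_simps)
  also have "integral {a..b} \<dots> = integral {a..b} (\<lambda>x. (g x)\<^sup>2) - 2 * m * I + m\<^sup>2 * (b - a)"
    using has_integral_add[OF has_integral_diff[OF integrable_integral[OF int(2)] has_integral_mult_right[OF integrable_integral[OF int(1)], of "2 * m"]]
        has_integral_const_real[of "m\<^sup>2" a b]] assms(1)
    by (intro integral_unique) (simp add: I_def mult.commute)
  finally have "0 \<le> (b - a) * (integral {a..b} (\<lambda>x. (g x)\<^sup>2) - 2 * m * I + m\<^sup>2 * (b - a))"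
    using assms(1) by simp
  also have "\<dots> = (b - a) * integral {a..b} (\<lambda>x. (g x)\<^sup>2) - I\<^sup>2"
  proof -
    have "L * (Q - 2 * (I / L) * I + (I / L)\<^sup>2 * L) = L * Q - I\<^sup>2" if "L \<noteq> 0" for L Q :: real
      using that by (simp add: field_simps power2_eq_square)
    then show ?thesis using assms(1) by (simp add: m_def)
  qed
  finally show ?thesis by (simp add: I_def)
qed

lemma weighted_integral_bound:
  fixes g :: "real \<Rightarrow> complex"
  assumes "a < b" "continuous_on {a..b} g" "continuous_on {a..b} B" "\<And>x. x \<in> {a..b} \<Longrightarrow> \<bar>B x\<bar> \<le> M"
  shows "(cmod (integral {a..b} (\<lambda>x. of_real (B x) * g x)))\<^sup>2 \<le> M\<^sup>2 * (b - a) * integral {a..b} (\<lambda>x. (cmod (g x))\<^sup>2)"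
proof -
  have M: "M \<ge> 0" using assms(4)[of a] assms(1) by auto
  have "cmod (integral {a..b} (\<lambda>x. of_real (B x) * g x)) \<le> integral {a..b} (\<lambda>x. M * cmod (g x))"
    by (rule integral_norm_bound_integral)
      (use assms in \<open>auto intro!: integrable_continuous_real continuous_intros mult_right_mono simp: norm_mult\<close>)
  also have "\<dots> = M * integral {a..b} (\<lambda>x. cmod (g x))" by simp
  finally have "(cmod (integral {a..b} (\<lambda>x. of_real (B x) * g x)))\<^sup>2 \<le> (M * integral {a..b} (\<lambda>x. cmod (g x)))\<^sup>2"
    by (rule power_mono) simp
  also have "\<dots> = M\<^sup>2 * (integral {a..b} (\<lambda>x. cmod (g x)))\<^sup>2" by (simp add: power_mult_distrib)
  also have "\<dots> \<le> M\<^sup>2 * ((b - a) * integral {a..b} (\<lambda>x. (cmod (g x))\<^sup>2))"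
    by (intro mult_left_mono cauchy_schwarz_integral assms continuous_intros) auto
  finally show ?thesis by (simp add: mult.assoc)
qed

lemma integral_by_parts_twice:
  fixes g g' g'' :: "real \<Rightarrow> complex" and B B' B'' :: "real \<Rightarrow> real"
  assumes ab: "a \<le> b"
    and g: "\<And>x. x \<in> {a..b} \<Longrightarrow> (g has_vector_derivative g' x) (at x)"
    and g': "\<And>x. x \<in> {a..b} \<Longrightarrow> (g' has_vector_derivative g'' x) (at x)"
    and g'': "continuous_on {a..b} g''"
    and B: "\<And>x. (B has_real_derivative B' x) (at x)"
    and B': "\<And>x. (B' has_real_derivative B'' x) (at x)"
    and B'': "continuous_on {a..b} B''"
    and zero: "B a = 0" "B b = 0" "B' a = 0" "B' b = 0"
  shows "integral {a..b} (\<lambda>x. of_real (B x) * g'' x) = integral {a..b} (\<lambda>x. of_real (B'' x) * g x)"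
proof -
  have cg: "continuous_on {a..b} g"
    using g by (meson continuous_at_imp_continuous_on has_vector_derivative_continuous)
  have cB: "continuous_on {a..b} B"
    using B by (meson DERIV_isCont continuous_at_imp_continuous_on)
  have vB: "((\<lambda>x. of_real (B x) :: complex) has_vector_derivative of_real (B' x)) (at x)"
    "((\<lambda>x. of_real (B' x) :: complex) has_vector_derivative of_real (B'' x)) (at x)" for x
    using B B' by (auto intro!: has_vector_derivative_of_real simp: has_real_derivative_iff_has_vector_derivative)
  let ?h = "\<lambda>x. of_real (B x) * g' x - of_real (B' x) * g x"
  have "(?h has_vector_derivative (of_real (B x) * g'' x + of_real (B' x) * g' x) - (of_real (B' x) * g' x + of_real (B'' x) * g x)) (at x)"
    if "x \<in> {a..b}" for x
    by (intro has_vector_derivative_diff has_vector_derivative_mult vB g[OF that] g'[OF that])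
  then have "((\<lambda>x. (of_real (B x) * g'' x + of_real (B' x) * g' x) - (of_real (B' x) * g' x + of_real (B'' x) * g x)) has_integral (?h b - ?h a)) {a..b}"
    using ab by (intro fundamental_theorem_of_calculus) (auto intro: has_vector_derivative_at_within)
  then have "integral {a..b} (\<lambda>x. of_real (B x) * g'' x - of_real (B'' x) * g x) = 0"
    by (intro integral_unique) (simp add: zero)
  moreover have "integral {a..b} (\<lambda>x. of_real (B x) * g'' x - of_real (B'' x) * g x)
     = integral {a..b} (\<lambda>x. of_real (B x) * g'' x) - integral {a..b} (\<lambda>x. of_real (B'' x) * g x)"
    by (intro integral_diff integrable_continuous_real continuous_intros cB cg g'' B'')
  ultimately show ?thesis by simp
qed

text \<open>The weight vanishes with its derivative at both ends of the window, and the weights of windows whose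
  centres are \<open>h\<close> apart add up to 1 where they overlap.\<close>

definition window_integral :: "(real \<Rightarrow> complex) \<Rightarrow> real \<Rightarrow> real \<Rightarrow> complex" where
  "window_integral f c h =
     integral {c - h..c + h} (\<lambda>x. of_real ((cos (pi / (2 * h) * (x - c)))\<^sup>2) * f x)"

text \<open>The integrations by parts in \<open>x\<close> have no boundary terms because the weight vanishes with its
  derivative at both ends; the even part in \<open>y\<close> of the averages has derivative 0 at 0, as
  \<open>sec_squared_ode_bound\<close> requires.\<close>

lemma strip_average_bound:
  fixes f :: "complex \<Rightarrow> complex"
  assumes T: "open T" and C: "Ck_on 2 T f"
    and rect: "\<And>x y. \<bar>x - x0\<bar> \<le> l \<Longrightarrow> \<bar>y\<bar> < D \<Longrightarrow> Complex x y \<in> T"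
    and d: "0 < d" "d < D" "d \<le> 1" and l: "l > 0"
    and eig: "\<And>z. z \<in> T \<Longrightarrow> flat_laplacian f z = \<mu> * of_real (1 / (cos (Im z))\<^sup>2) * f z"
  shows "(cmod (window_integral (\<lambda>x. f (of_real x)) x0 l))\<^sup>2
    \<le> 855 / d ^ 5 * ((1 + 4 * (pi / (2 * l)) ^ 4) * l) *
       integral {-d..d} (\<lambda>y. integral {x0 - l..x0 + l} (\<lambda>x. (cmod (f (Complex x y)))\<^sup>2))"
proof -
  define k where "k = pi / (2 * l)"
  define a b where "a = x0 - l" and "b = x0 + l"
  have ab: "a < b" using l by (simp add: a_def b_def)
  define B where "B = (\<lambda>x. (cos (k * (x - x0)))\<^sup>2)"
  define B1 where "B1 = (\<lambda>x. - 2 * k * (cos (k * (x - x0)) * sin (k * (x - x0))))"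
  define B2 where "B2 = (\<lambda>x. - 2 * k\<^sup>2 * ((cos (k * (x - x0)))\<^sup>2 - (sin (k * (x - x0)))\<^sup>2))"
  have dB: "(B has_real_derivative B1 x) (at x)" "(B1 has_real_derivative B2 x) (at x)" for x
    unfolding B_def B1_def B2_def by (auto intro!: derivative_eq_intros simp: power2_eq_square algebra_simps)
  have kl: "k * l = pi / 2" using l by (simp add: k_def)
  have Bz: "B a = 0" "B b = 0" "B1 a = 0" "B1 b = 0"
    by (simp_all add: B_def B1_def a_def b_def kl)
  have cB: "continuous_on S B" "continuous_on S B2" for S
    unfolding B_def B2_def by (intro continuous_intros)+
  have B_le: "\<bar>B x\<bar> \<le> 1" for x unfolding B_def by (simp add: abs_square_le_1)
  have B2_le: "\<bar>B2 x\<bar> \<le> 2 * k\<^sup>2" for x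
  proof -
    have "(cos u)\<^sup>2 \<le> 1" "(sin u)\<^sup>2 \<le> 1" "0 \<le> (cos u)\<^sup>2" "0 \<le> (sin u)\<^sup>2" for u :: real
      by (auto simp: abs_square_le_1)
    then have "\<bar>(cos u)\<^sup>2 - (sin u)\<^sup>2\<bar> \<le> 1" for u :: real
      by (smt (verit))
    then show ?thesis unfolding B2_def abs_mult by (simp add: mult_left_le)
  qed
  define U where "U = {-D<..<D}"
  have U: "open U" "convex U" by (auto simp: U_def)
  have inT: "Complex x y \<in> T" if "x \<in> {a..b}" "y \<in> U" for x y
    using rect[of x y] that by (auto simp: a_def b_def U_def abs_le_iff)
  have df: "f differentiable (at z)" "partial_x f differentiable (at z)" "partial_y f differentiable (at z)" if "z \<in> T" for z
    using C T that unfolding numeral_2_eq_2 by (auto simp: differentiable_on_eq_differentiable_at)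
  have cf: "continuous_on T f" "continuous_on T (partial_x (partial_x f))" "continuous_on T (partial_y (partial_y f))" "continuous_on T (partial_y f)"
    using C unfolding numeral_2_eq_2 by (auto intro: differentiable_imp_continuous_on)
  have cC: "continuous_on S (\<lambda>s. Complex (u s) (v s))" if "continuous_on S u" "continuous_on S v" for S :: "'s::topological_space set" and u v
    using that unfolding Complex_eq by (intro continuous_intros)
  have dx: "((\<lambda>x. g (Complex x y)) has_vector_derivative partial_x g (Complex x y)) (at x)"
    if "g differentiable (at (Complex x y))" for g :: "complex \<Rightarrow> complex" and x y
    using has_vector_derivative_along_line[of g "\<i> * of_real y" x 1] that by (simp add: Complex_eq add.commute)
  have dy: "((\<lambda>y. g (Complex x y)) has_vector_derivative partial_y g (Complex x y)) (at y)"
    if "g differentiable (at (Complex x y))" for g :: "complex \<Rightarrow> complex" and x y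
    using has_vector_derivative_along_line[of g "of_real x" y \<i>] that by (simp add: Complex_eq mult.commute)
  have cx: "continuous_on {a..b} (\<lambda>x. g (Complex x y))" if "continuous_on T g" "y \<in> U" for g :: "complex \<Rightarrow> complex" and y
    by (intro continuous_on_compose2[OF that(1)] cC continuous_intros) (use inT that in auto)
  have c2: "continuous_on (U \<times> {a..b}) (\<lambda>(y, x). g (Complex x y))" if "continuous_on T g" for g :: "complex \<Rightarrow> complex"
    unfolding split_beta by (intro continuous_on_compose2[OF that] cC continuous_intros) (use inT in auto)
  have leib: "((\<lambda>y. integral {a..b} (\<lambda>x. of_real (B x) * g (Complex x y))) has_vector_derivative
      integral {a..b} (\<lambda>x. of_real (B x) * partial_y g (Complex x y))) (at y)"
    if y: "y \<in> U" and g: "\<And>z. z \<in> T \<Longrightarrow> g differentiable (at z)" and g': "continuous_on T (partial_y g)"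
    for g :: "complex \<Rightarrow> complex" and y
  proof -
    have cg: "continuous_on T g" using g by (simp add: continuous_at_imp_continuous_on differentiable_imp_continuous_within)
    have "((\<lambda>y. integral (cbox a b) (\<lambda>x. of_real (B x) * g (Complex x y))) has_vector_derivative
      integral (cbox a b) (\<lambda>x. of_real (B x) * partial_y g (Complex x y))) (at y within U)"
    proof (rule leibniz_rule_vector_derivative)
      fix y x assume "y \<in> U" "x \<in> cbox a b"
      then show "((\<lambda>y. of_real (B x) * g (Complex x y)) has_vector_derivative of_real (B x) * partial_y g (Complex x y)) (at y within U)"
        using inT by (intro has_vector_derivative_at_within[OF has_vector_derivative_mult_right] dy g) auto
    next
      fix y assume "y \<in> U"
      then show "(\<lambda>x. of_real (B x) * g (Complex x y)) integrable_on cbox a b"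
        unfolding cbox_interval by (intro integrable_continuous_real continuous_intros cx cg cB)
    next
      have "continuous_on (U \<times> {a..b}) (\<lambda>p. of_real (B (snd p)) * (\<lambda>(y, x). partial_y g (Complex x y)) p)"
        by (intro continuous_intros c2 g' continuous_on_compose2[OF cB(1)[of UNIV]]) auto
      then show "continuous_on (U \<times> cbox a b) (\<lambda>(y, x). of_real (B x) * partial_y g (Complex x y))"
        by (simp add: split_beta)
    qed (use y U in auto)
    then show ?thesis using y U(1) by (simp add: at_within_open[of y U])
  qed
  define A A' R where "A = (\<lambda>y. integral {a..b} (\<lambda>x. of_real (B x) * f (Complex x y)))"
    and "A' = (\<lambda>y. integral {a..b} (\<lambda>x. of_real (B x) * partial_y f (Complex x y)))"
    and "R = (\<lambda>y. - integral {a..b} (\<lambda>x. of_real (B2 x) * f (Complex x y)))"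
  have dA: "(A has_vector_derivative A' y) (at y)" if "y \<in> U" for y
    unfolding A_def A'_def by (rule leib[OF that df(1) cf(4)])
  have dA': "(A' has_vector_derivative \<mu> * of_real (1 / (cos y)\<^sup>2) * A y + R y) (at y)" if y: "y \<in> U" for y
  proof -
    have "integral {a..b} (\<lambda>x. of_real (B x) * partial_y (partial_y f) (Complex x y))
      = integral {a..b} (\<lambda>x. \<mu> * of_real (1 / (cos y)\<^sup>2) * (of_real (B x) * f (Complex x y)) - of_real (B x) * partial_x (partial_x f) (Complex x y))"
    proof (rule integral_cong)
      fix x assume x: "x \<in> {a..b}"
      have yy: "partial_y (partial_y f) (Complex x y) = \<mu> * of_real (1 / (cos y)\<^sup>2) * f (Complex x y) - partial_x (partial_x f) (Complex x y)"
        using eig[OF inT[OF x y]] by (simp add: flat_laplacian_def algebra_simps)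
      show "of_real (B x) * partial_y (partial_y f) (Complex x y) = \<mu> * of_real (1 / (cos y)\<^sup>2) * (of_real (B x) * f (Complex x y)) - of_real (B x) * partial_x (partial_x f) (Complex x y)"
        unfolding yy by (simp add: algebra_simps)
    qed
    also have "\<dots> = \<mu> * of_real (1 / (cos y)\<^sup>2) * A y - integral {a..b} (\<lambda>x. of_real (B x) * partial_x (partial_x f) (Complex x y))"
      unfolding A_def integral_mult_right[symmetric]
      by (intro integral_diff integrable_continuous_real continuous_intros cx cf cB y)
    also have "integral {a..b} (\<lambda>x. of_real (B x) * partial_x (partial_x f) (Complex x y)) = - R y"
    proof -
      have "integral {a..b} (\<lambda>x. of_real (B x) * partial_x (partial_x f) (Complex x y)) = integral {a..b} (\<lambda>x. of_real (B2 x) * f (Complex x y))"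
        by (rule integral_by_parts_twice[OF _ dx dx _ dB cB(2) Bz]) (use ab y inT df cx[OF cf(2)] in auto)
      then show ?thesis by (simp add: R_def)
    qed
    finally show ?thesis using leib[OF y df(3) cf(3)] by (simp add: A'_def)
  qed
  \<comment> \<open>The even part of \<open>A\<close>, whose derivative at 0 vanishes.\<close>
  define F F' S where "F = (\<lambda>y. (A y + A (- y)) / 2)" and "F' = (\<lambda>y. (A' y - A' (- y)) / 2)" and "S = (\<lambda>y. (R y + R (- y)) / 2)"
  have U2: "y \<in> U" "- y \<in> U" if "y \<in> {-d..d}" for y using that d by (auto simp: U_def)
  have refl: "((\<lambda>y. h (- y)) has_vector_derivative - h') (at y)" if "(h has_vector_derivative h') (at (- y))" for h :: "real \<Rightarrow> complex" and h' y
    using vector_diff_chain_at[of uminus "-1" y h h'] that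
      has_vector_derivative_minus[OF has_vector_derivative_id[of "at y"]] by (simp add: o_def)
  have dF: "(F has_vector_derivative F' y) (at y)" if "y \<in> {0..d}" for y
  proof -
    have "y \<in> {-d..d}" using that d by auto
    note u = U2[OF this]
    show ?thesis
      using has_vector_derivative_divide[OF has_vector_derivative_add[OF dA[OF u(1)] refl[OF dA[OF u(2)]]], of 2]
      by (simp add: F_def F'_def)
  qed
  have dF': "(F' has_vector_derivative \<mu> * of_real (1 / (cos y)\<^sup>2) * F y + S y) (at y)" if "y \<in> {0..d}" for y
  proof -
    have "y \<in> {-d..d}" using that d by auto
    note u = U2[OF this]
    show ?thesis
      using has_vector_derivative_divide[OF has_vector_derivative_diff[OF dA'[OF u(1)] refl[OF dA'[OF u(2)]]], of 2]
      by (simp add: F_def F'_def S_def algebra_simps add_divide_distrib)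
  qed
  define G where "G = (\<lambda>y. integral {a..b} (\<lambda>x. (cmod (f (Complex x y)))\<^sup>2))"
  have cint: "continuous_on U (\<lambda>y. integral {a..b} (\<lambda>x. g (y, x)))" if "continuous_on (U \<times> {a..b}) g" for g :: "real \<times> real \<Rightarrow> 'z::banach"
    using integral_continuous_on_param[of U a b "\<lambda>y x. g (y, x)"] that by (simp add: cbox_interval)
  have cA: "continuous_on U A"
    using dA by (meson continuous_at_imp_continuous_on has_vector_derivative_continuous)
  have cR: "continuous_on U R"
  proof -
    have "continuous_on (U \<times> {a..b}) (\<lambda>p. of_real (B2 (snd p)) * (\<lambda>(y, x). f (Complex x y)) p)"
      by (intro continuous_intros c2 cf continuous_on_compose2[OF cB(2)[of UNIV]]) auto
    from cint[OF this] show ?thesis unfolding R_def by (intro continuous_intros) simp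
  qed
  have cG: "continuous_on U G"
  proof -
    have "continuous_on (U \<times> {a..b}) (\<lambda>p. (cmod ((\<lambda>(y, x). f (Complex x y)) p))\<^sup>2)"
      by (intro continuous_intros c2 cf)
    from cint[OF this] show ?thesis unfolding G_def by simp
  qed
  have cneg: "continuous_on {0..d} (\<lambda>y. h (- y))" if "continuous_on U h" for h :: "real \<Rightarrow> 'z::banach"
    by (intro continuous_on_compose2[OF that] continuous_intros) (use U2 d in auto)
  have cpos: "continuous_on {0..d} h" if "continuous_on U h" for h :: "real \<Rightarrow> 'z::banach"
    by (rule continuous_on_subset[OF that]) (use U2 d in auto)
  have ode: "(cmod (F 0))\<^sup>2 \<le> 855 / d ^ 5 *
    (integral {0..d} (\<lambda>y. (cmod (F y))\<^sup>2) + integral {0..d} (\<lambda>y. (cmod (S y))\<^sup>2))"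
  proof (rule sec_squared_ode_bound[OF d(1,3) dF dF'])
    show "F' 0 = 0" by (simp add: F'_def)
    show "continuous_on {0..d} S" unfolding S_def by (intro continuous_intros cneg cpos cR) auto
  qed
  have half: "(cmod ((p + q) / 2))\<^sup>2 \<le> ((cmod p)\<^sup>2 + (cmod q)\<^sup>2) / 2" for p q :: complex
  proof -
    have "cmod ((p + q) / 2) \<le> (cmod p + cmod q) / 2" by (simp add: norm_divide norm_triangle_ineq)
    then have "(cmod ((p + q) / 2))\<^sup>2 \<le> ((cmod p + cmod q) / 2)\<^sup>2" by (rule power_mono) simp
    also have "\<dots> \<le> ((cmod p)\<^sup>2 + (cmod q)\<^sup>2) / 2"
      using sum_squares_bound[of "cmod p" "cmod q"] by (simp add: power2_eq_square field_simps)
    finally show ?thesis .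
  qed
  have A_le: "(cmod (A y))\<^sup>2 \<le> 2 * l * G y" and R_le: "(cmod (R y))\<^sup>2 \<le> 4 * k ^ 4 * (2 * l) * G y" if y: "y \<in> U" for y
  proof -
    show "(cmod (A y))\<^sup>2 \<le> 2 * l * G y"
      using weighted_integral_bound[OF ab cx[OF cf(1) y] cB(1) B_le] by (simp add: A_def G_def a_def b_def)
    show "(cmod (R y))\<^sup>2 \<le> 4 * k ^ 4 * (2 * l) * G y"
      using weighted_integral_bound[OF ab cx[OF cf(1) y] cB(2) B2_le]
      by (simp add: R_def G_def a_def b_def power_mult_distrib power2_eq_square power4_eq_xxxx)
  qed
  have GG: "integral {0..d} (\<lambda>y. G y + G (- y)) = integral {-d..d} G"
  proof -
    have i: "G integrable_on {-d..d}"
      by (rule integrable_continuous_real, rule continuous_on_subset[OF cG]) (use U2 in auto)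
    have "integral {0..d} (\<lambda>y. G y + G (- y)) = integral {0..d} G + integral {0..d} (\<lambda>y. G (- y))"
      by (intro integral_add integrable_continuous_real cneg cpos cG)
    also have "integral {0..d} (\<lambda>y. G (- y)) = integral {-d..0} G"
      using Henstock_Kurzweil_Integration.integral_reflect_real[of 0 "-d" G] by simp
    also have "integral {0..d} G + integral {-d..0} G = integral {-d..d} G"
      using Henstock_Kurzweil_Integration.integral_combine[of "-d" 0 d G] d i by simp
    finally show ?thesis .
  qed
  have mono: "integral {0..d} (\<lambda>y. (cmod ((h y + h (- y)) / 2))\<^sup>2) \<le> M * l * integral {-d..d} G"
    if h: "continuous_on U h" and le: "\<And>y. y \<in> U \<Longrightarrow> (cmod (h y))\<^sup>2 \<le> M * (2 * l) * G y" for h :: "real \<Rightarrow> complex" and M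
  proof -
    have "integral {0..d} (\<lambda>y. (cmod ((h y + h (- y)) / 2))\<^sup>2) \<le> integral {0..d} (\<lambda>y. M * l * (G y + G (- y)))"
    proof (rule integral_le)
      show "(\<lambda>y. (cmod ((h y + h (- y)) / 2))\<^sup>2) integrable_on {0..d}"
        by (intro integrable_continuous_real continuous_intros cneg cpos h) auto
      show "(\<lambda>y. M * l * (G y + G (- y))) integrable_on {0..d}"
        by (intro integrable_continuous_real continuous_intros cneg cpos cG)
      fix y assume "y \<in> {0..d}"
      then have "y \<in> {-d..d}" using d by auto
      from half[of "h y" "h (- y)"] le[OF U2(1)[OF this]] le[OF U2(2)[OF this]]
      show "(cmod ((h y + h (- y)) / 2))\<^sup>2 \<le> M * l * (G y + G (- y))" by (simp add: algebra_simps)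
    qed
    then show ?thesis using GG by simp
  qed
  have "integral {0..d} (\<lambda>y. (cmod (F y))\<^sup>2) \<le> 1 * l * integral {-d..d} G"
    unfolding F_def by (rule mono[OF cA]) (use A_le in auto)
  moreover have "integral {0..d} (\<lambda>y. (cmod (S y))\<^sup>2) \<le> 4 * k ^ 4 * l * integral {-d..d} G"
    unfolding S_def by (rule mono[OF cR]) (use R_le in auto)
  ultimately have "integral {0..d} (\<lambda>y. (cmod (F y))\<^sup>2) + integral {0..d} (\<lambda>y. (cmod (S y))\<^sup>2) \<le> (1 + 4 * k ^ 4) * l * integral {-d..d} G"
    by (simp add: algebra_simps)
  then have "(cmod (F 0))\<^sup>2 \<le> 855 / d ^ 5 * ((1 + 4 * k ^ 4) * l * integral {-d..d} G)"
    using ode d by (intro order_trans[OF ode] mult_left_mono) auto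
  moreover have "F 0 = window_integral (\<lambda>x. f (of_real x)) x0 l"
    by (simp add: F_def A_def B_def k_def a_def b_def Complex_eq window_integral_def)
  ultimately show ?thesis by (simp add: k_def G_def a_def b_def mult.assoc)
qed

section \<open>Area in strip coordinates\<close>

text \<open>Used to move Lebesgue measure between the plane as complex numbers, as vectors and as pairs.\<close>

lemma distr_lborel_isometry:
  fixes j :: "'a::euclidean_space \<Rightarrow> 'b::euclidean_space"
  assumes lin: "linear j" and bij: "bij_betw j Basis Basis"
    and inner: "\<And>x b. b \<in> Basis \<Longrightarrow> j x \<bullet> j b = x \<bullet> b"
  shows "distr lborel borel j = lborel"
proof (rule lborel_eqI[symmetric])
  have m: "j \<in> borel_measurable lborel"
    using borel_measurable_continuous_onI[OF linear_continuous_on[OF linear_conv_bounded_linear[THEN iffD1, OF lin]]] by simp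
  fix l u :: 'b assume lu: "\<And>b. b \<in> Basis \<Longrightarrow> l \<bullet> b \<le> u \<bullet> b"
  define L U where "L = (\<Sum>b\<in>Basis. (l \<bullet> j b) *\<^sub>R b)" and "U = (\<Sum>b\<in>Basis. (u \<bullet> j b) *\<^sub>R b)"
  have LU: "L \<bullet> b = l \<bullet> j b" "U \<bullet> b = u \<bullet> j b" "j b \<in> Basis" if "b \<in> Basis" for b
    using that bij_betw_apply[OF bij that] by (auto simp: L_def U_def inner_sum_left inner_Basis if_distrib cong: if_cong)
  have "j -` box l u = box L U"
  proof -
    have "j x \<in> box l u \<longleftrightarrow> (\<forall>b\<in>Basis. l \<bullet> j b < j x \<bullet> j b \<and> j x \<bullet> j b < u \<bullet> j b)" for x
      unfolding mem_box bij_betw_imp_surj_on[OF bij, symmetric] by blast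
    then show ?thesis using inner LU by (auto simp: mem_box)
  qed
  then have "emeasure (distr lborel borel j) (box l u) = emeasure lborel (box L U)"
    using m by (simp add: emeasure_distr)
  also have "\<dots> = (\<Prod>b\<in>Basis. (U - L) \<bullet> b)"
    by (rule emeasure_lborel_box) (use lu LU in simp)
  also have "(\<Prod>b\<in>Basis. (U - L) \<bullet> b) = (\<Prod>b\<in>Basis. (u - l) \<bullet> j b)"
    by (rule prod.cong) (simp_all add: inner_diff_left LU)
  also have "\<dots> = (\<Prod>b\<in>Basis. (u - l) \<bullet> b)"
    by (rule prod.reindex_bij_betw[OF bij])
  finally show "emeasure (distr lborel borel j) (box l u) = (\<Prod>b\<in>Basis. (u - l) \<bullet> b)" .
qed simp

lemma nn_integral_lborel_complex:
  fixes H :: "complex \<Rightarrow> ennreal"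
  assumes H: "H \<in> borel_measurable borel"
  shows "(\<integral>\<^sup>+v. H (Complex (v $ 1) (v $ 2)) \<partial>(lborel :: (real^2) measure)) = (\<integral>\<^sup>+z. H z \<partial>lborel)"
    and "(\<integral>\<^sup>+p. H (Complex (snd p) (fst p)) \<partial>(lborel :: (real \<times> real) measure)) = (\<integral>\<^sup>+z. H z \<partial>lborel)"
proof -
  define j1 where "j1 = (\<lambda>v::real^2. Complex (v $ 1) (v $ 2))"
  define j2 where "j2 = (\<lambda>p::real\<times>real. Complex (snd p) (fst p))"
  have lin: "linear j1" "linear j2"
    by (auto simp: j1_def j2_def linear_iff complex_eq_iff)
  have B1: "(Basis :: (real^2) set) = {axis 1 1, axis 2 1}"
    by (auto simp: Basis_vec_def UNIV_2)
  have B2: "(Basis :: (real\<times>real) set) = {(1,0), (0,1)}"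
    by (auto simp: Basis_prod_def)
  have a: "j1 (axis 1 1) = 1" "j1 (axis 2 1) = \<i>" "j2 (1,0) = \<i>" "j2 (0,1) = 1"
    by (auto simp: j1_def j2_def complex_eq_iff axis_def)
  have ne: "axis 1 1 \<noteq> (axis 2 1 :: real^2)" by (simp add: axis_eq_axis)
  have "distr lborel borel j1 = lborel"
  proof (rule distr_lborel_isometry[OF lin(1)])
    show "bij_betw j1 Basis Basis"
      unfolding B1 Basis_complex_def using a ne by (auto simp: bij_betw_def complex_eq_iff)
    show "j1 x \<bullet> j1 b = x \<bullet> b" if "b \<in> Basis" for x b
      using that unfolding B1 by (auto simp: a inner_axis) (auto simp: j1_def inner_complex_def)
  qed
  moreover have "j1 \<in> lborel \<rightarrow>\<^sub>M borel"
    using borel_measurable_continuous_onI[OF linear_continuous_on[OF linear_conv_bounded_linear[THEN iffD1, OF lin(1)]]] by simp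
  ultimately show "(\<integral>\<^sup>+v. H (Complex (v $ 1) (v $ 2)) \<partial>(lborel :: (real^2) measure)) = (\<integral>\<^sup>+z. H z \<partial>lborel)"
    using nn_integral_distr[of j1 lborel borel H] H by (simp add: j1_def)
  have "distr lborel borel j2 = lborel"
  proof (rule distr_lborel_isometry[OF lin(2)])
    show "bij_betw j2 Basis Basis"
      unfolding B2 Basis_complex_def using a by (auto simp: bij_betw_def complex_eq_iff)
    show "j2 x \<bullet> j2 b = x \<bullet> b" if "b \<in> Basis" for x b
      using that unfolding B2 by (auto simp: a) (auto simp: j2_def inner_complex_def inner_prod_def)
  qed
  moreover have "j2 \<in> lborel \<rightarrow>\<^sub>M borel"
    using borel_measurable_continuous_onI[OF linear_continuous_on[OF linear_conv_bounded_linear[THEN iffD1, OF lin(2)]]] by simp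
  ultimately show "(\<integral>\<^sup>+p. H (Complex (snd p) (fst p)) \<partial>(lborel :: (real \<times> real) measure)) = (\<integral>\<^sup>+z. H z \<partial>lborel)"
    using nn_integral_distr[of j2 lborel borel H] H by (simp add: j2_def)
qed

text \<open>The Jacobian determinant of a holomorphic map is \<open>|g'|\<^sup>2\<close>. The computation passes through
  \<^typ>\<open>real^2\<close> for the change of variables and through \<^typ>\<open>real \<times> real\<close> for the iterated
  integral, with \<open>y\<close> as first component so that it becomes the outer variable.\<close>

lemma conformal_change_of_variables:
  fixes g :: "complex \<Rightarrow> complex" and F :: "complex \<Rightarrow> real"
  assumes T: "open T" and g: "g holomorphic_on T" and inj: "inj_on g T"
    and Q: "cbox (Complex a1 a2) (Complex b1 b2) \<subseteq> T"
    and F: "continuous_on (g ` T) F" and F0: "\<And>z. z \<in> g ` T \<Longrightarrow> F z \<ge> 0"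
  shows "(\<integral>\<^sup>+z. ennreal (F z) * indicator (g ` cbox (Complex a1 a2) (Complex b1 b2)) z \<partial>lborel)
    = ennreal (integral {a2..b2} (\<lambda>y. integral {a1..b1} (\<lambda>x. (cmod (deriv g (Complex x y)))\<^sup>2 * F (g (Complex x y)))))"
proof -
  let ?Q = "cbox (Complex a1 a2) (Complex b1 b2)"
  define j where "j = (\<lambda>v::real^2. Complex (v $ 1) (v $ 2))"
  define i where "i = (\<lambda>z. vector [Re z, Im z] :: real^2)"
  have ij: "i (j v) = v" "j (i z) = z" for v z
    by (simp_all add: i_def j_def vec_eq_iff forall_2)
  have "linear j" "linear i"
    by (auto simp: i_def j_def linear_iff complex_eq_iff vec_eq_iff forall_2)
  then have bl: "bounded_linear j" "bounded_linear i" by (simp_all add: linear_conv_bounded_linear)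
  define S where "S = cbox (i (Complex a1 a2)) (i (Complex b1 b2))"
  have jS: "j v \<in> ?Q \<longleftrightarrow> v \<in> S" for v
    by (auto simp: S_def i_def j_def in_cbox_complex_iff mem_box_cart forall_2)
  define K where "K = (\<lambda>z. (cmod (deriv g z))\<^sup>2 * F (g z))"
  have gc: "continuous_on T g" "continuous_on T (deriv g)"
    using g T by (auto intro: holomorphic_on_imp_continuous_on holomorphic_deriv)
  have cK: "continuous_on T K"
    unfolding K_def by (intro continuous_intros gc continuous_on_compose2[OF F gc(1)]) auto
  have K0: "K z \<ge> 0" if "z \<in> T" for z using F0 that by (auto simp: K_def)
  have cj: "continuous_on X j" for X using bl(1) by (rule linear_continuous_on)
  have cKS: "continuous_on S (\<lambda>v. K (j v))"
    by (rule continuous_on_compose2[OF cK cj]) (use jS Q in auto)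
  define G where "G = (\<lambda>v. i (g (j v)))"
  define G' where "G' = (\<lambda>v h. i (deriv g (j v) * j h))"
  have dG: "(G has_derivative G' v) (at v within S)" if "v \<in> S" for v
  proof -
    have "(g has_derivative (*) (deriv g (j v))) (at (j v))"
      using holomorphic_derivI[OF g T, of "j v"] jS that Q by (auto simp: has_field_derivative_def)
    moreover have "(j has_derivative j) (at v within S)" using bl(1) by (rule bounded_linear_imp_has_derivative)
    ultimately have "((\<lambda>v. g (j v)) has_derivative (\<lambda>h. deriv g (j v) * j h)) (at v within S)"
      using has_derivative_compose by blast
    then show ?thesis unfolding G_def G'_def by (rule bounded_linear.has_derivative[OF bl(2)])
  qed
  have det: "\<bar>det (matrix (G' v))\<bar> = (cmod (deriv g (j v)))\<^sup>2" for v
    unfolding cmod_power2 by (simp add: det_2 matrix_def G'_def i_def j_def axis_def power2_eq_square)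
  have injG: "inj_on G S"
  proof (rule inj_onI)
    fix u v assume uv: "u \<in> S" "v \<in> S" "G u = G v"
    have "j (G u) = j (G v)" using uv(3) by simp
    then have "g (j u) = g (j v)" unfolding G_def ij .
    moreover have "j u \<in> T" "j v \<in> T" using uv(1,2) Q by (auto simp: jS[symmetric])
    ultimately have "j u = j v" by (rule inj_onD[OF inj])
    then have "i (j u) = i (j v)" by simp
    then show "u = v" unfolding ij .
  qed
  define I where "I = integral S (\<lambda>v. K (j v))"
  define f where "f = (\<lambda>u. vec (F (j u)) :: real^1)"
  have fG: "\<bar>det (matrix (G' v))\<bar> *\<^sub>R f (G v) = vec (K (j v))" for v
    unfolding det by (simp add: f_def G_def ij K_def vec_eq_iff)
  have absK: "(\<lambda>v. K (j v)) absolutely_integrable_on S"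
    using cKS unfolding S_def by (rule absolutely_integrable_continuous)
  have "(\<lambda>v. \<bar>det (matrix (G' v))\<bar> *\<^sub>R f (G v)) absolutely_integrable_on S \<and>
     integral S (\<lambda>v. \<bar>det (matrix (G' v))\<bar> *\<^sub>R f (G v)) = vec I"
    unfolding fG absolutely_integrable_on_1_iff integral_on_1_eq using absK by (simp add: I_def)
  then have "f absolutely_integrable_on (G ` S) \<and> integral (G ` S) f = vec I"
    by (subst has_absolute_integral_change_of_variables[symmetric, OF _ dG injG]) (auto simp: S_def)
  then have "(\<lambda>u. F (j u)) absolutely_integrable_on (G ` S)" "integral (G ` S) (\<lambda>u. F (j u)) = I"
    unfolding absolutely_integrable_on_1_iff integral_on_1_eq by (auto simp: f_def vec_eq_iff)
  then have hF: "((\<lambda>u. F (j u)) has_integral I) (G ` S)"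
    using set_lebesgue_integral_eq_integral(1) integrable_integral by blast
  have GS: "u \<in> G ` S \<longleftrightarrow> j u \<in> g ` ?Q" for u
  proof
    assume "u \<in> G ` S" then show "j u \<in> g ` ?Q" using jS by (auto simp: G_def ij)
  next
    assume "j u \<in> g ` ?Q"
    then obtain z where "z \<in> ?Q" "j u = g z" by auto
    then have "i z \<in> S" "G (i z) = i (j u)" using jS[of "i z"] by (auto simp: G_def ij(2))
    then show "u \<in> G ` S" unfolding ij(1) by blast
  qed
  have gQ: "g ` ?Q \<subseteq> g ` T" by (rule image_mono[OF Q])
  have meas: "(\<lambda>z. ennreal (H z) * indicator X z) \<in> borel_measurable borel"
    if "compact X" "continuous_on X H" for X and H :: "complex \<Rightarrow> real"
  proof -
    have "X \<in> sets borel" using that(1) by (rule borel_compact)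
    from borel_measurable_continuous_on_indicator[OF this that(2)]
    have "(\<lambda>z. ennreal (indicator X z *\<^sub>R H z)) \<in> borel_measurable borel" by measurable
    also have "(\<lambda>z. ennreal (indicator X z *\<^sub>R H z)) = (\<lambda>z. ennreal (H z) * indicator X z)"
      by (rule ext) (simp add: indicator_def)
    finally show ?thesis .
  qed
  have cpt: "compact (g ` ?Q)"
    by (rule compact_continuous_image[OF continuous_on_subset[OF gc(1) Q]]) simp
  have "(\<integral>\<^sup>+z. ennreal (F z) * indicator (g ` ?Q) z \<partial>lborel) = (\<integral>\<^sup>+u. ennreal (F (j u)) * indicator (g ` ?Q) (j u) \<partial>lborel)"
    using nn_integral_lborel_complex(1)[OF meas[OF cpt continuous_on_subset[OF F gQ]]] by (simp add: j_def)
  also have "\<dots> = (\<integral>\<^sup>+u. ennreal (F (j u)) * indicator (G ` S) u \<partial>lborel)"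
    by (intro nn_integral_cong) (simp add: indicator_def GS)
  also have "\<dots> = ennreal I"
    by (rule nn_integral_has_integral_lebesgue'[OF _ hF]) (use F0 GS gQ in blast)
  finally have 1: "(\<integral>\<^sup>+z. ennreal (F z) * indicator (g ` ?Q) z \<partial>lborel) = ennreal I" .
  have hK: "((\<lambda>v. K (j v)) has_integral I) S"
    unfolding I_def using absK set_lebesgue_integral_eq_integral(1) integrable_integral by blast
  have "ennreal I = (\<integral>\<^sup>+v. ennreal (K (j v)) * indicator S v \<partial>lborel)"
    by (rule nn_integral_has_integral_lebesgue'[OF _ hK, symmetric]) (use K0 jS Q in blast)
  also have "\<dots> = (\<integral>\<^sup>+v. ennreal (K (j v)) * indicator ?Q (j v) \<partial>lborel)"
    by (intro nn_integral_cong) (simp add: indicator_def jS)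
  also have "\<dots> = (\<integral>\<^sup>+z. ennreal (K z) * indicator ?Q z \<partial>lborel)"
    using nn_integral_lborel_complex(1)[OF meas[OF compact_cbox continuous_on_subset[OF cK Q]]] by (simp add: j_def)
  also have "\<dots> = (\<integral>\<^sup>+p. ennreal (K (Complex (snd p) (fst p))) * indicator ?Q (Complex (snd p) (fst p)) \<partial>lborel)"
    using nn_integral_lborel_complex(2)[OF meas[OF compact_cbox continuous_on_subset[OF cK Q]]] by simp
  also have "\<dots> = (\<integral>\<^sup>+p. ennreal (K (Complex (snd p) (fst p))) * indicator (cbox (a2, a1) (b2, b1)) p \<partial>lborel)"
    by (intro nn_integral_cong) (auto simp: indicator_def in_cbox_complex_iff cbox_Pair_eq mem_Times_iff)
  also have "\<dots> = ennreal (integral (cbox (a2, a1) (b2, b1)) (\<lambda>p. K (Complex (snd p) (fst p))))"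
  proof (rule nn_integral_has_integral_lebesgue')
    have sub: "(\<lambda>p. Complex (snd p) (fst p)) ` cbox (a2, a1) (b2, b1) \<subseteq> T"
      using Q by (auto simp: in_cbox_complex_iff cbox_Pair_eq)
    show "K (Complex (snd p) (fst p)) \<ge> 0" if "p \<in> cbox (a2, a1) (b2, b1)" for p using K0 sub that by auto
    show "((\<lambda>p. K (Complex (snd p) (fst p))) has_integral integral (cbox (a2, a1) (b2, b1)) (\<lambda>p. K (Complex (snd p) (fst p)))) (cbox (a2, a1) (b2, b1))"
      unfolding Complex_eq
      by (intro integrable_integral integrable_continuous continuous_on_compose2[OF cK] continuous_intros)
       (use sub in \<open>auto simp: Complex_eq\<close>)
  qed
  also have "integral (cbox (a2, a1) (b2, b1)) (\<lambda>p. K (Complex (snd p) (fst p)))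
     = integral {a2..b2} (\<lambda>y. integral {a1..b1} (\<lambda>x. K (Complex x y)))"
  proof -
    have sub: "(\<lambda>p. Complex (snd p) (fst p)) ` cbox (a2, a1) (b2, b1) \<subseteq> T"
      using Q by (auto simp: in_cbox_complex_iff cbox_Pair_eq)
    have "continuous_on (cbox (a2, a1) (b2, b1)) (\<lambda>p. K (Complex (snd p) (fst p)))"
      unfolding Complex_eq by (intro continuous_on_compose2[OF cK] continuous_intros) (use sub in \<open>auto simp: Complex_eq\<close>)
    from integral_prod_continuous[OF this] show ?thesis by (simp add: cbox_interval)
  qed
  finally show ?thesis using 1 by (simp add: K_def)
qed

text \<open>The volume measure on \<open>patch c\<close>, carried to the plane by \<open>coord c\<close>, has density \<open>\<rho> c\<close>:
  this is its defining property evaluated on preimages of Borel sets.\<close>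

lemma volume_in_chart:
  fixes A :: "'a::t2_space chart set"
  assumes RS: "riemann_surface A" and CM: "conformal_metric A \<rho>" and V: "is_volume_measure A \<rho> v"
    and c: "c \<in> A" and k: "continuous_on UNIV (k :: 'a \<Rightarrow> real)" and k0: "\<And>y. k y \<ge> 0"
    and X: "X \<in> sets borel" "X \<subseteq> coord_dom c"
  shows "(\<integral>\<^sup>+z. ennreal (k (param c z) * \<rho> c z) * indicator X z \<partial>lborel) \<le> (\<integral>\<^sup>+y. ennreal (k y) \<partial>v)"
proof -
  have op: "open (patch c)" "open (coord_dom c)" and hom: "homeomorphism (patch c) (coord_dom c) (coord c) (param c)"
    using RS c unfolding riemann_surface_def by auto
  have sv: "sets v = sets borel" using V by (simp add: is_volume_measure_def)
  have "smooth_on (coord_dom c) (\<rho> c)" and \<rho>0: "\<And>z. z \<in> coord_dom c \<Longrightarrow> \<rho> c z > 0"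
    using CM c by (auto simp: conformal_metric_def)
  then have c\<rho>: "continuous_on (coord_dom c) (\<rho> c)" unfolding smooth_on_def by (metis Ck_on.simps(1))
  have spv: "space v = UNIV" using sets_eq_imp_space_eq[OF sv] by simp
  have pm: "patch c \<inter> space v \<in> sets v" using op sv spv by auto
  have dm: "coord_dom c \<in> sets borel" using op by auto
  have "sets (restrict_space v (patch c)) = sets (restrict_space borel (patch c))"
    by (rule sets_restrict_space_cong[OF sv])
  note meq = measurable_cong_sets[OF this refl]
  have cm: "coord c \<in> restrict_space v (patch c) \<rightarrow>\<^sub>M borel"
    using borel_measurable_continuous_on_restrict[OF homeomorphism_cont1[OF hom]] unfolding meq .
  define \<nu> where "\<nu> = distr (restrict_space v (patch c)) borel (coord c)"
  define d where "d = (\<lambda>z. ennreal (indicator (coord_dom c) z *\<^sub>R \<rho> c z))"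
  have dmeas[measurable]: "d \<in> borel_measurable borel"
    unfolding d_def using borel_measurable_continuous_on_indicator[OF dm c\<rho>] by measurable
  have "\<nu> = density lborel d"
  proof (rule measure_eqI)
    show "sets \<nu> = sets (density lborel d)" by (simp add: \<nu>_def)
    fix Y assume "Y \<in> sets \<nu>"
    then have Y: "Y \<in> sets borel" by (simp add: \<nu>_def)
    define B where "B = coord c -` Y \<inter> patch c"
    have "coord c -` Y \<inter> space (restrict_space v (patch c)) \<in> sets (restrict_space v (patch c))"
      using cm Y by (rule measurable_sets)
    then have B: "B \<in> sets borel" "B \<subseteq> patch c"
      using pm sv spv by (auto simp: B_def space_restrict_space sets_restrict_space_iff)
    have "emeasure \<nu> Y = emeasure v B"
      unfolding \<nu>_def using cm Y pm spv
      by (subst emeasure_distr) (auto simp: space_restrict_space B_def emeasure_restrict_space)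
    also have "\<dots> = (\<integral>\<^sup>+z\<in>coord c ` B. ennreal (\<rho> c z) \<partial>lborel)"
      using V c B by (simp add: is_volume_measure_def)
    also have "coord c ` B = Y \<inter> coord_dom c" by (auto simp: B_def coord_dom_def)
    also have "(\<integral>\<^sup>+z\<in>Y \<inter> coord_dom c. ennreal (\<rho> c z) \<partial>lborel) = (\<integral>\<^sup>+z. d z * indicator Y z \<partial>lborel)"
      by (intro nn_integral_cong) (simp add: d_def indicator_def)
    also have "\<dots> = emeasure (density lborel d) Y"
      using Y by (subst emeasure_density) auto
    finally show "emeasure \<nu> Y = emeasure (density lborel d) Y" .
  qed
  define h where "h = (\<lambda>z. ennreal (indicator (coord_dom c) z *\<^sub>R k (param c z)) * indicator X z)"
  have ck: "continuous_on (coord_dom c) (\<lambda>z. k (param c z))"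
    by (rule continuous_on_compose2[OF k homeomorphism_cont2[OF hom]]) auto
  have hm[measurable]: "h \<in> borel_measurable borel"
    unfolding h_def using borel_measurable_continuous_on_indicator[OF dm ck] X(1) by measurable
  have "(\<integral>\<^sup>+z. ennreal (k (param c z) * \<rho> c z) * indicator X z \<partial>lborel) = (\<integral>\<^sup>+z. d z * h z \<partial>lborel)"
    using X(2) k0 \<rho>0 by (intro nn_integral_cong) (auto simp: d_def h_def indicator_def ennreal_mult'' less_imp_le mult.commute)
  also have "\<dots> = (\<integral>\<^sup>+z. h z \<partial>\<nu>)"
    unfolding \<open>\<nu> = density lborel d\<close> by (subst nn_integral_density) auto
  also have "\<dots> = (\<integral>\<^sup>+y. h (coord c y) \<partial>restrict_space v (patch c))"
    unfolding \<nu>_def by (rule nn_integral_distr[OF cm]) simp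
  also have "\<dots> = (\<integral>\<^sup>+y. h (coord c y) * indicator (patch c) y \<partial>v)"
    by (rule nn_integral_restrict_space[OF pm])
  also have "\<dots> \<le> (\<integral>\<^sup>+y. ennreal (k y) \<partial>v)"
  proof (rule nn_integral_mono)
    fix y
    have "param c (coord c y) = y" if "y \<in> patch c" using homeomorphism_apply1[OF hom that] .
    then show "h (coord c y) * indicator (patch c) y \<le> ennreal (k y)"
      by (auto simp: h_def indicator_def)
  qed
  finally show ?thesis .
qed

section \<open>Change of chart and averages over the circle\<close>

lemma chart_at:
  assumes "riemann_surface A"
  shows "chart_at A y \<in> A" "y \<in> patch (chart_at A y)"
proof -
  have "\<exists>c. c \<in> A \<and> y \<in> patch c" using assms unfolding riemann_surface_def by blast
  from someI_ex[OF this] show "chart_at A y \<in> A" "y \<in> patch (chart_at A y)"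
    by (auto simp: chart_at_def)
qed

lemma chart_homeomorphism:
  assumes "riemann_surface A" "c \<in> A"
  shows "open (patch c)" "open (coord_dom c)" "homeomorphism (patch c) (coord_dom c) (coord c) (param c)"
  using assms unfolding riemann_surface_def by auto

lemma chart_transition:
  assumes RS: "riemann_surface A" and c: "c \<in> A" and d: "d \<in> A"
  defines "O' \<equiv> coord c ` (patch c \<inter> patch d)" and "\<tau> \<equiv> coord d \<circ> param c"
  shows "open O'" "O' \<subseteq> coord_dom c" "\<tau> holomorphic_on O'" "\<tau> ` O' \<subseteq> coord_dom d"
    "\<And>z. z \<in> O' \<Longrightarrow> param d (\<tau> z) = param c z"
    "\<And>y. y \<in> patch c \<Longrightarrow> \<tau> (coord c y) = coord d y"
proof -
  note hc = chart_homeomorphism[OF RS c] and hd = chart_homeomorphism[OF RS d]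
  have pc: "param c (coord c y) = y" if "y \<in> patch c" for y using homeomorphism_apply1[OF hc(3) that] .
  have pd: "param d (coord d y) = y" if "y \<in> patch d" for y using homeomorphism_apply1[OF hd(3) that] .
  have "O' = coord_dom c \<inter> param c -` patch d"
    unfolding O'_def coord_dom_def by (auto simp: pc)
  moreover have "open (coord_dom c \<inter> param c -` patch d)"
    by (rule continuous_open_preimage[OF homeomorphism_cont2[OF hc(3)] hc(2) hd(1)])
  ultimately show "open O'" by simp
  show "O' \<subseteq> coord_dom c" by (auto simp: O'_def coord_dom_def)
  show "\<tau> holomorphic_on O'" using RS c d unfolding riemann_surface_def O'_def \<tau>_def by auto
  show "\<tau> ` O' \<subseteq> coord_dom d" by (auto simp: O'_def \<tau>_def pc coord_dom_def)
  show "param d (\<tau> z) = param c z" if "z \<in> O'" for z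
    using that by (auto simp: O'_def \<tau>_def pc pd)
  show "\<tau> (coord c y) = coord d y" if "y \<in> patch c" for y using pc[OF that] by (simp add: \<tau>_def)
qed

lemma flat_laplacian_cong:
  assumes S: "open S" "z \<in> S" and eq: "\<And>w. w \<in> S \<Longrightarrow> f w = g w"
  shows "flat_laplacian f z = flat_laplacian g z"
proof -
  have "partial_x f w = partial_x g w" "partial_y f w = partial_y g w" if "w \<in> S" for w
    using partials_cong[OF S(1) that, of f g] eq by blast+
  then show ?thesis
    unfolding flat_laplacian_def
    using partials_cong(1)[OF S, of "partial_x f" "partial_x g"] partials_cong(2)[OF S, of "partial_y f" "partial_y g"]
    by simp
qed

text \<open>The operator is defined through the chart that \<open>chart_at\<close> picks at each point. The transition
  map to the given chart is holomorphic, so the Laplacian and the density are multiplied by the same factor.\<close>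

lemma eigenfunction_in_chart:
  assumes RS: "riemann_surface A" and CM: "conformal_metric A \<rho>" and sm: "smooth_function A \<phi>"
    and eig: "\<And>y. laplace_beltrami A \<rho> \<phi> y = \<mu> * \<phi> y" and c: "c \<in> A" and z: "z \<in> coord_dom c"
  shows "flat_laplacian (\<phi> \<circ> param c) z = \<mu> * \<phi> (param c z) * of_real (\<rho> c z)"
proof -
  define y where "y = param c z"
  define d where "d = chart_at A y"
  note hc = chart_homeomorphism[OF RS c]
  have d: "d \<in> A" "y \<in> patch d" using chart_at[OF RS] by (auto simp: d_def)
  have yc: "y \<in> patch c" "coord c y = z"
    using z homeomorphism_image2[OF hc(3)] homeomorphism_apply2[OF hc(3) z] by (auto simp: y_def)
  let ?O = "coord c ` (patch c \<inter> patch d)" and ?\<tau> = "coord d \<circ> param c"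
  note tr = chart_transition[OF RS c d(1)]
  have zO: "z \<in> ?O" using yc d by force
  have "flat_laplacian (\<phi> \<circ> param c) z = flat_laplacian ((\<phi> \<circ> param d) \<circ> ?\<tau>) z"
    by (rule flat_laplacian_cong[OF tr(1) zO]) (use tr(5) in \<open>simp add: o_def\<close>)
  also have "\<dots> = (cmod (deriv ?\<tau> z))\<^sup>2 *\<^sub>R flat_laplacian (\<phi> \<circ> param d) (?\<tau> z)"
  proof (rule Ck2_holomorphic_comp(2)[OF _ tr(1) tr(3) tr(4) _ zO])
    show "open (coord_dom d)" using chart_homeomorphism[OF RS d(1)] by simp
    show "Ck_on 2 (coord_dom d) (\<phi> \<circ> param d)" using sm d(1) unfolding smooth_function_def smooth_on_def by blast
  qed
  also have "?\<tau> z = coord d y" using tr(6)[OF yc(1)] yc(2) by simp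
  also have "flat_laplacian (\<phi> \<circ> param d) (coord d y) = \<mu> * \<phi> y * of_real (\<rho> d (coord d y))"
  proof -
    have "\<rho> d (coord d y) > 0" using CM d by (auto simp: conformal_metric_def coord_dom_def)
    moreover have "flat_laplacian (\<phi> \<circ> param d) (coord d y) / of_real (\<rho> d (coord d y)) = \<mu> * \<phi> y"
      using eig[of y] by (simp add: laplace_beltrami_def Let_def d_def)
    ultimately show ?thesis by (simp add: field_simps)
  qed
  also have "(cmod (deriv ?\<tau> z))\<^sup>2 *\<^sub>R (\<mu> * \<phi> y * of_real (\<rho> d (coord d y))) = \<mu> * \<phi> y * of_real (\<rho> c z)"
  proof -
    have "\<rho> c z = \<rho> d (coord d (param c z)) * (cmod (deriv ?\<tau> z))\<^sup>2"
      by (rule CM[unfolded conformal_metric_def, THEN conjunct2, THEN bspec, OF c, THEN bspec, OF d(1), THEN bspec, OF zO])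
    then show ?thesis by (simp add: y_def scaleR_conv_of_real mult_ac)
  qed
  finally show ?thesis by (simp only: y_def)
qed

text \<open>As in \<open>eigenfunction_in_chart\<close>, the derivative of the transition map cancels between the density
  and the derivative of the curve.\<close>

lemma speed_in_chart:
  assumes RS: "riemann_surface A" and CM: "conformal_metric A \<rho>" and t: "continuous_on UNIV t"
    and c: "c \<in> A" and tc: "t \<theta> \<in> patch c" and dz: "((coord c \<circ> t) has_vector_derivative z') (at \<theta>)"
  shows "\<rho> c (coord c (t \<theta>)) * (cmod z')\<^sup>2 = (speed A \<rho> t \<theta>)\<^sup>2"
proof -
  define y where "y = t \<theta>"
  define d where "d = chart_at A y"
  have d: "d \<in> A" "y \<in> patch d" using chart_at[OF RS] by (auto simp: d_def)
  let ?O = "coord c ` (patch c \<inter> patch d)" and ?\<tau> = "coord d \<circ> param c"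
  note tr = chart_transition[OF RS c d(1)]
  note hc = chart_homeomorphism[OF RS c] and hd = chart_homeomorphism[OF RS d(1)]
  have zO: "coord c y \<in> ?O" using tc d by (auto simp: y_def)
  have "(?\<tau> has_field_derivative deriv ?\<tau> (coord c y)) (at (coord c y))"
    using holomorphic_derivI[OF tr(3) tr(1) zO] .
  then have "(?\<tau> \<circ> (coord c \<circ> t) has_vector_derivative z' * deriv ?\<tau> (coord c y)) (at \<theta>)"
    by (intro field_vector_diff_chain_at[OF dz]) (simp add: y_def)
  then have "(coord d \<circ> t has_vector_derivative z' * deriv ?\<tau> (coord c y)) (at \<theta>)"
  proof (rule has_vector_derivative_transform_within_open)
    show "open (t -` (patch c \<inter> patch d))" using t hc(1) hd(1) by (intro open_vimage open_Int)
    show "\<theta> \<in> t -` (patch c \<inter> patch d)" using tc d by (simp add: y_def)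
    show "(?\<tau> \<circ> (coord c \<circ> t)) u = (coord d \<circ> t) u" if "u \<in> t -` (patch c \<inter> patch d)" for u
      using tr(6)[of "t u"] that by simp
  qed
  then have vd: "vector_derivative (coord d \<circ> t) (at \<theta>) = z' * deriv ?\<tau> (coord c y)"
    by (rule vector_derivative_at)
  have "\<rho> d (coord d y) > 0" using CM d by (auto simp: conformal_metric_def coord_dom_def)
  then have "(speed A \<rho> t \<theta>)\<^sup>2 = \<rho> d (coord d y) * (cmod (z' * deriv ?\<tau> (coord c y)))\<^sup>2"
    by (simp add: speed_def Let_def power_mult_distrib vd[unfolded d_def y_def] d_def y_def)
  also have "\<dots> = \<rho> d (coord d (param c (coord c y))) * (cmod (deriv ?\<tau> (coord c y)))\<^sup>2 * (cmod z')\<^sup>2"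
    using homeomorphism_apply1[OF hc(3)] tc by (simp add: norm_mult power_mult_distrib y_def)
  also have "\<rho> d (coord d (param c (coord c y))) * (cmod (deriv ?\<tau> (coord c y)))\<^sup>2 = \<rho> c (coord c y)"
    using CM[unfolded conformal_metric_def, THEN conjunct2, THEN bspec, OF c, THEN bspec, OF d(1), THEN bspec, OF zO] by simp
  finally show ?thesis by (simp add: y_def)
qed

lemma smooth_function_continuous:
  assumes RS: "riemann_surface A" and sm: "smooth_function A \<phi>"
  shows "continuous_on UNIV \<phi>"
proof -
  have "continuous_on (patch c) \<phi>" if c: "c \<in> A" for c
  proof -
    note hc = chart_homeomorphism[OF RS c]
    have "Ck_on 0 (coord_dom c) (\<phi> \<circ> param c)" using sm c unfolding smooth_function_def smooth_on_def by blast
    then have "continuous_on (patch c) ((\<phi> \<circ> param c) \<circ> coord c)"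
      by (intro continuous_on_compose[OF homeomorphism_cont1[OF hc(3)]])
        (simp only: homeomorphism_image1[OF hc(3)] Ck_on.simps(1))
    then show ?thesis
      by (rule continuous_on_eq) (simp add: homeomorphism_apply1[OF hc(3)])
  qed
  then have "continuous_on (\<Union>c\<in>A. patch c) \<phi>"
    using chart_homeomorphism(1)[OF RS] by (intro continuous_on_open_UN) auto
  then show ?thesis using RS by (simp add: riemann_surface_def)
qed

lemma nn_integral_of_L2_norm_1:
  assumes "L2_norm v \<phi> = 1"
  shows "(\<integral>\<^sup>+y. ennreal ((cmod (\<phi> y))\<^sup>2) \<partial>v) = 1"
proof -
  have 1: "(\<integral>y. (cmod (\<phi> y))\<^sup>2 \<partial>v) = 1" using assms by (simp add: L2_norm_def)
  then have "integrable v (\<lambda>y. (cmod (\<phi> y))\<^sup>2)" using not_integrable_integral_eq[of v "\<lambda>y. (cmod (\<phi> y))\<^sup>2"] by auto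
  then show ?thesis using nn_integral_eq_integral[of v "\<lambda>y. (cmod (\<phi> y))\<^sup>2"] 1 by simp
qed

lemma integral_affine_substitution:
  fixes h :: "real \<Rightarrow> complex"
  assumes "a \<le> b" "s > 0" "continuous_on {s * (a - u)..s * (b - u)} h"
  shows "integral {a..b} (\<lambda>x. h (s * (x - u))) = integral {s * (a - u)..s * (b - u)} h / of_real s"
proof -
  have "((\<lambda>x. s *\<^sub>R h (s * (x - u))) has_integral integral {s * (a - u)..s * (b - u)} h) {a..b}"
    using assms by (intro has_integral_substitution[where c = "s * (a - u)" and d = "s * (b - u)"])
      (auto intro!: derivative_eq_intros)
  then have "((\<lambda>x. (1/s) *\<^sub>R (s *\<^sub>R h (s * (x - u)))) has_integral (1/s) *\<^sub>R integral {s * (a - u)..s * (b - u)} h) {a..b}"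
    by (rule has_integral_cmul)
  then have "integral {a..b} (\<lambda>x. (1/s) *\<^sub>R (s *\<^sub>R h (s * (x - u)))) = (1/s) *\<^sub>R integral {s * (a - u)..s * (b - u)} h"
    by (rule integral_unique)
  then show ?thesis using assms(2) by (simp add: scaleR_conv_of_real)
qed

text \<open>Neighbouring windows overlap by half, and there their weights are \<open>cos\<^sup>2\<close> and \<open>sin\<^sup>2\<close> of the
  same angle. By periodicity, the half of the first window to the left of 0 stands for
  the half window missing at the right end.\<close>

lemma periodic_integral_partition:
  fixes f :: "real \<Rightarrow> complex"
  assumes f: "continuous_on UNIV f" and per: "\<And>x. f (x + 1) = f x" and n: "n > 0"
  defines "h \<equiv> 1 / real n"
  shows "integral {0..1} f = (\<Sum>k<n. window_integral f (real k * h) h)"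
proof -
  have h: "h > 0" "real n * h = 1" using n by (auto simp: h_def)
  define w where "w = (\<lambda>(k::nat) x. of_real ((cos (pi / (2 * h) * (x - real k * h)))\<^sup>2) * f x)"
  have cw: "continuous_on S (w k)" for S k
    unfolding w_def by (intro continuous_intros continuous_on_subset[OF f]) auto
  define a b where "a = (\<lambda>k. integral {real k * h - h..real k * h} (w k))" and "b = (\<lambda>k. integral {real k * h..real k * h + h} (w k))"
  have int: "w k integrable_on {x..y}" for k x y by (intro integrable_continuous_real cw)
  have "integral {0..real m * h} f = (\<Sum>k<m. b k + a (Suc k))" for m
  proof (induction m)
    case 0
    then show ?case by simp
  next
    case (Suc m)
    have "w m x + w (Suc m) x = f x" for x
    proof -
      have "pi / (2 * h) * (x - real (Suc m) * h) = pi / (2 * h) * (x - real m * h) - pi / 2"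
        using h by (simp add: field_simps)
      then have "cos (pi / (2 * h) * (x - real (Suc m) * h)) = sin (pi / (2 * h) * (x - real m * h))"
        by (simp add: cos_diff)
      then show ?thesis unfolding w_def
        by (simp flip: distrib_right of_real_add of_real_power)
    qed
    then have "integral {real m * h..real m * h + h} f = integral {real m * h..real m * h + h} (\<lambda>x. w m x + w (Suc m) x)"
      by simp
    also have "\<dots> = b m + a (Suc m)"
      using integral_add[OF int int, of "real m * h" "real m * h + h" m "Suc m"]
      by (simp add: a_def b_def algebra_simps)
    finally have "integral {real m * h..real (Suc m) * h} f = b m + a (Suc m)" by (simp add: algebra_simps)
    moreover have "integral {0..real m * h} f + integral {real m * h..real (Suc m) * h} f = integral {0..real (Suc m) * h} f"
      by (rule Henstock_Kurzweil_Integration.integral_combine)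
        (use h in \<open>auto intro!: integrable_continuous_real continuous_on_subset[OF f] mult_right_mono\<close>)
    ultimately show ?case using Suc by simp
  qed
  from this[of n] have "integral {0..1} f = (\<Sum>k<n. b k + a (Suc k))" using h by simp
  also have "\<dots> = (\<Sum>k<n. b k) + (\<Sum>k<n. a (Suc k))" by (rule sum.distrib)
  also have "(\<Sum>k<n. a (Suc k)) = (\<Sum>k<n. a k) + (a n - a 0)"
    using sum_lessThan_telescope[of a n] by (simp add: sum_subtractf algebra_simps)
  also have "a n = a 0"
  proof -
    have w1: "w n x = w 0 (1 * (x - 1))" for x
    proof -
      have "f x = f (x - 1)" using per[of "x - 1"] by simp
      then show ?thesis using h by (simp add: w_def)
    qed
    have "a n = integral {1 - h..1} (\<lambda>x. w 0 (1 * (x - 1)))" unfolding a_def h(2) w1 ..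
    also have "\<dots> = a 0"
      using integral_affine_substitution[of "1 - h" 1 1 1 "w 0"] h cw by (simp add: a_def)
    finally show ?thesis .
  qed
  finally have "integral {0..1} f = (\<Sum>k<n. a k + b k)" by (simp add: sum.distrib)
  also have "\<dots> = (\<Sum>k<n. integral {real k * h - h..real k * h + h} (w k))"
    unfolding a_def b_def
    by (intro sum.cong refl Henstock_Kurzweil_Integration.integral_combine int) (use h in auto)
  finally show ?thesis by (simp add: w_def window_integral_def)
qed

section \<open>The bound on a window of the geodesic\<close>

text \<open>The inverse \<open>g\<close> of the strip coordinate around a point of the geodesic, on a domain containing a
  square around 0.\<close>

lemma geodesic_strip_chart:
  fixes A :: "'a::t2_space chart set"
  assumes H: "compact_hyperbolic_surface A \<rho>" and geo: "geodesic A \<rho> t"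
    and s: "s > 0" "\<And>\<theta>. speed A \<rho> t \<theta> = s"
  obtains c g w T e \<delta> where "c \<in> A" "open T" "g holomorphic_on T" "inj_on g T" "g ` T \<subseteq> coord_dom c"
    "continuous_on (g ` T) w" "\<And>u. u \<in> T \<Longrightarrow> w (g u) = u"
    "\<And>u. u \<in> T \<Longrightarrow> \<rho> c (g u) * (cmod (deriv g u))\<^sup>2 = 1 / (cos (Im u))\<^sup>2"
    "\<And>u. u \<in> T \<Longrightarrow> cos (Im u) > 0"
    "e > 0" "\<delta> > 0" "s * e \<le> \<delta>" "\<And>x y. \<bar>x\<bar> \<le> \<delta> \<Longrightarrow> \<bar>y\<bar> \<le> \<delta> \<Longrightarrow> Complex x y \<in> T"
    "\<And>\<theta>. \<bar>\<theta> - \<theta>0\<bar> \<le> e \<Longrightarrow> t \<theta> = param c (g (of_real (s * (\<theta> - \<theta>0))))"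
proof -
  have RS: "riemann_surface A" and CM: "conformal_metric A \<rho>"
    and K: "\<And>c z. c \<in> A \<Longrightarrow> z \<in> coord_dom c \<Longrightarrow> gauss_curvature (\<rho> c) z = -1"
    using H by (auto simp: compact_hyperbolic_surface_def)
  have ct: "continuous_on UNIV t" using geo by (simp add: geodesic_def)
  define c where "c = chart_at A (t \<theta>0)"
  have c: "c \<in> A" "t \<theta>0 \<in> patch c" using chart_at[OF RS] by (auto simp: c_def)
  note hc = chart_homeomorphism[OF RS c(1)]
  define z where "z = coord c \<circ> t"
  define z' where "z' = (\<lambda>s. vector_derivative z (at s))"
  define z'' where "z'' = (\<lambda>s. vector_derivative z' (at s))"
  have dz: "(z has_vector_derivative z' \<theta>) (at \<theta>)"
    and dz': "(z' has_vector_derivative z'' \<theta>) (at \<theta>)"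
    and gz: "z'' \<theta> + wirtinger_dz (\<lambda>u. ln (\<rho> c u)) (z \<theta>) * (z' \<theta>)\<^sup>2 = 0"
    and sp: "\<rho> c (z \<theta>) * (cmod (z' \<theta>))\<^sup>2 = s\<^sup>2"
    if \<theta>: "t \<theta> \<in> patch c" for \<theta>
  proof -
    have g: "z differentiable at \<theta>" "z' differentiable at \<theta>"
       "z'' \<theta> + wirtinger_dz (\<lambda>w. ln (\<rho> c w)) (z \<theta>) * (z' \<theta>)\<^sup>2 = 0"
      using geo[unfolded geodesic_def Let_def, THEN conjunct2, THEN bspec, OF c(1), THEN spec, of \<theta>] \<theta>
      unfolding z_def z'_def z''_def by auto
    show "(z has_vector_derivative z' \<theta>) (at \<theta>)" "(z' has_vector_derivative z'' \<theta>) (at \<theta>)"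
      using g(1,2) unfolding z'_def z''_def by (simp_all add: vector_derivative_works)
    then show "\<rho> c (z \<theta>) * (cmod (z' \<theta>))\<^sup>2 = s\<^sup>2"
      using speed_in_chart[OF RS CM ct c(1) \<theta>] s(2) by (simp add: z_def)
    show "z'' \<theta> + wirtinger_dz (\<lambda>u. ln (\<rho> c u)) (z \<theta>) * (z' \<theta>)\<^sup>2 = 0" using g(3) .
  qed
  define z0 where "z0 = z \<theta>0"
  have z0: "z0 \<in> coord_dom c" using c by (simp add: z0_def z_def coord_dom_def)
  \<comment> \<open>The unit tangent vector, which the coordinate sends to 1.\<close>
  define d where "d = z' \<theta>0 / of_real s"
  have sm: "smooth_on (coord_dom c) (\<rho> c)" and rpos: "\<And>z. z \<in> coord_dom c \<Longrightarrow> \<rho> c z > 0"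
    using CM c(1) by (auto simp: conformal_metric_def)
  have nd: "\<rho> c z0 * (cmod d)\<^sup>2 = 1"
    using sp[OF c(2)] s(1) by (simp add: d_def z0_def norm_divide power_divide)
  then have d0: "d \<noteq> 0" by auto
  have C3: "Ck_on 3 (coord_dom c) (\<rho> c)" using sm unfolding smooth_on_def by blast
  obtain R w where R: "R > 0" "ball z0 R \<subseteq> coord_dom c" "w holomorphic_on ball z0 R" "w z0 = 0" "deriv w z0 = 1 / d"
    and w0: "\<And>z. z \<in> ball z0 R \<Longrightarrow> deriv w z \<noteq> 0"
    and wI: "\<And>z. z \<in> ball z0 R \<Longrightarrow> \<bar>Im (w z)\<bar> < pi / 2"
    and wr: "\<And>z. z \<in> ball z0 R \<Longrightarrow> \<rho> c z = (cmod (deriv w z))\<^sup>2 / (cos (Im (w z)))\<^sup>2"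
    by (rule strip_coordinate[OF hc(2) C3 rpos K[OF c(1)] z0 nd]) blast+
  have z0R: "z0 \<in> ball z0 R" using R by simp
  obtain r where r: "r > 0" "ball z0 r \<subseteq> ball z0 R" "open (w ` ball z0 r)" "inj_on w (ball z0 r)"
    using has_complex_derivative_locally_invertible[OF R(3) z0R open_ball w0[OF z0R]] by blast
  define D where "D = ball z0 r"
  define T where "T = w ` D"
  have D: "open D" "z0 \<in> D" "D \<subseteq> ball z0 R" "inj_on w D" using r by (auto simp: D_def)
  have wD: "w holomorphic_on D" using R(3) D(3) by (rule holomorphic_on_subset)
  obtain g where g: "g holomorphic_on T" "\<And>z. z \<in> D \<Longrightarrow> deriv w z * deriv g (w z) = 1" "\<And>z. z \<in> D \<Longrightarrow> g (w z) = z"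
    unfolding T_def using holomorphic_has_inverse[OF wD D(1,4)] by blast
  have T: "open T" "0 \<in> T" using r(3) D(2) R(4) by (auto simp: T_def D_def intro: rev_image_eqI)
  have gT: "g u \<in> D" "w (g u) = u" if "u \<in> T" for u using that g(3) by (auto simp: T_def)
  have gTD: "g ` T \<subseteq> D" using gT by auto
  obtain \<eta> where \<eta>: "\<eta> > 0" "ball 0 \<eta> \<subseteq> T" using T open_contains_ball by blast
  define \<delta> where "\<delta> = \<eta> / 3"
  have rect: "Complex x y \<in> T" if "\<bar>x\<bar> \<le> \<delta>" "\<bar>y\<bar> \<le> \<delta>" for x y
  proof -
    have "cmod (Complex x y) \<le> \<bar>x\<bar> + \<bar>y\<bar>" using cmod_le[of "Complex x y"] by simp
    also have "\<dots> < \<eta>" using that \<eta> by (simp add: \<delta>_def)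
    finally show ?thesis using \<eta>(2) by (auto simp: dist_norm)
  qed
  define N where "N = t -` (patch c \<inter> coord c -` D)"
  have "open (patch c \<inter> coord c -` D)"
    by (rule continuous_open_preimage[OF homeomorphism_cont1[OF hc(3)] hc(1) D(1)])
  then have "open N" unfolding N_def by (rule open_vimage[OF _ ct])
  moreover have "\<theta>0 \<in> N" using c(2) D(2) by (simp add: N_def z0_def z_def)
  ultimately obtain e0 where e0: "e0 > 0" "ball \<theta>0 e0 \<subseteq> N" using open_contains_ball by blast
  define e where "e = min (e0 / 2) (\<delta> / s)"
  have \<delta>0: "\<delta> > 0" using \<eta> by (simp add: \<delta>_def)
  have e: "e > 0" "s * e \<le> \<delta>"
  proof -
    show "e > 0" using e0 s(1) \<delta>0 by (simp add: e_def)
    have "s * e \<le> s * (\<delta> / s)" using s(1) by (intro mult_left_mono) (auto simp: e_def)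
    then show "s * e \<le> \<delta>" using s(1) by simp
  qed
  have inN: "t \<theta> \<in> patch c" "z \<theta> \<in> D" if "\<bar>\<theta> - \<theta>0\<bar> \<le> e" for \<theta>
  proof -
    have "\<theta> \<in> ball \<theta>0 e0" using that e0(1) by (auto simp: e_def dist_real_def abs_minus_commute[of \<theta>0 \<theta>])
    then have "\<theta> \<in> N" using e0(2) by blast
    then show "t \<theta> \<in> patch c" "z \<theta> \<in> D" by (auto simp: N_def z_def)
  qed
  have straight: "w (z \<theta>) = of_real (s * (\<theta> - \<theta>0))" if \<theta>: "\<bar>\<theta> - \<theta>0\<bar> \<le> e" for \<theta>
  proof (rule geodesic_straight_in_strip[where w = w and z = z and t = \<theta> and ?t0.0 = \<theta>0 and s = s and D = D and r = "\<rho> c" and z' = z' and z'' = z'' and e = e])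
    show "w (z \<theta>0) = 0" using R(4) by (simp add: z0_def)
    show "deriv w (z \<theta>0) * z' \<theta>0 = of_real s"
      using R(5) d0 s(1) by (simp add: d_def flip: z0_def)
    show "deriv w u \<noteq> 0" "\<bar>Im (w u)\<bar> < pi / 2" "\<rho> c u = (cmod (deriv w u))\<^sup>2 / (cos (Im (w u)))\<^sup>2"
      if "u \<in> D" for u
      using w0[OF subsetD[OF D(3) that]] wI[OF subsetD[OF D(3) that]] wr[OF subsetD[OF D(3) that]] .
    show "z u \<in> D" "(z has_vector_derivative z' u) (at u)" "(z' has_vector_derivative z'' u) (at u)"
      "z'' u + wirtinger_dz (\<lambda>u. ln (\<rho> c u)) (z u) * (z' u)\<^sup>2 = 0" "\<rho> c (z u) * (cmod (z' u))\<^sup>2 = s\<^sup>2"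
      if "\<bar>u - \<theta>0\<bar> \<le> e" for u
      using inN(2)[OF that] dz[OF inN(1)[OF that]] dz'[OF inN(1)[OF that]] gz[OF inN(1)[OF that]] sp[OF inN(1)[OF that]] .
  qed (fact D(1) wD \<theta>)+
  have tg: "t \<theta> = param c (g (of_real (s * (\<theta> - \<theta>0))))" if "\<bar>\<theta> - \<theta>0\<bar> \<le> e" for \<theta>
  proof -
    have "g (of_real (s * (\<theta> - \<theta>0))) = z \<theta>" using straight[OF that] g(3)[OF inN(2)[OF that]] by metis
    then show ?thesis using homeomorphism_apply1[OF hc(3) inN(1)[OF that]] by (simp add: z_def)
  qed
  have density: "\<rho> c (g u) * (cmod (deriv g u))\<^sup>2 = 1 / (cos (Im u))\<^sup>2" if u: "u \<in> T" for u
  proof -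
    have "deriv w (g u) * deriv g u = 1" using g(2)[OF gT(1)[OF u]] gT(2)[OF u] by simp
    then have "(cmod (deriv w (g u)))\<^sup>2 * (cmod (deriv g u))\<^sup>2 = 1"
      by (metis norm_mult norm_one one_power2 power_mult_distrib)
    moreover have "\<rho> c (g u) = (cmod (deriv w (g u)))\<^sup>2 / (cos (Im u))\<^sup>2"
      using wr[of "g u"] gT[OF u] D(3) by auto
    ultimately show ?thesis by simp
  qed
  have cosT: "cos (Im u) > 0" if u: "u \<in> T" for u
    using wI[of "g u"] gT[OF u] D(3) by (intro cos_gt_zero_pi) auto
  have inj: "inj_on g T" using gT(2) by (metis inj_onI)
  have cw: "continuous_on (g ` T) w"
    using wD gTD by (meson continuous_on_subset holomorphic_on_imp_continuous_on)
  have gc: "g ` T \<subseteq> coord_dom c" using gTD D(3) R(2) by blast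
  show thesis
    by (rule that[OF c(1) T(1) g(1) inj gc cw gT(2) density cosT e(1) \<delta>0 e(2) rect tg])
qed

text \<open>On a window short enough to lie in one strip chart, \<open>strip_average_bound\<close> applies to the
  eigenfunction read in that chart. The strip chart is injective, so the \<open>L\<^sup>2\<close> norm over the
  rectangle is at most the norm over the whole surface.\<close>

lemma local_period_bound:
  fixes A :: "'a::t2_space chart set"
  assumes H: "compact_hyperbolic_surface A \<rho>" and V: "is_volume_measure A \<rho> v" and geo: "geodesic A \<rho> t"
    and s: "s > 0" "\<And>\<theta>. speed A \<rho> t \<theta> = s"
  obtains e where "e > 0"
    "\<And>\<theta>1 h. h > 0 \<Longrightarrow> {\<theta>1 - h..\<theta>1 + h} \<subseteq> ball \<theta>0 e \<Longrightarrow>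
      \<exists>C. \<forall>\<phi>. eigenfunction A \<rho> \<phi> \<and> L2_norm v \<phi> = 1 \<longrightarrow>
        cmod (window_integral (\<lambda>\<theta>. \<phi> (t \<theta>)) \<theta>1 h) \<le> C"
proof -
  have RS: "riemann_surface A" and CM: "conformal_metric A \<rho>"
    using H by (auto simp: compact_hyperbolic_surface_def)
  obtain c g w T e \<delta> where c: "c \<in> A" and T: "open T" and g: "g holomorphic_on T" "inj_on g T" "g ` T \<subseteq> coord_dom c"
    and w: "continuous_on (g ` T) w" "\<And>u. u \<in> T \<Longrightarrow> w (g u) = u"
    and density: "\<And>u. u \<in> T \<Longrightarrow> \<rho> c (g u) * (cmod (deriv g u))\<^sup>2 = 1 / (cos (Im u))\<^sup>2"
    and cosT: "\<And>u. u \<in> T \<Longrightarrow> cos (Im u) > 0"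
    and e: "e > 0" "\<delta> > 0" "s * e \<le> \<delta>" and rect: "\<And>x y. \<bar>x\<bar> \<le> \<delta> \<Longrightarrow> \<bar>y\<bar> \<le> \<delta> \<Longrightarrow> Complex x y \<in> T"
    and tg: "\<And>\<theta>. \<bar>\<theta> - \<theta>0\<bar> \<le> e \<Longrightarrow> t \<theta> = param c (g (of_real (s * (\<theta> - \<theta>0))))"
    by (rule geodesic_strip_chart[OF H geo s, where ?\<theta>0.0 = \<theta>0]) blast+
  note hc = chart_homeomorphism[OF RS c]
  show thesis
  proof (rule that[OF e(1)])
    fix \<theta>1 h :: real assume h: "h > 0" and sub: "{\<theta>1 - h..\<theta>1 + h} \<subseteq> ball \<theta>0 e"
    define x0 l where "x0 = s * (\<theta>1 - \<theta>0)" and "l = s * h"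
    have l: "l > 0" using h s by (simp add: l_def)
    have xd: "\<bar>x\<bar> \<le> \<delta>" if "\<bar>x - x0\<bar> \<le> l" for x
    proof -
      have "\<theta>1 - h \<in> ball \<theta>0 e" "\<theta>1 + h \<in> ball \<theta>0 e" using h by (intro subsetD[OF sub]; simp)+
      then have "\<theta>1 + h - \<theta>0 \<le> e" "- e \<le> \<theta>1 - h - \<theta>0" by (auto simp: dist_real_def)
      then have "s * (\<theta>1 + h - \<theta>0) \<le> s * e" "s * (- e) \<le> s * (\<theta>1 - h - \<theta>0)"
        using s(1) by (intro mult_left_mono; simp)+
      moreover have "x \<le> s * (\<theta>1 + h - \<theta>0)" "s * (\<theta>1 - h - \<theta>0) \<le> x"
        using that by (auto simp: x0_def l_def abs_le_iff algebra_simps)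
      ultimately show ?thesis using e(3) by auto
    qed
    define d where "d = min (\<delta> / 2) 1"
    have d: "0 < d" "d < \<delta>" "d \<le> 1" using e(2) by (auto simp: d_def)
    define B where "B = 855 / d ^ 5 * ((1 + 4 * (pi / (2 * l)) ^ 4) * l)"
    have B0: "B \<ge> 0" using d l by (simp add: B_def)
    show "\<exists>C. \<forall>\<phi>. eigenfunction A \<rho> \<phi> \<and> L2_norm v \<phi> = 1 \<longrightarrow>
        cmod (window_integral (\<lambda>\<theta>. \<phi> (t \<theta>)) \<theta>1 h) \<le> C"
    proof (intro exI[of _ "sqrt B / s"] allI impI)
      fix \<phi> assume as: "eigenfunction A \<rho> \<phi> \<and> L2_norm v \<phi> = 1"
      then obtain \<mu> where sm: "smooth_function A \<phi>" and eig: "\<And>y. laplace_beltrami A \<rho> \<phi> y = \<mu> * \<phi> y"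
        by (auto simp: eigenfunction_def)
      define f where "f = (\<phi> \<circ> param c) \<circ> g"
      have C2: "Ck_on 2 (coord_dom c) (\<phi> \<circ> param c)" using sm c unfolding smooth_function_def smooth_on_def by blast
      note f2 = Ck2_holomorphic_comp[OF hc(2) T g(1,3) C2, folded f_def]
      have feig: "flat_laplacian f u = \<mu> * of_real (1 / (cos (Im u))\<^sup>2) * f u" if u: "u \<in> T" for u
      proof -
        have "g u \<in> coord_dom c" using g(3) u by blast
        from eigenfunction_in_chart[OF RS CM sm eig c this]
        have "flat_laplacian f u = (cmod (deriv g u))\<^sup>2 *\<^sub>R (\<mu> * \<phi> (param c (g u)) * of_real (\<rho> c (g u)))"
          using f2(2)[OF u] by simp
        also have "\<dots> = \<mu> * of_real (\<rho> c (g u) * (cmod (deriv g u))\<^sup>2) * f u"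
          by (simp add: f_def scaleR_conv_of_real mult_ac)
        finally show ?thesis unfolding density[OF u] .
      qed
      have strip: "(cmod (window_integral (\<lambda>x. f (of_real x)) x0 l))\<^sup>2
        \<le> B * integral {-d..d} (\<lambda>y. integral {x0 - l..x0 + l} (\<lambda>x. (cmod (f (Complex x y)))\<^sup>2))"
        unfolding B_def
        by (rule strip_average_bound[OF T f2(1) _ d l feig]) (use rect xd in auto)
      \<comment> \<open>The factor \<open>cos\<^sup>2\<close> cancels the density of the strip metric, so that \<open>F\<close> pulls back to \<open>|f|\<^sup>2\<close>.\<close>
      define F where "F = (\<lambda>z. (cmod (\<phi> (param c z)))\<^sup>2 * \<rho> c z * (cos (Im (w z)))\<^sup>2)"
      have c\<phi>: "continuous_on UNIV \<phi>" by (rule smooth_function_continuous[OF RS sm])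
      have "Ck_on 0 (coord_dom c) (\<rho> c)" using CM c unfolding conformal_metric_def smooth_on_def by blast
      then have c\<rho>: "continuous_on (coord_dom c) (\<rho> c)" by simp
      have rpos: "\<And>z. z \<in> coord_dom c \<Longrightarrow> \<rho> c z > 0" using CM c by (auto simp: conformal_metric_def)
      have cF: "continuous_on (g ` T) F"
        unfolding F_def
        by (intro continuous_intros w(1) continuous_on_subset[OF c\<rho> g(3)]
            continuous_on_compose2[OF c\<phi> continuous_on_subset[OF homeomorphism_cont2[OF hc(3)] g(3)]]) auto
      have F0: "F z \<ge> 0" if "z \<in> g ` T" for z using rpos[OF subsetD[OF g(3) that]] by (simp add: F_def)
      have Fg: "(cmod (deriv g u))\<^sup>2 * F (g u) = (cmod (f u))\<^sup>2" if u: "u \<in> T" for u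
      proof -
        have "(cmod (deriv g u))\<^sup>2 * F (g u) = (cmod (f u))\<^sup>2 * (\<rho> c (g u) * (cmod (deriv g u))\<^sup>2) * (cos (Im u))\<^sup>2"
          using w(2)[OF u] by (simp add: F_def f_def)
        then show ?thesis unfolding density[OF u] using cosT[OF u] by simp
      qed
      let ?Q = "cbox (Complex (x0 - l) (-d)) (Complex (x0 + l) d)"
      have QT: "?Q \<subseteq> T"
      proof
        fix u assume u: "u \<in> ?Q"
        then have "\<bar>Re u - x0\<bar> \<le> l" "\<bar>Im u\<bar> \<le> \<delta>" using d by (auto simp: in_cbox_complex_iff)
        then show "u \<in> T" using rect[of "Re u" "Im u"] xd by auto
      qed
      have "ennreal (integral {-d..d} (\<lambda>y. integral {x0 - l..x0 + l} (\<lambda>x. (cmod (f (Complex x y)))\<^sup>2)))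
        = ennreal (integral {-d..d} (\<lambda>y. integral {x0 - l..x0 + l} (\<lambda>x. (cmod (deriv g (Complex x y)))\<^sup>2 * F (g (Complex x y)))))"
      proof -
        have "(cmod (f (Complex x y)))\<^sup>2 = (cmod (deriv g (Complex x y)))\<^sup>2 * F (g (Complex x y))"
          if "y \<in> {-d..d}" "x \<in> {x0 - l..x0 + l}" for x y
          using that QT by (intro Fg[symmetric]) (auto simp: in_cbox_complex_iff)
        then show ?thesis by (intro arg_cong[where f = ennreal] integral_cong) auto
      qed
      also have "\<dots> = (\<integral>\<^sup>+z. ennreal (F z) * indicator (g ` ?Q) z \<partial>lborel)"
        by (rule conformal_change_of_variables[OF T g(1,2) QT cF F0, symmetric])
      also have "\<dots> \<le> (\<integral>\<^sup>+z. ennreal ((cmod (\<phi> (param c z)))\<^sup>2 * \<rho> c z) * indicator (g ` ?Q) z \<partial>lborel)"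
      proof (rule nn_integral_mono)
        fix z
        show "ennreal (F z) * indicator (g ` ?Q) z \<le> ennreal ((cmod (\<phi> (param c z)))\<^sup>2 * \<rho> c z) * indicator (g ` ?Q) z"
        proof (cases "z \<in> g ` ?Q")
          case True
          then have "z \<in> coord_dom c" using QT g(3) by blast
          then have "0 \<le> (cmod (\<phi> (param c z)))\<^sup>2 * \<rho> c z" using rpos by (simp add: less_imp_le)
          then have "F z \<le> (cmod (\<phi> (param c z)))\<^sup>2 * \<rho> c z * 1"
            unfolding F_def by (intro mult_left_mono) (auto simp: abs_square_le_1)
          then show ?thesis by (intro mult_right_mono ennreal_leI) auto
        qed simp
      qed
      also have "\<dots> \<le> (\<integral>\<^sup>+y. ennreal ((cmod (\<phi> y))\<^sup>2) \<partial>v)"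
      proof (rule volume_in_chart[OF RS CM V c])
        show "continuous_on UNIV (\<lambda>y. (cmod (\<phi> y))\<^sup>2)" by (intro continuous_intros c\<phi>)
        have "compact (g ` ?Q)"
          by (rule compact_continuous_image[OF continuous_on_subset[OF holomorphic_on_imp_continuous_on[OF g(1)] QT]]) simp
        then show "g ` ?Q \<in> sets borel" by (rule borel_compact)
        show "g ` ?Q \<subseteq> coord_dom c" using QT g(3) by blast
      qed simp
      also have "\<dots> = 1" using nn_integral_of_L2_norm_1 as by blast
      finally have "integral {-d..d} (\<lambda>y. integral {x0 - l..x0 + l} (\<lambda>x. (cmod (f (Complex x y)))\<^sup>2)) \<le> 1" by simp
      then have "B * integral {-d..d} (\<lambda>y. integral {x0 - l..x0 + l} (\<lambda>x. (cmod (f (Complex x y)))\<^sup>2)) \<le> B * 1"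
        using B0 by (rule mult_left_mono)
      then have "(cmod (window_integral (\<lambda>x. f (of_real x)) x0 l))\<^sup>2 \<le> B"
        using strip by simp
      then have sB: "cmod (window_integral (\<lambda>x. f (of_real x)) x0 l) \<le> sqrt B"
        by (rule real_le_rsqrt)
      define k where "k = (\<lambda>x. of_real ((cos (pi / (2 * l) * (x - x0)))\<^sup>2) * f (of_real x))"
      have ends: "s * (\<theta>1 - h - \<theta>0) = x0 - l" "s * (\<theta>1 + h - \<theta>0) = x0 + l"
        by (simp_all add: x0_def l_def algebra_simps)
      have ck: "continuous_on {x0 - l..x0 + l} k"
      proof -
        have "continuous_on T f" using Ck_on_diffD[OF _ T] f2(1)
          by (metis continuous_at_imp_continuous_on differentiable_imp_continuous_within numeral_2_eq_2)
        then have "continuous_on {x0 - l..x0 + l} (\<lambda>x. f (of_real x))"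
        proof (rule continuous_on_compose2)
          show "of_real ` {x0 - l..x0 + l} \<subseteq> T"
          proof
            fix u :: complex assume "u \<in> of_real ` {x0 - l..x0 + l}"
            then obtain x where x: "u = of_real x" "\<bar>x - x0\<bar> \<le> l" by auto
            then show "u \<in> T" using rect[OF xd[OF x(2)], of 0] e(2) by (simp add: complex_of_real_def)
          qed
        qed (intro continuous_intros)
        then show ?thesis unfolding k_def by (intro continuous_intros) auto
      qed
      have "window_integral (\<lambda>\<theta>. \<phi> (t \<theta>)) \<theta>1 h
        = integral {\<theta>1 - h..\<theta>1 + h} (\<lambda>\<theta>. k (s * (\<theta> - \<theta>0)))"
        unfolding window_integral_def
      proof (rule integral_cong)
        fix \<theta> assume "\<theta> \<in> {\<theta>1 - h..\<theta>1 + h}"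
        then have "\<theta> \<in> ball \<theta>0 e" using sub by blast
        then have "\<phi> (t \<theta>) = f (of_real (s * (\<theta> - \<theta>0)))"
          using tg[of \<theta>] by (simp add: f_def dist_real_def)
        moreover have "pi / (2 * l) * (s * (\<theta> - \<theta>0) - x0) = pi / (2 * h) * (\<theta> - \<theta>1)"
          using s(1) h by (simp add: l_def x0_def field_simps)
        ultimately show "of_real ((cos (pi / (2 * h) * (\<theta> - \<theta>1)))\<^sup>2) * \<phi> (t \<theta>) = k (s * (\<theta> - \<theta>0))"
          by (simp only: k_def)
      qed
      also have "\<dots> = integral {x0 - l..x0 + l} k / of_real s"
        using integral_affine_substitution[of "\<theta>1 - h" "\<theta>1 + h" s \<theta>0 k] h s(1) ck unfolding ends by simp
      finally show "cmod (window_integral (\<lambda>\<theta>. \<phi> (t \<theta>)) \<theta>1 h) \<le> sqrt B / s"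
        using sB s(1) by (simp add: norm_divide k_def window_integral_def divide_right_mono)
    qed
  qed
qed

theorem corollaryB:
  fixes A :: "'a::t2_space chart set"
    and \<rho> :: "'a chart \<Rightarrow> complex \<Rightarrow> real"
    and v :: "'a measure"
    and t :: "real \<Rightarrow> 'a"
  assumes "compact_hyperbolic_surface A \<rho>"
    and "is_volume_measure A \<rho> v"
    and "closed_geodesic A \<rho> t"
  shows "\<exists>C>0. \<forall>\<phi>. eigenfunction A \<rho> \<phi> \<and> L2_norm v \<phi> = 1 \<longrightarrow>
           cmod (geodesic_period A \<rho> t \<phi>) \<le> C"
proof -
  have geo: "geodesic A \<rho> t" and per: "\<And>\<theta>. t (\<theta> + 1) = t \<theta>"
    using assms(3) by (auto simp: closed_geodesic_def)
  obtain s where s: "s > 0" "\<And>\<theta>. speed A \<rho> t \<theta> = s"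
    using assms(3) by (auto simp: closed_geodesic_def)
  have RS: "riemann_surface A" using assms(1) by (simp add: compact_hyperbolic_surface_def)
  have ct: "continuous_on UNIV t" using geo by (simp add: geodesic_def)
  define good where "good = (\<lambda>\<theta>1 h C. \<forall>\<phi>. eigenfunction A \<rho> \<phi> \<and> L2_norm v \<phi> = 1 \<longrightarrow>
        cmod (window_integral (\<lambda>\<theta>. \<phi> (t \<theta>)) \<theta>1 h) \<le> C)"
  have "\<exists>e>0. \<forall>\<theta>1 h. h > 0 \<longrightarrow> {\<theta>1 - h..\<theta>1 + h} \<subseteq> ball \<theta>0 e \<longrightarrow> (\<exists>C. good \<theta>1 h C)" for \<theta>0
    by (rule local_period_bound[OF assms(1,2) geo s, of \<theta>0]) (unfold good_def, blast)
  then obtain e where e: "\<And>\<theta>0. e \<theta>0 > 0"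
    "\<And>\<theta>0 \<theta>1 h. h > 0 \<Longrightarrow> {\<theta>1 - h..\<theta>1 + h} \<subseteq> ball \<theta>0 (e \<theta>0) \<Longrightarrow> \<exists>C. good \<theta>1 h C"
    by metis
  obtain \<delta> where \<delta>: "\<delta> > 0" "\<And>X. X \<subseteq> {-1..2} \<Longrightarrow> diameter X < \<delta> \<Longrightarrow> \<exists>B\<in>range (\<lambda>\<theta>0. ball \<theta>0 (e \<theta>0)). X \<subseteq> B"
  proof (rule Lebesgue_number_lemma[of "{-1..2::real}" "range (\<lambda>\<theta>0. ball \<theta>0 (e \<theta>0))"])
    show "{-1..2} \<subseteq> \<Union> (range (\<lambda>\<theta>0. ball \<theta>0 (e \<theta>0)))" 
    proof
      fix x :: real
      show "x \<in> \<Union> (range (\<lambda>\<theta>0. ball \<theta>0 (e \<theta>0)))" using e(1)[of x] by (intro UN_I[of x]) auto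
    qed
  qed auto
  obtain n :: nat where n: "n > 0" "2 / real n < \<delta>"
  proof -
    obtain n where "real n > 2 / \<delta>" using reals_Archimedean2 by blast
    moreover have "2 / \<delta> > 0" using \<delta>(1) by simp
    ultimately have r: "real n > 0" "real n > 2 / \<delta>" by linarith+
    have "2 / real n < \<delta>" using r(2) \<delta>(1) by (simp add: pos_divide_less_eq[OF r(1)] field_simps)
    then show ?thesis using r(1) by (intro that[of n]) auto
  qed
  define h where "h = 1 / real n"
  have h: "h > 0" "h \<le> 1" "2 * h < \<delta>" using n by (auto simp: h_def)
  have "\<exists>C. good (real k * h) h C" if "k < n" for k
  proof -
    have "real k * h \<le> real n * h" using that h(1) by (intro mult_right_mono) auto
    also have "real n * h = 1" using n by (simp add: h_def)
    finally have "real k * h \<le> 1" .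
    moreover have "0 \<le> real k * h" using h(1) by simp
    ultimately have "-1 \<le> real k * h - h" "real k * h + h \<le> 2" using h by linarith+
    then have "{real k * h - h..real k * h + h} \<subseteq> {-1..2}" by auto
    moreover have "diameter {real k * h - h..real k * h + h} < \<delta>" using h by simp
    ultimately obtain \<theta>0 where "{real k * h - h..real k * h + h} \<subseteq> ball \<theta>0 (e \<theta>0)" using \<delta>(2) by blast
    then show ?thesis by (rule e(2)[OF h(1)])
  qed
  then obtain C where C: "\<And>k. k < n \<Longrightarrow> good (real k * h) h (C k)" by metis
  have len: "curve_length A \<rho> t = s"
  proof -
    have "speed A \<rho> t = (\<lambda>_. s)" using s(2) by (intro ext)
    then show ?thesis by (simp add: curve_length_def)
  qed
  show ?thesis
  proof (intro exI[of _ "s * (\<Sum>k<n. \<bar>C k\<bar>) + 1"] conjI allI impI)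
    show "s * (\<Sum>k<n. \<bar>C k\<bar>) + 1 > 0" using s(1) by (simp add: add_nonneg_pos sum_nonneg)
    fix \<phi> assume as: "eigenfunction A \<rho> \<phi> \<and> L2_norm v \<phi> = 1"
    have c\<phi>: "continuous_on UNIV \<phi>"
      using as by (intro smooth_function_continuous[OF RS]) (simp add: eigenfunction_def)
    have "cmod (integral {0..1} (\<lambda>\<theta>. \<phi> (t \<theta>))) \<le> (\<Sum>k<n. \<bar>C k\<bar>)"
    proof -
      have "integral {0..1} (\<lambda>\<theta>. \<phi> (t \<theta>)) = (\<Sum>k<n. window_integral (\<lambda>\<theta>. \<phi> (t \<theta>)) (real k * h) h)"
        unfolding h_def
        by (rule periodic_integral_partition[OF continuous_on_compose2[OF c\<phi> ct] _ n(1)]) (auto simp: per)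
      also have "cmod \<dots> \<le> (\<Sum>k<n. \<bar>C k\<bar>)"
      proof (rule sum_norm_le)
        fix k assume "k \<in> {..<n}"
        then have "good (real k * h) h (C k)" using C by simp
        then show "cmod (window_integral (\<lambda>\<theta>. \<phi> (t \<theta>)) (real k * h) h) \<le> \<bar>C k\<bar>"
          unfolding good_def using as abs_ge_self order_trans by blast
      qed
      finally show ?thesis .
    qed
    then have "s * cmod (integral {0..1} (\<lambda>\<theta>. \<phi> (t \<theta>))) \<le> s * (\<Sum>k<n. \<bar>C k\<bar>)"
      using s(1) by (intro mult_left_mono) auto
    moreover have "cmod (geodesic_period A \<rho> t \<phi>) = s * cmod (integral {0..1} (\<lambda>\<theta>. \<phi> (t \<theta>)))"
      using s(1) by (simp add: geodesic_period_def len norm_mult mult.commute)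
    ultimately show "cmod (geodesic_period A \<rho> t \<phi>) \<le> s * (\<Sum>k<n. \<bar>C k\<bar>) + 1" by linarith
  qed
qed

end
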